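(* For every positive integer $n$, \[ W_{14}(n)=\frac{1}{600}\sigma_3(n)+\frac{1}{150}\sigma_3\left(\frac{n}{2}\right)+\frac{49}{600}\sigma_3\left(\frac{n}{7}\right)+\frac{49}{150}\sigma_3\left(\frac{n}{14}\right)-\frac{1}{56}n\sigma_1(n)-\frac{1}{4}n\sigma_1\left(\frac{n}{14}\right)+\frac{1}{24}\sigma_1(n)+\frac{1}{24}\sigma_1\left(\frac{n}{14}\right)-\frac{3}{350}\tau_{4,7}(n)-\frac{6}{175}\tau_{4,7}\left(\frac{n}{2}\right)-\frac{1}{84}\tau_{4,14,1}(n)-\frac{1}{200}\tau_{4,14,2}(n). \]
   Context: For positive integers $j,n$ let $\sigma_j(n)=\sum_{d\mid n}d^j$; set $\sigma_j(x)=0$ and $\tau_\ast(x)=0$ for $x\notin\mathbb{N}^*$ for every arithmetic function $\tau_\ast$ below. For $N\in\mathbb{N}^*$ let $W_N(n)=\sum_{m}\sigma_1(m)\sigma_1(n-Nm)$, summed over positive integers $m<n/N$. Write $q=e^{2\pi iz}$. Let $\Delta_{4,7}=\sum_{n\ge1}\tau_{4,7}(n)q^n$ be the unique cusp form of weight $4$ on $\Gamma_0(7)$ with expansion $q+O(q^2)$ (the cusp space is one-dimensional; $\Delta_{4,7}=q-q^2-2q^3-\cdots$). There are exactly two primitive forms (normalized newforms, Hecke eigenforms with first coefficient $1$) of weight $4$ on $\Gamma_0(14)$, both with rational coefficients: $\Delta_{4,14,1}=q+2q^2+O(q^3)$ and $\Delta_{4,14,2}=q-2q^2+O(q^3)$;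 write $\Delta_{4,14,i}=\sum_{n\ge1}\tau_{4,14,i}(n)q^n$. *)

theory Defs
  imports "HOL-Complex_Analysis.Complex_Analysis"
begin

definition divisor_sigma :: "nat \<Rightarrow> nat \<Rightarrow> nat" where
  "divisor_sigma j n = (\<Sum>d | d dvd n. d ^ j)"

text \<open>
  Extension by zero of an arithmetic function on the positive integers to rational arguments;
  the value of the given function at \<open>0\<close> is never used.
\<close>

definition zero_ext :: "(nat \<Rightarrow> 'a::zero) \<Rightarrow> rat \<Rightarrow> 'a" where
  "zero_ext f x = (if \<exists>m>0. x = of_nat m then f (nat \<lfloor>x\<rfloor>) else 0)"

lemma zero_ext_divide:
  assumes "n > 0" "d > 0"
  shows "zero_ext f (of_nat n / of_nat d) = (if d dvd n then f (n div d) else 0)"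
proof (cases "d dvd n")
  case True
  then obtain m where m: "n = d * m" by blast
  then show ?thesis using assms by (auto simp: zero_ext_def)
next
  case False
  have "d dvd n" if "(of_nat n / of_nat d :: rat) = of_nat m" for m
  proof -
    have "of_nat n = (of_nat (m * d) :: rat)" using that assms by (simp add: field_simps)
    then have "n = m * d" by (simp only: of_nat_eq_iff)
    then show ?thesis by simp
  qed
  then show ?thesis using False by (auto simp: zero_ext_def)
qed

definition conv_W :: "nat \<Rightarrow> nat \<Rightarrow> nat" where
  "conv_W N n = (\<Sum>m | 0 < m \<and> N * m < n. divisor_sigma 1 m * divisor_sigma 1 (n - N * m))"

definition uhp :: "complex set" where
  "uhp = {z. Im z > 0}"

definition SL2Z :: "(int^2^2) set" where
  "SL2Z = {A. det A = 1}"

definition Gamma0 :: "nat \<Rightarrow> (int^2^2) set" where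
  "Gamma0 N = {A \<in> SL2Z. int N dvd A $ 2 $ 1}"

definition slash :: "nat \<Rightarrow> (complex \<Rightarrow> complex) \<Rightarrow> int^2^2 \<Rightarrow> complex \<Rightarrow> complex" where
  "slash k f A z =
     f ((of_int (A $ 1 $ 1) * z + of_int (A $ 1 $ 2)) / (of_int (A $ 2 $ 1) * z + of_int (A $ 2 $ 2)))
       / (of_int (A $ 2 $ 1) * z + of_int (A $ 2 $ 2)) ^ k"

text \<open>
  Modular forms are functions on all of \<open>complex\<close> of which only the restriction to \<open>uhp\<close>
  matters. Every cusp is the image of \<open>\<infinity>\<close> under some element of \<open>SL2Z\<close>, so vanishing at the cusps
  is convergence to \<open>0\<close> of every \<open>slash k f A\<close> as the imaginary part tends to infinity, uniformly
  in the real part.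
\<close>

definition cusp_form :: "nat \<Rightarrow> nat \<Rightarrow> (complex \<Rightarrow> complex) \<Rightarrow> bool" where
  "cusp_form k N f \<longleftrightarrow>
     f holomorphic_on uhp \<and>
     (\<forall>A\<in>Gamma0 N. \<forall>z\<in>uhp. slash k f A z = f z) \<and>
     (\<forall>A\<in>SL2Z. (slash k f A \<longlongrightarrow> 0) (filtercomap Im at_top))"

definition has_q_expansion :: "(complex \<Rightarrow> complex) \<Rightarrow> (nat \<Rightarrow> complex) \<Rightarrow> bool" where
  "has_q_expansion f a \<longleftrightarrow>
     (\<forall>z\<in>uhp. (\<lambda>n. a n * exp (2 * of_real pi * \<i> * z) ^ n) sums f z)"

text \<open>
  The Hecke operator \<open>T\<^sub>n\<close> on weight \<open>k \<ge> 1\<close> and level \<open>N\<close> with trivial character, for every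
  \<open>n \<ge> 1\<close>; for a prime \<open>n\<close> dividing \<open>N\<close> this is the operator often written \<open>U\<^sub>n\<close>.
\<close>

definition hecke :: "nat \<Rightarrow> nat \<Rightarrow> nat \<Rightarrow> (complex \<Rightarrow> complex) \<Rightarrow> complex \<Rightarrow> complex" where
  "hecke k N n f z =
     of_nat n ^ (k - 1) *
     (\<Sum>a | a dvd n \<and> coprime a N. \<Sum>b<n div a.
        f ((of_nat a * z + of_nat b) / of_nat (n div a)) / of_nat (n div a) ^ k)"

definition hecke_eigenform :: "nat \<Rightarrow> nat \<Rightarrow> (complex \<Rightarrow> complex) \<Rightarrow> bool" where
  "hecke_eigenform k N f \<longleftrightarrow>
     cusp_form k N f \<and> (\<exists>z\<in>uhp. f z \<noteq> 0) \<and>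
     (\<forall>n>0. \<exists>c. \<forall>z\<in>uhp. hecke k N n f z = c * f z)"

definition SL2Z_domain :: "complex set" where
  "SL2Z_domain = {z \<in> uhp. \<bar>Re z\<bar> \<le> 1 / 2 \<and> norm z \<ge> 1}"

text \<open>
  The translates of \<open>SL2Z_domain\<close> by representatives of \<open>Gamma0 N \ SL2Z\<close> make up a fundamental
  domain of \<open>Gamma0 N\<close>; pulling the integral of \<open>f(z) cnj(g(z)) y^k dx dy / y^2\<close> back to
  \<open>SL2Z_domain\<close> gives the sum below. For \<open>f\<close>, \<open>g\<close> invariant under \<open>Gamma0 N\<close> the summand does not
  depend on the representative chosen.
\<close>

definition petersson ::
    "nat \<Rightarrow> nat \<Rightarrow> (complex \<Rightarrow> complex) \<Rightarrow> (complex \<Rightarrow> complex) \<Rightarrow> complex" where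
  "petersson k N f g =
     (\<Sum>C\<in>(\<lambda>A. (\<lambda>G. G ** A) ` Gamma0 N) ` SL2Z.
        LINT z : SL2Z_domain | lborel.
          slash k f (SOME A. A \<in> C) z * cnj (slash k g (SOME A. A \<in> C) z)
            * of_real (Im z ^ k / (Im z)\<^sup>2))"

inductive_set old_space :: "nat \<Rightarrow> nat \<Rightarrow> (complex \<Rightarrow> complex) set" for k N where
  lift: "M dvd N \<Longrightarrow> M \<noteq> N \<Longrightarrow> d dvd N div M \<Longrightarrow> cusp_form k M g \<Longrightarrow>
     (\<lambda>z. g (of_nat d * z)) \<in> old_space k N"
| zero: "(\<lambda>z. 0) \<in> old_space k N"
| add: "f \<in> old_space k N \<Longrightarrow> g \<in> old_space k N \<Longrightarrow> (\<lambda>z. f z + g z) \<in> old_space k N"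
| scale: "f \<in> old_space k N \<Longrightarrow> (\<lambda>z. c * f z) \<in> old_space k N"

definition new_space :: "nat \<Rightarrow> nat \<Rightarrow> (complex \<Rightarrow> complex) set" where
  "new_space k N = {f. cusp_form k N f \<and> (\<forall>g\<in>old_space k N. petersson k N f g = 0)}"

definition primitive_form :: "nat \<Rightarrow> nat \<Rightarrow> (complex \<Rightarrow> complex) \<Rightarrow> bool" where
  "primitive_form k N f \<longleftrightarrow>
     f \<in> new_space k N \<and> hecke_eigenform k N f \<and> (\<exists>a. has_q_expansion f a \<and> a 1 = 1)"

end

theory Submission
  imports Defs
begin

text \<open>
  Let \<open>P\<close> and \<open>E\<^sub>4\<close> be the normalized Eisenstein series of weights 2 and 4. The convolution sum \<open>W\<^sub>1\<^sub>4(n)\<close> is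
  a coefficient of \<open>P(z) P(14z)\<close>, hence of \<open>(P(z) - 14 P(14z))\<^sup>2\<close> once \<open>P\<^sup>2 = E\<^sub>4 + 12 q dP/dq\<close> is known. That
  square is a modular form of weight 4 on \<open>\<Gamma>\<^sub>0(14)\<close>, and the theorem writes it in terms of the
  \<open>E\<^sub>4(dz)\<close> and the given cusp forms.

  Coefficients decide such identities: if \<open>f\<close> of weight 4 on \<open>\<Gamma>\<^sub>0(14)\<close> vanishes to order 8 at infinity, then
  \<open>f\<^sup>1\<^sup>8\<close> divided by the eta quotient \<open>\<Delta>(z) \<Delta>(14z)\<^sup>1\<^sup>4 / (\<Delta>(2z)\<^sup>2 \<Delta>(7z)\<^sup>7)\<close>, whose zeros all lie at infinity,
  is bounded of weight 0 and therefore constant. So nine coefficients determine \<open>f\<close>.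

  The newforms are eigenforms of \<open>U\<^sub>2\<close> with eigenvalue \<open>\<plusminus> 2\<close>, whereas the eigenvalues of \<open>U\<^sub>2\<close> on old forms are the
  roots of \<open>x\<^sup>2 + x + 8\<close>. Accordingly the relations \<open>a(2n) = \<plusminus> 2 a(n)\<close> for \<open>n \<le> 7\<close> and the linear
  relations between the first coefficients of weight 4 forms leave one solution, an explicit
  combination of Eisenstein series and their products. The form of level 7 is pinned down by its
  vanishing at both cusps.
\<close>

section \<open>Lipschitz's formula in weights 2 and 4\<close>

text \<open>The dimension of the weight 4 space is never computed. The valence bound 4 * 24 / 12 = 8
  (24 being the index of level 14) allows the nine leading exponents 0 to 8, but only eight explicit
  Eisenstein combinations are at hand. A further form starting at q^8 is therefore carried along as
  an unknown multiple of a sequence that the eta quotient determines, and the U_2 relations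
  eliminate it together with the other unknowns. Relations for n up to 7 involve coefficients up to
  q^14, which is how far the tables reach.

  The power 18 comes from the exponents t * mu(14/t) of Delta(tz): they sum to 6, so the quotient
  has weight 72 = 18 * 4 and order 144 = 18 * 8 at infinity.

  P itself is not modular: its double series converges only conditionally, and reordering it leaves
  a term linear in z. This term cancels in P(z) - t P(tz), and it is also what gives Delta, the
  exponential of an integral of P, its weight 12.\<close>

abbreviation two_pi_i :: complex where
  "two_pi_i \<equiv> 2 * of_real pi * \<i>"

abbreviation qexp :: "complex \<Rightarrow> complex" where
  "qexp z \<equiv> exp (two_pi_i * z)"

lemma uhp_iff: "z \<in> uhp \<longleftrightarrow> Im z > 0"
  by (simp add: uhp_def)

lemma open_uhp: "open uhp"
  unfolding uhp_def by (rule open_halfspace_Im_gt)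

lemma convex_uhp: "convex uhp"
  unfolding uhp_def by (rule convex_halfspace_Im_gt)

lemma connected_uhp: "connected uhp"
  by (rule convex_connected[OF convex_uhp])

lemma norm_qexp: "norm (qexp z) = exp (- 2 * pi * Im z)"
  by (simp add: norm_exp_eq_Re)

lemma norm_qexp_less_1: "z \<in> uhp \<Longrightarrow> norm (qexp z) < 1"
  by (simp add: norm_exp_eq_Re uhp_iff)

lemma qexp_neq_1: "z \<in> uhp \<Longrightarrow> qexp z \<noteq> 1"
  using norm_qexp_less_1[of z] by (metis less_irrefl norm_one)

lemma uhp_not_Ints: "z \<in> uhp \<Longrightarrow> z \<notin> \<int>"
  by (auto simp: uhp_iff elim!: Ints_cases)

lemma uhp_not_nonpos_Ints: "z \<in> uhp \<Longrightarrow> z \<notin> \<int>\<^sub>\<le>\<^sub>0"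
  using uhp_not_Ints nonpos_Ints_subset_Ints by blast

lemma one_minus_uhp_not_nonpos_Ints: "z \<in> uhp \<Longrightarrow> 1 - z \<notin> \<int>\<^sub>\<le>\<^sub>0"
  by (auto simp: uhp_iff elim!: nonpos_Ints_cases dest!: arg_cong[of _ _ Im])

lemma DERIV_unique_on_open:
  fixes f g :: "complex \<Rightarrow> complex"
  assumes "open S" "z \<in> S" "\<And>w. w \<in> S \<Longrightarrow> f w = g w"
    and "(f has_field_derivative f') (at z)" "(g has_field_derivative g') (at z)"
  shows "f' = g'"
proof -
  have "(g has_field_derivative f') (at z)"
    using has_field_derivative_transform_within_open[OF assms(4,1,2), of g] assms(3) by simp
  then show ?thesis
    using assms(5) by (rule DERIV_unique)
qed

text \<open>Logarithmic derivative of the reflection formula for \<open>rGamma\<close>. The right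
  side is -pi cot(pi z) written in q, the form in which it can be differentiated further as a
  rational function of q.\<close>

lemma Digamma_reflection_uhp:
  assumes "z \<in> uhp"
  shows "Digamma z - Digamma (1 - z) = \<i> * of_real pi * (2 / (1 - qexp z) - 1)"
proof -
  let ?p = "complex_of_real pi"
  have "((\<lambda>z. rGamma z * rGamma (1 - z)) has_field_derivative
      (- rGamma z * Digamma z) * rGamma (1 - z) + (- rGamma (1 - z) * Digamma (1 - z)) * (0 - 1) * rGamma z) (at z)"
    using uhp_not_nonpos_Ints[OF assms] one_minus_uhp_not_nonpos_Ints[OF assms]
    by (auto intro!: derivative_eq_intros)
  moreover have "((\<lambda>z. sin (?p * z) / ?p) has_field_derivative cos (?p * z)) (at z)"
    by (auto intro!: derivative_eq_intros)
  ultimately have "(- rGamma z * Digamma z) * rGamma (1 - z) + (- rGamma (1 - z) * Digamma (1 - z)) * (0 - 1) * rGamma z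
      = cos (?p * z)"
    by (rule DERIV_unique_on_open[OF open_UNIV UNIV_I rGamma_reflection_complex])
  then have 1: "(Digamma (1 - z) - Digamma z) * (rGamma z * rGamma (1 - z)) = cos (?p * z)"
    by (simp add: algebra_simps)
  define e where "e = exp (\<i> * ?p * z)"
  have e: "qexp z = e * e" "exp (\<i> * (?p * z)) = e" "exp (- (\<i> * (?p * z))) = inverse e" "e \<noteq> 0"
    by (simp_all add: e_def exp_minus mult_ac flip: exp_add)
  have ne: "e * e \<noteq> 1"
    using qexp_neq_1[OF assms] e by simp
  have "(Digamma (1 - z) - Digamma z) * ((e - inverse e) / (2 * \<i>)) = ?p * ((e + inverse e) / 2)"
    using 1 unfolding rGamma_reflection_complex sin_exp_eq cos_exp_eq e by (simp add: field_simps)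
  moreover define f where "f = inverse e"
  ultimately have "(Digamma (1 - z) - Digamma z) * ((e - f) / (2 * \<i>)) * (2 * \<i>) = ?p * ((e + f) / 2) * (2 * \<i>)"
    by (simp only: f_def)
  then have "- ((Digamma (1 - z) - Digamma z) * (\<i> * ((e - f) * \<i>))) = ?p * ((e + f) * \<i>)"
    by simp
  then have "(Digamma (1 - z) - Digamma z) * (e - f) = ?p * (e + f) * \<i>"
    using i_squared by algebra
  moreover have "e * f = 1"
    using e(4) by (simp add: f_def)
  ultimately have "(Digamma (1 - z) - Digamma z) * (e * e - 1) = ?p * (e * e + 1) * \<i>"
    by algebra
  then have "(Digamma z - Digamma (1 - z)) * (1 - e * e) = \<i> * ?p * (1 + e * e)"
    by (simp add: algebra_simps)
  then have "Digamma z - Digamma (1 - z) = \<i> * ?p * (1 + e * e) / (1 - e * e)"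
    using ne by (simp add: eq_divide_eq)
  also have "\<dots> = \<i> * ?p * (2 / (1 - e * e) - 1)"
    using ne by (simp add: field_simps)
  finally show ?thesis
    by (simp add: e)
qed

text \<open>On functions of q, d/dz is 2 pi i times the operator x d/dx. Each differentiation of the
  reflection formula below uses this once.\<close>

lemma DERIV_qexp_chain:
  assumes "(F has_field_derivative F') (at (qexp z))"
  shows "((\<lambda>z. F (qexp z)) has_field_derivative two_pi_i * (qexp z * F')) (at z)"
proof -
  have "((\<lambda>z. qexp z) has_field_derivative qexp z * (two_pi_i)) (at z)"
    by (auto intro!: derivative_eq_intros)
  from DERIV_chain2[OF assms this] show ?thesis
    by (simp add: mult_ac)
qed

lemma Polygamma_reflection_1:
  assumes "z \<in> uhp"
  shows "Polygamma 1 z + Polygamma 1 (1 - z) = (two_pi_i)\<^sup>2 * (qexp z / (1 - qexp z)\<^sup>2)"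
proof -
  have 1: "((\<lambda>z. Digamma z - Digamma (1 - z)) has_field_derivative
      Polygamma 1 z - Polygamma 1 (1 - z) * (0 - 1)) (at z)"
    using uhp_not_nonpos_Ints[OF assms] one_minus_uhp_not_nonpos_Ints[OF assms]
    by (auto intro!: derivative_eq_intros)
  have "((\<lambda>x. \<i> * of_real pi * (2 / (1 - x) - 1)) has_field_derivative
      \<i> * of_real pi * (2 / (1 - x)\<^sup>2)) (at x)" if "x \<noteq> 1" for x :: complex
    using that by (auto intro!: derivative_eq_intros simp: power2_eq_square)
  from DERIV_unique_on_open[OF open_uhp assms Digamma_reflection_uhp 1
      DERIV_qexp_chain[OF this[OF qexp_neq_1[OF assms]]]]
  show ?thesis by (simp add: power2_eq_square mult_ac)
qed

lemma Polygamma_reflection_2: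
  assumes "z \<in> uhp"
  shows "Polygamma 2 z - Polygamma 2 (1 - z) =
    (two_pi_i)^3 * (qexp z * (1 + qexp z) / (1 - qexp z)^3)"
proof -
  have 1: "((\<lambda>z. Polygamma 1 z + Polygamma 1 (1 - z)) has_field_derivative
      Polygamma 2 z + Polygamma 2 (1 - z) * (0 - 1)) (at z)"
    using uhp_not_nonpos_Ints[OF assms] one_minus_uhp_not_nonpos_Ints[OF assms]
    by (auto intro!: derivative_eq_intros simp: numeral_2_eq_2)
  have "((\<lambda>x. c * (x / (1 - x)\<^sup>2)) has_field_derivative c * ((1 + x) / (1 - x)^3)) (at x)"
    if "x \<noteq> 1" for c x :: complex
    using that by (auto intro!: derivative_eq_intros simp: divide_simps)
      (simp_all add: algebra_simps power2_eq_square power3_eq_cube power4_eq_xxxx)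
  from DERIV_unique_on_open[OF open_uhp assms Polygamma_reflection_1 1
      DERIV_qexp_chain[OF this[OF qexp_neq_1[OF assms]]]]
  show ?thesis by (simp add: power2_eq_square power3_eq_cube mult_ac)
qed

lemma Polygamma_reflection_3:
  assumes "z \<in> uhp"
  shows "Polygamma 3 z + Polygamma 3 (1 - z) =
    (two_pi_i)^4 * (qexp z * (1 + 4 * qexp z + (qexp z)\<^sup>2) / (1 - qexp z)^4)"
proof -
  have 1: "((\<lambda>z. Polygamma 2 z - Polygamma 2 (1 - z)) has_field_derivative
      Polygamma 3 z - Polygamma 3 (1 - z) * (0 - 1)) (at z)"
    using uhp_not_nonpos_Ints[OF assms] one_minus_uhp_not_nonpos_Ints[OF assms]
    by (auto intro!: derivative_eq_intros simp: eval_nat_numeral)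
  have "((\<lambda>x. c * (x * (1 + x) / (1 - x)^3)) has_field_derivative c * ((1 + 4 * x + x\<^sup>2) / (1 - x)^4)) (at x)"
    if "x \<noteq> 1" for c x :: complex
    using that by (auto intro!: derivative_eq_intros simp: divide_simps)
      (simp_all add: algebra_simps eval_nat_numeral)
  from DERIV_unique_on_open[OF open_uhp assms Polygamma_reflection_2 1
      DERIV_qexp_chain[OF this[OF qexp_neq_1[OF assms]]]]
  show ?thesis by (simp add: power2_eq_square power3_eq_cube power4_eq_xxxx mult_ac)
qed

text \<open>The operator x d/dx multiplies the d-th coefficient by d. Iterated from the geometric
  series it yields the same rational functions as the differentiated reflection formula.\<close>

lemma x_times_deriv_powser_sums:
  fixes a :: "nat \<Rightarrow> complex"
  assumes "\<And>x. norm x < 1 \<Longrightarrow> (\<lambda>d. a d * x ^ d) sums F x"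
    and "norm x < 1" "(F has_field_derivative F') (at x)"
  shows "(\<lambda>d. of_nat d * a d * x ^ d) sums (x * F')"
proof -
  have "(\<lambda>n. diffs a n * x ^ n) sums F'"
    by (rule termdiffs_sums_strong[OF assms(1,3,2)])
  then have "(\<lambda>n. x * (diffs a n * x ^ n)) sums (x * F')"
    by (rule sums_mult)
  then have "(\<lambda>n. of_nat (Suc n) * a (Suc n) * x ^ Suc n) sums (x * F')"
    by (simp add: diffs_def mult_ac)
  then show ?thesis
    by (subst (asm) sums_Suc_iff) simp
qed

lemma sums_power_index_1:
  fixes x :: complex
  assumes "norm x < 1"
  shows "(\<lambda>d. of_nat d ^ 1 * x ^ d) sums (x / (1 - x)\<^sup>2)"
proof -
  have "x \<noteq> 1" using assms by auto
  then have "((\<lambda>x. 1 / (1 - x)) has_field_derivative 1 / (1 - x)\<^sup>2) (at x)"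
    by (auto intro!: derivative_eq_intros simp: power2_eq_square)
  from x_times_deriv_powser_sums[OF _ assms this, of "\<lambda>_. 1"] show ?thesis
    by (simp add: geometric_sums)
qed

lemma sums_power_index_2:
  fixes x :: complex
  assumes "norm x < 1"
  shows "(\<lambda>d. of_nat d ^ 2 * x ^ d) sums (x * ((1 + x) / (1 - x)^3))"
proof -
  have "x \<noteq> 1" using assms by auto
  then have "((\<lambda>x. x / (1 - x)\<^sup>2) has_field_derivative (1 + x) / (1 - x)^3) (at x)"
    by (auto intro!: derivative_eq_intros simp: divide_simps)
      (simp_all add: algebra_simps power2_eq_square power3_eq_cube power4_eq_xxxx)
  from x_times_deriv_powser_sums[OF sums_power_index_1 assms this] show ?thesis
    by (simp add: power2_eq_square)
qed

lemma sums_power_index_3: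
  fixes x :: complex
  assumes "norm x < 1"
  shows "(\<lambda>d. of_nat d ^ 3 * x ^ d) sums (x * (1 + 4 * x + x\<^sup>2) / (1 - x)^4)"
proof -
  have "x \<noteq> 1" using assms by auto
  then have "((\<lambda>x. x * ((1 + x) / (1 - x)^3)) has_field_derivative (1 + 4 * x + x\<^sup>2) / (1 - x)^4) (at x)"
    by (auto intro!: derivative_eq_intros simp: divide_simps)
      (simp_all add: algebra_simps eval_nat_numeral)
  from x_times_deriv_powser_sums[OF sums_power_index_2 assms this] show ?thesis
    by (simp add: power2_eq_square power3_eq_cube mult.assoc)
qed

abbreviation L2 :: "complex \<Rightarrow> complex" where
  "L2 x \<equiv> x / (1 - x)\<^sup>2"

abbreviation L4 :: "complex \<Rightarrow> complex" where
  "L4 x \<equiv> x * (1 + 4 * x + x\<^sup>2) / (1 - x)^4"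

text \<open>By Lipschitz's formula the first term is the sum of 1/(z+n)^2 over all integers n; the
  subtraction removes n = 0. Likewise for \<open>lip4\<close>.\<close>

abbreviation lip2 :: "complex \<Rightarrow> complex" where
  "lip2 z \<equiv> (two_pi_i)\<^sup>2 * L2 (qexp z) - 1 / z\<^sup>2"

abbreviation lip4 :: "complex \<Rightarrow> complex" where
  "lip4 z \<equiv> (two_pi_i)^4 / 6 * L4 (qexp z) - 1 / z^4"

text \<open>\<open>Polygamma n\<close> at z collects the shifts z + k and at 1 - z the shifts z -
  (k+1). For odd n the exponent n + 1 is even, so the signs disappear.\<close>

lemma Lipschitz_sums:
  assumes "z \<in> uhp" "odd n"
  shows "(\<lambda>k. 1 / (z + of_nat (Suc k)) ^ Suc n + 1 / (z - of_nat (Suc k)) ^ Suc n) sums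
    ((Polygamma n z + Polygamma n (1 - z)) / fact n - 1 / z ^ Suc n)"
proof -
  have nz: "z \<noteq> 0" "1 - z \<noteq> 0" and n: "n > 0"
    using assms by (auto simp: uhp_iff intro: Nat.gr0I)
  have 1: "(\<lambda>k. 1 / (z + of_nat k) ^ Suc n) sums (Polygamma n z / fact n)"
    and 2: "(\<lambda>k. 1 / (1 - z + of_nat k) ^ Suc n) sums (Polygamma n (1 - z) / fact n)"
    using Polygamma_LIMSEQ[OF nz(1) n] Polygamma_LIMSEQ[OF nz(2) n] assms(2)
    by (simp_all add: inverse_eq_divide)
  have 3: "(1 - z + of_nat k) ^ Suc n = (z - of_nat (Suc k)) ^ Suc n" for k
  proof -
    have "(1 - z + of_nat k) ^ Suc n = (- (z - of_nat (Suc k))) ^ Suc n"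
      by (intro arg_cong[where f = "\<lambda>x. x ^ Suc n"]) simp
    then show ?thesis
      using assms(2) by (simp only: power_minus_even even_Suc not_False_eq_True)
  qed
  have "(\<lambda>k. 1 / (z + of_nat (Suc k)) ^ Suc n) sums (Polygamma n z / fact n - 1 / z ^ Suc n)"
    using 1 by (subst sums_Suc_iff) simp
  from sums_add[OF this 2] show ?thesis
    unfolding 3 by (simp only: add_divide_distrib) (simp add: algebra_simps)
qed

lemma Lipschitz_sums_2:
  assumes "z \<in> uhp"
  shows "(\<lambda>n. 1 / (z + of_nat (Suc n))\<^sup>2 + 1 / (z - of_nat (Suc n))\<^sup>2) sums lip2 z"
  using Lipschitz_sums[OF assms, of 1] Polygamma_reflection_1[OF assms] by (simp add: numeral_2_eq_2)

lemma Lipschitz_sums_4: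
  assumes "z \<in> uhp"
  shows "(\<lambda>n. 1 / (z + of_nat (Suc n))^4 + 1 / (z - of_nat (Suc n))^4) sums lip4 z"
proof -
  have "Suc 3 = 4" "fact 3 = (6 :: complex)" by (simp_all add: eval_nat_numeral)
  then show ?thesis
    using Lipschitz_sums[OF assms, of 3] unfolding Polygamma_reflection_3[OF assms] by (simp add: mult.commute)
qed

text \<open>The partial fraction expansion of 1/w - pi cot(pi w), each term being 1/(m-w) -
  1/(m+w).\<close>

lemma cot_partial_fraction_sums:
  assumes "w \<in> uhp"
  shows "(\<lambda>m. 2 * w / ((of_nat (Suc m))\<^sup>2 - w\<^sup>2)) sums
    (1 / w + \<i> * of_real pi * (2 / (1 - qexp w) - 1))"
proof -
  have nz: "w \<noteq> 0" "1 - w \<noteq> 0" using assms by (auto simp: uhp_iff)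
  have nz': "of_nat m + w \<noteq> 0" "of_nat m - w \<noteq> 0" for m
    using assms by (auto simp: uhp_iff complex_eq_iff)
  have a: "(\<lambda>k. inverse (of_nat (Suc k)) - inverse (w + of_nat k)) sums (Digamma w + euler_mascheroni)"
    using summable_sums[OF summable_Digamma[OF nz(1)]] by (simp add: Digamma_def)
  have b: "(\<lambda>k. inverse (of_nat (Suc k)) - inverse (1 - w + of_nat k)) sums (Digamma (1 - w) + euler_mascheroni)"
    using summable_sums[OF summable_Digamma[OF nz(2)]] by (simp add: Digamma_def)
  have c: "(\<lambda>k. inverse (1 - w + of_nat k) - inverse (w + of_nat k)) sums (Digamma w - Digamma (1 - w))"
    using sums_diff[OF a b] by (simp add: algebra_simps)
  \<comment> \<open>The digamma series pair 1 - w + k with w + k. Adding a telescoping series shifts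
    the second index by one, which gives the pairing of m - w with m + w.\<close>
  have "filterlim (\<lambda>k. w + of_nat k) at_infinity sequentially"
    by (intro tendsto_add_filterlim_at_infinity[OF tendsto_const] tendsto_of_nat)
  then have "(\<lambda>k. inverse (w + of_nat k)) \<longlonglongrightarrow> 0"
    using filterlim_compose[OF tendsto_inverse_0] by blast
  from telescope_sums'[OF this]
  have "(\<lambda>k. inverse (w + of_nat k) - inverse (w + of_nat (Suc k))) sums inverse w"
    by simp
  from sums_add[OF c this]
  have "(\<lambda>k. inverse (1 - w + of_nat k) - inverse (w + of_nat (Suc k))) sums (Digamma w - Digamma (1 - w) + inverse w)"
    by simp
  also have "(\<lambda>k. inverse (1 - w + of_nat k) - inverse (w + of_nat (Suc k))) =
      (\<lambda>m. 2 * w / ((of_nat (Suc m))\<^sup>2 - w\<^sup>2))"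
  proof
    fix k
    have "1 - w + of_nat k = of_nat (Suc k) - w" by simp
    moreover have "w + of_nat (Suc k) = of_nat (Suc k) + w" by simp
    moreover have "(of_nat (Suc k))\<^sup>2 - w\<^sup>2 = (of_nat (Suc k) - w) * (of_nat (Suc k) + w)"
      by (simp add: power2_eq_square algebra_simps)
    ultimately show "inverse (1 - w + of_nat k) - inverse (w + of_nat (Suc k)) = 2 * w / ((of_nat (Suc k))\<^sup>2 - w\<^sup>2)"
      using nz'[of "Suc k"] by (simp add: field_simps del: of_nat_Suc)
  qed
  finally show ?thesis
    by (simp add: Digamma_reflection_uhp[OF assms] inverse_eq_divide add.commute)
qed

section \<open>The Eisenstein series of weights 2 and 4 under inversion\<close>

lemma summable_on_product_bound:
  fixes u :: "nat \<times> nat \<Rightarrow> complex"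
  assumes "\<And>m n. norm (u (m, n)) \<le> g m * h n" "summable g" "summable h"
    and "\<And>m. g m \<ge> 0" "\<And>n. h n \<ge> 0"
  shows "(\<lambda>p. norm (u p)) summable_on UNIV"
proof -
  have g: "g summable_on UNIV" and h: "h summable_on UNIV"
    using assms by (simp_all add: summable_on_UNIV_nonneg_real_iff)
  have "(\<lambda>(m, n). g m * h n) summable_on (UNIV \<times> UNIV)"
  proof (rule summable_on_SigmaI)
    show "((\<lambda>n. case (m, n) of (m, n) \<Rightarrow> g m * h n) has_sum g m * infsum h UNIV) UNIV" for m
      using has_sum_cmult_right[OF has_sum_infsum[OF h]] by simp
    show "(\<lambda>m. g m * infsum h UNIV) summable_on UNIV"
      by (rule summable_on_cmult_left[OF g])
  qed (use assms in auto)
  then show ?thesis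
    by (intro Infinite_Sum.abs_summable_on_comparison_test'[where g = "\<lambda>(m, n). g m * h n"]) (use assms in auto)
qed

lemma abs_summable_slices:
  fixes u :: "nat \<times> nat \<Rightarrow> complex"
  assumes "(\<lambda>p. norm (u p)) summable_on UNIV"
  shows "(\<lambda>n. norm (u (m, n))) summable_on UNIV" "(\<lambda>m. norm (u (m, n))) summable_on UNIV"
proof -
  have "(\<lambda>p. norm (u p)) summable_on range (Pair m)" "(\<lambda>p. norm (u p)) summable_on range (\<lambda>m. (m, n))"
    using assms by (auto intro: summable_on_subset_banach)
  moreover have "inj_on (Pair m) UNIV" "inj_on (\<lambda>m. (m, n)) UNIV"
    by (auto simp: inj_on_def)
  ultimately show "(\<lambda>n. norm (u (m, n))) summable_on UNIV" "(\<lambda>m. norm (u (m, n))) summable_on UNIV"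
    using summable_on_reindex[of "Pair m" UNIV "\<lambda>p. norm (u p)"]
      summable_on_reindex[of "\<lambda>m. (m, n)" UNIV "\<lambda>p. norm (u p)"] by (simp_all add: o_def)
qed

lemma has_sum_of_abs_summable_sums:
  fixes f :: "nat \<Rightarrow> complex"
  assumes "(\<lambda>n. norm (f n)) summable_on UNIV" "f sums S"
  shows "(f has_sum S) UNIV"
  using assms by (intro norm_summable_imp_has_sum summable_on_imp_summable)

lemma double_sums_swap:
  fixes u :: "nat \<times> nat \<Rightarrow> complex"
  assumes u: "(\<lambda>p. norm (u p)) summable_on UNIV"
    and r: "\<And>m. (\<lambda>n. u (m, n)) sums r m" and c: "\<And>n. (\<lambda>m. u (m, n)) sums c n"
  obtains S where "(u has_sum S) UNIV" "r sums S" "c sums S"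
proof -
  obtain S where S: "(u has_sum S) (UNIV \<times> UNIV)"
    using abs_summable_summable[OF u] by (auto simp: summable_on_def)
  have "(r has_sum S) UNIV"
    using has_sum_SigmaD[OF S has_sum_of_abs_summable_sums[OF abs_summable_slices(1)[OF u] r]] by simp
  moreover have S': "((\<lambda>(n, m). u (m, n)) has_sum S) (UNIV \<times> UNIV)"
    using S by (subst (asm) has_sum_swap)
  have "(c has_sum S) UNIV"
    using has_sum_SigmaD[OF S'] has_sum_of_abs_summable_sums[OF abs_summable_slices(2)[OF u] c] by simp
  ultimately show ?thesis
    using that S by (simp add: has_sum_imp_sums)
qed

section \<open>Lambert series\<close>

lemma divisor_sigma_0 [simp]: "divisor_sigma k 0 = 0"
  by (simp add: divisor_sigma_def)

text \<open>Both series are groupings of the double series of d^k x^(md): by m, and by the product n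
  = md.\<close>

lemma Lambert_series_sums:
  fixes x :: complex
  assumes x: "norm x < 1" and k: "\<And>x. norm x < 1 \<Longrightarrow> (\<lambda>d. of_nat d ^ k * x ^ d) sums F x" "k > 0"
  shows "\<exists>S. (\<lambda>m. F (x ^ Suc m)) sums S \<and> (\<lambda>n. of_nat (divisor_sigma k n) * x ^ n) sums S"
proof -
  define u where "u = (\<lambda>(m, d). of_nat (Suc d) ^ k * x ^ (Suc m * Suc d))"
  define r where "r = norm x"
  have r: "0 \<le> r" "r < 1" using x by (auto simp: r_def)
  have "\<exists>t. r < t \<and> t < 1" using r by (simp add: dense)
  then obtain t where t: "r < t" "t < 1" by blast
  have "summable (\<lambda>d. norm (of_nat d ^ k * x ^ d))"
    by (rule powser_insidea[where x = "of_real t"]) (use k(1)[of "of_real t"] t r in \<open>auto simp: sums_iff r_def\<close>)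
  then have "summable (\<lambda>d. real d ^ k * r ^ d)"
    by (simp add: norm_mult norm_power r_def)
  then have sh: "summable (\<lambda>d. real (Suc d) ^ k * r ^ Suc d)"
    by (subst summable_Suc_iff[where f = "\<lambda>d. real d ^ k * r ^ d"])
  \<comment> \<open>Since (m+1)(d+1) >= m + (d+1), the two indices decouple.\<close>
  have "norm (u (m, d)) \<le> r ^ m * (real (Suc d) ^ k * r ^ Suc d)" for m d
  proof -
    have "norm (u (m, d)) = real (Suc d) ^ k * r ^ (Suc m * Suc d)"
      by (simp only: u_def case_prod_conv norm_mult norm_power norm_of_nat r_def)
    also have "r ^ (Suc m * Suc d) \<le> r ^ (m + Suc d)"
      by (rule power_decreasing) (use r in auto)
    finally show ?thesis
      by (simp add: power_add mult_ac)
  qed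
  then have u: "(\<lambda>p. norm (u p)) summable_on UNIV"
    by (rule summable_on_product_bound) (use sh r in \<open>auto intro!: summable_geometric\<close>)
  have row: "(\<lambda>d. u (m, d)) sums F (x ^ Suc m)" for m
  proof -
    have "norm (x ^ Suc m) < 1"
      using r power_Suc_less_one[of r m] by (cases "r = 0") (auto simp: r_def norm_power norm_mult simp del: power_Suc)
    from k(1)[OF this] have "(\<lambda>d. of_nat (Suc d) ^ k * (x ^ Suc m) ^ Suc d) sums (F (x ^ Suc m) - of_nat 0 ^ k * (x ^ Suc m) ^ 0)"
      by (subst sums_Suc_iff) simp
    then show ?thesis
      using k(2) unfolding u_def case_prod_conv by (simp add: zero_power power_mult power_mult_distrib del: of_nat_Suc power_Suc mult_Suc mult_Suc_right)
  qed
  obtain S where S: "(u has_sum S) (UNIV \<times> UNIV)"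
    using abs_summable_summable[OF u] by (auto simp: summable_on_def)
  have 1: "((\<lambda>m. F (x ^ Suc m)) has_sum S) UNIV"
    by (rule has_sum_SigmaD[OF S has_sum_of_abs_summable_sums[OF abs_summable_slices(1)[OF u] row]])
  have "((\<lambda>(n, d). of_nat d ^ k * x ^ n) has_sum S) (Sigma {0<..} (\<lambda>n. {d. d dvd n})) \<longleftrightarrow>
      (u has_sum S) (UNIV \<times> UNIV)"
  proof (rule has_sum_reindex_bij_witness[where i = "\<lambda>(m, d). (Suc m * Suc d, Suc d)" and
        j = "\<lambda>(n, d). (n div d - 1, d - 1)"])
    fix a assume "a \<in> Sigma {0<..} (\<lambda>n::nat. {d. d dvd n})"
    then obtain n d where a: "a = (n, d)" "n > 0" "d dvd n" by auto
    then obtain m where m: "n = d * m" by (elim dvdE)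
    with a have pos: "d > 0" "m > 0" by auto
    show "(\<lambda>(m, d). (Suc m * Suc d, Suc d)) ((\<lambda>(n, d). (n div d - 1, d - 1)) a) = a"
      using pos unfolding a m by (simp add: mult.commute del: mult_Suc mult_Suc_right)
    show "u ((\<lambda>(n, d). (n div d - 1, d - 1)) a) = (\<lambda>(n, d). of_nat d ^ k * x ^ n) a"
      using pos unfolding a m u_def by (simp add: mult.commute del: mult_Suc mult_Suc_right of_nat_Suc)
  qed (auto simp del: mult_Suc mult_Suc_right)
  with S have T: "((\<lambda>(n, d). of_nat d ^ k * x ^ n) has_sum S) (Sigma {0<..} (\<lambda>n. {d. d dvd n}))"
    by blast
  have "((\<lambda>n. of_nat (divisor_sigma k n) * x ^ n) has_sum S) {0<..}"
  proof (rule has_sum_SigmaD[OF T])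
    fix n :: nat assume "n \<in> {0<..}"
    then have "finite {d. d dvd n}" by simp
    from has_sum_finite[OF this]
    show "((\<lambda>d. case (n, d) of (n, d) \<Rightarrow> of_nat d ^ k * x ^ n) has_sum of_nat (divisor_sigma k n) * x ^ n) {d. d dvd n}"
      by (simp add: divisor_sigma_def sum_distrib_right)
  qed
  also have "?this \<longleftrightarrow> ((\<lambda>n. of_nat (divisor_sigma k n) * x ^ n) has_sum S) UNIV"
    by (rule has_sum_cong_neutral) auto
  finally have "((\<lambda>n. of_nat (divisor_sigma k n) * x ^ n) has_sum S) UNIV" .
  with 1 show ?thesis
    by (auto intro!: exI[of _ S] has_sum_imp_sums)
qed

text \<open>As z and 1 are linearly independent over the reals, the norm of m z + t is comparable
  with m + |t|: the imaginary part controls m, and then the triangle inequality controls t.\<close>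

lemma norm_lattice_point_ge:
  assumes "z \<in> uhp"
  obtains c where "c > 0" "\<And>m t :: real. m \<ge> 0 \<Longrightarrow> c * (m + \<bar>t\<bar>) \<le> norm (of_real m * z + of_real t)"
proof
  define K where "K = 1 / Im z + 1 + norm z / Im z"
  have y: "Im z > 0" using assms by (simp add: uhp_iff)
  have K: "K > 0" using y unfolding K_def by (intro add_pos_nonneg) auto
  then show "1 / K > 0" by simp
  fix m t :: real assume m: "m \<ge> 0"
  define N where "N = norm (of_real m * z + of_real t)"
  have "m * Im z \<le> N"
    using abs_Im_le_cmod[of "of_real m * z + of_real t"] by (simp add: N_def)
  then have 1: "m \<le> N / Im z" using y by (simp add: field_simps)
  have "\<bar>t\<bar> \<le> N + m * norm z"
    using norm_triangle_ineq4[of "of_real m * z + of_real t" "of_real m * z"] m by (simp add: N_def norm_mult)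
  also have "\<dots> \<le> N + N / Im z * norm z"
    using 1 by (intro add_left_mono mult_right_mono) auto
  finally have "m + \<bar>t\<bar> \<le> K * N"
    using 1 by (simp add: K_def algebra_simps)
  then show "1 / K * (m + \<bar>t\<bar>) \<le> norm (of_real m * z + of_real t)"
    using K by (simp add: N_def field_simps)
qed

lemma summable_Suc_powr_minus_3_2: "summable (\<lambda>m. real (Suc m) powr (- 3 / 2))"
proof -
  have "summable (\<lambda>m. real m powr (- 3 / 2))"
    by (subst summable_real_powr_iff) simp
  then show ?thesis
    by (subst summable_Suc_iff[where f = "\<lambda>m. real m powr (- 3 / 2)"])
qed

text \<open>Splitting the exponent as 3 = 3/2 + 3/2 bounds the lattice sum by a product of two
  single series that still converge.\<close>

lemma inverse_cube_le_powr:
  assumes "a \<ge> 1" "b \<ge> (1::real)"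
  shows "1 / (a + b) ^ 3 \<le> a powr (- 3 / 2) * b powr (- 3 / 2)"
proof -
  have "a * b \<le> (a + b) ^ 2"
    using assms by (simp add: power2_eq_square algebra_simps)
  then have "(a * b) powr (3 / 2) \<le> ((a + b) ^ 2) powr (3 / 2)"
    using assms by (intro powr_mono2) auto
  also have "(a + b) ^ 2 = (a + b) powr 2"
    using assms by simp
  also have "((a + b) powr 2) powr (3 / 2) = (a + b) powr 3"
    by (subst powr_powr) simp
  also have "\<dots> = (a + b) ^ 3"
    using assms by simp
  finally have "1 / (a + b) ^ 3 \<le> 1 / (a * b) powr (3 / 2)"
    using assms by (intro divide_left_mono) auto
  also have "\<dots> = a powr (- 3 / 2) * b powr (- 3 / 2)"
    using assms by (simp add: powr_mult powr_minus_divide)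
  finally show ?thesis .
qed

lemma uhp_mult_nat: "z \<in> uhp \<Longrightarrow> n > 0 \<Longrightarrow> of_nat n * z \<in> uhp"
  by (simp add: uhp_iff)

lemma Im_minus_inverse: "Im (- 1 / z) = Im z / (norm z)\<^sup>2"
  by (simp add: Im_divide cmod_power2)

lemma uhp_minus_inverse: "z \<in> uhp \<Longrightarrow> - 1 / z \<in> uhp"
  unfolding uhp_iff Im_minus_inverse by (auto intro!: divide_pos_pos)

lemma uhp_neq_0: "z \<in> uhp \<Longrightarrow> z \<noteq> 0"
  by (auto simp: uhp_iff)

lemma lattice_neq_0: "z \<in> uhp \<Longrightarrow> m > 0 \<Longrightarrow> of_nat m * z + of_real t \<noteq> 0" "z \<in> uhp \<Longrightarrow> m > 0 \<Longrightarrow> of_nat m * z - of_real t \<noteq> 0"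
  by (auto simp: uhp_iff complex_eq_iff)

definition sigma_series :: "nat \<Rightarrow> complex \<Rightarrow> complex" where
  "sigma_series k z = (\<Sum>n. of_nat (divisor_sigma k n) * qexp z ^ n)"

lemma qexp_power_Suc: "qexp z ^ Suc m = qexp (of_nat (Suc m) * z)"
  by (simp only: exp_of_nat_mult[symmetric] mult_ac)

lemma sigma_series_1:
  assumes "z \<in> uhp"
  shows "(\<lambda>n. of_nat (divisor_sigma 1 n) * qexp z ^ n) sums sigma_series 1 z"
    and "(\<lambda>m. L2 (qexp (of_nat (Suc m) * z))) sums sigma_series 1 z"
proof -
  obtain S where S: "(\<lambda>m. L2 (qexp z ^ Suc m)) sums S" "(\<lambda>n. of_nat (divisor_sigma 1 n) * qexp z ^ n) sums S"
    using Lambert_series_sums[OF norm_qexp_less_1[OF assms] sums_power_index_1] by auto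
  moreover have "S = sigma_series 1 z"
    using S(2) by (simp add: sigma_series_def sums_iff)
  ultimately show "(\<lambda>n. of_nat (divisor_sigma 1 n) * qexp z ^ n) sums sigma_series 1 z"
    and "(\<lambda>m. L2 (qexp (of_nat (Suc m) * z))) sums sigma_series 1 z"
    by (simp_all only: qexp_power_Suc)
qed

lemma sigma_series_3:
  assumes "z \<in> uhp"
  shows "(\<lambda>n. of_nat (divisor_sigma 3 n) * qexp z ^ n) sums sigma_series 3 z"
    and "(\<lambda>m. L4 (qexp (of_nat (Suc m) * z))) sums sigma_series 3 z"
proof -
  obtain S where S: "(\<lambda>m. L4 (qexp z ^ Suc m)) sums S" "(\<lambda>n. of_nat (divisor_sigma 3 n) * qexp z ^ n) sums S"
    using Lambert_series_sums[OF norm_qexp_less_1[OF assms] sums_power_index_3] by auto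
  moreover have "S = sigma_series 3 z"
    using S(2) by (simp add: sigma_series_def sums_iff)
  ultimately show "(\<lambda>n. of_nat (divisor_sigma 3 n) * qexp z ^ n) sums sigma_series 3 z"
    and "(\<lambda>m. L4 (qexp (of_nat (Suc m) * z))) sums sigma_series 3 z"
    by (simp_all only: qexp_power_Suc)
qed

text \<open>Comparing the conditionally convergent double series with the telescoping one of general
  term \<open>\<beta> m n - \<beta> m (n - 1)\<close>, where \<open>\<beta> m n = 2n / (m\<^sup>2z\<^sup>2 - n\<^sup>2)\<close>: the
  difference converges absolutely, and the two orders of summation of the telescoping series
  differ by \<open>- \<i>\<pi> / z\<close>.\<close>

lemma eisenstein_2_sums:
  assumes z: "z \<in> uhp"
  obtains S where
    "(\<lambda>m. lip2 (of_nat (Suc m) * z)) sums S"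
    "(\<lambda>n. (lip2 (of_nat (Suc n) * (- 1 / z))) / z\<^sup>2)
       sums (S - \<i> * of_real pi / z)"
proof -
  let ?N = "\<lambda>k. complex_of_nat (Suc k)"
  define \<beta> where "\<beta> = (\<lambda>m n. 2 * of_nat n / ((?N m * z)\<^sup>2 - (of_nat n)\<^sup>2))"
  define s where "s = (\<lambda>m n. 1 / (?N m * z + ?N n)\<^sup>2 + 1 / (?N m * z - ?N n)\<^sup>2)"
  define u where "u = (\<lambda>(m, n). s m n - (\<beta> m (Suc n) - \<beta> m n))"
  define v where "v = - 1 / z"
  have v: "v \<in> uhp" unfolding v_def by (rule uhp_minus_inverse[OF z])
  have z0: "z \<noteq> 0" using z by (rule uhp_neq_0)
  have nz: "?N m * z + of_nat n \<noteq> 0" "?N m * z - of_nat n \<noteq> 0" for m n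
    using lattice_neq_0[OF z, of "Suc m" "real n"] by (simp_all del: of_nat_Suc)
  have \<beta>: "\<beta> m n = 1 / (?N m * z - of_nat n) - 1 / (?N m * z + of_nat n)" for m n
  proof -
    have "(?N m * z)\<^sup>2 - (of_nat n)\<^sup>2 = (?N m * z - of_nat n) * (?N m * z + of_nat n)"
      by (simp add: power2_eq_square algebra_simps)
    then show ?thesis
      using nz[of m n] by (simp add: \<beta>_def field_simps del: of_nat_Suc)
  qed
  \<comment> \<open>Subtracting the telescoping term raises the decay from second to third order in
    the lattice norm, which is enough for absolute convergence.\<close>
  have u_eq: "u (m, n) = 1 / ((?N m * z - ?N n)\<^sup>2 * (?N m * z - of_nat n))
      - 1 / ((?N m * z + ?N n)\<^sup>2 * (?N m * z + of_nat n))" for m n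
  proof -
    define a b where "a = ?N m * z - ?N n" and "b = ?N m * z + of_nat n"
    have ab: "?N m * z - of_nat n = a + 1" "?N m * z + ?N n = b + 1"
      by (simp_all add: a_def b_def)
    have "a \<noteq> 0" "b \<noteq> 0" "a + 1 \<noteq> 0" "b + 1 \<noteq> 0"
      using nz[of m n] nz[of m "Suc n"] by (simp_all only: ab not_False_eq_True flip: a_def b_def)
    then have "1 / (b + 1)\<^sup>2 + 1 / a\<^sup>2 - ((1 / a - 1 / (b + 1)) - (1 / (a + 1) - 1 / b)) =
        1 / (a\<^sup>2 * (a + 1)) - 1 / ((b + 1)\<^sup>2 * b)"
      by (simp add: divide_simps) (simp add: power2_eq_square algebra_simps)
    then show ?thesis
      unfolding u_def s_def \<beta> case_prod_conv by (simp only: ab flip: a_def b_def)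
  qed
  obtain c where c: "c > 0" "\<And>m t :: real. m \<ge> 0 \<Longrightarrow> c * (m + \<bar>t\<bar>) \<le> norm (of_real m * z + of_real t)"
    using norm_lattice_point_ge[OF z] by blast
  have "norm (u (m, n)) \<le> (4 / c ^ 3 * real (Suc m) powr (- 3 / 2)) * real (Suc n) powr (- 3 / 2)" for m n
  proof -
    have key: "norm (1 / (x\<^sup>2 * y)) \<le> 2 / c ^ 3 * (1 / (real (Suc m) + real (Suc n)) ^ 3)"
      if "c * (real (Suc m) + real (Suc n)) \<le> norm x" "c * (real (Suc m) + real n) \<le> norm y" for x y :: complex
    proof -
      let ?t = "real (Suc m) + real (Suc n)"
      have t: "?t > 0" by simp
      \<comment> \<open>The factor y belongs to n rather than n + 1; this costs at most a factor
        2.\<close>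
      have y: "c * ?t / 2 \<le> norm y"
        by (rule order_trans[OF _ that(2)]) (use c(1) in \<open>simp add: field_simps\<close>)
      have "(c * ?t)\<^sup>2 * (c * ?t / 2) \<le> (norm x)\<^sup>2 * norm y"
        using that(1) y c(1) t by (intro mult_mono power_mono) auto
      then have "c ^ 3 * ?t ^ 3 / 2 \<le> norm (x\<^sup>2 * y)"
        by (simp add: norm_mult norm_power power_mult_distrib power3_eq_cube power2_eq_square mult_ac)
      moreover have "0 < c ^ 3 * ?t ^ 3 / 2"
        using c(1) t by simp
      ultimately have "1 / norm (x\<^sup>2 * y) \<le> 1 / (c ^ 3 * ?t ^ 3 / 2)"
        by (intro divide_left_mono mult_pos_pos) auto
      then show ?thesis
        by (simp add: norm_divide)
    qed
    have 1: "norm (1 / ((?N m * z - ?N n)\<^sup>2 * (?N m * z - of_nat n))) \<le> 2 / c ^ 3 * (1 / (real (Suc m) + real (Suc n)) ^ 3)"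
      using c(2)[of "real (Suc m)" "- real (Suc n)"] c(2)[of "real (Suc m)" "- real n"]
      by (intro key) (simp_all del: of_nat_Suc)
    have 2: "norm (1 / ((?N m * z + ?N n)\<^sup>2 * (?N m * z + of_nat n))) \<le> 2 / c ^ 3 * (1 / (real (Suc m) + real (Suc n)) ^ 3)"
      using c(2)[of "real (Suc m)" "real (Suc n)"] c(2)[of "real (Suc m)" "real n"]
      by (intro key) (simp_all del: of_nat_Suc)
    have "norm (u (m, n)) \<le> 4 / c ^ 3 * (1 / (real (Suc m) + real (Suc n)) ^ 3)"
      unfolding u_eq by (rule order_trans[OF norm_triangle_ineq4]) (use add_mono[OF 1 2] in simp)
    also have "\<dots> \<le> 4 / c ^ 3 * (real (Suc m) powr (- 3 / 2) * real (Suc n) powr (- 3 / 2))"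
      using c(1) by (intro mult_left_mono inverse_cube_le_powr) auto
    finally show ?thesis
      by (simp add: mult.assoc)
  qed
  then have u: "(\<lambda>p. norm (u p)) summable_on UNIV"
    by (rule summable_on_product_bound) (use c(1) summable_Suc_powr_minus_3_2 in \<open>auto intro!: summable_mult\<close>)

  define R where "R = (\<lambda>m. lip2 (?N m * z))"
  define C where "C = (\<lambda>n. (lip2 (?N n * v)) / z\<^sup>2)"
  \<comment> \<open>The column sums of \<open>\<beta>\<close>: with w = n v and v = -1/z,
    \<open>\<beta> m n\<close> is -1/z times a term of the cotangent expansion at w. For n = 0 the
    terms vanish, and the cotangent expansion would have a pole.\<close>
  define \<gamma> where "\<gamma> = (\<lambda>n. if n = 0 then 0 else (- 1 / z) * (1 / (of_nat n * v) + \<i> * of_real pi * (2 / (1 - qexp (of_nat n * v)) - 1)))"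

  have "\<beta> m \<longlonglongrightarrow> 0" for m
  proof -
    have "filterlim (\<lambda>n. - (?N m * z) + of_nat n) at_infinity sequentially" "filterlim (\<lambda>n. ?N m * z + of_nat n) at_infinity sequentially"
      by (intro tendsto_add_filterlim_at_infinity[OF tendsto_const] tendsto_of_nat)+
    from this[THEN filterlim_compose[OF tendsto_inverse_0]]
    have "(\<lambda>n. - inverse (- (?N m * z) + of_nat n) - inverse (?N m * z + of_nat n)) \<longlonglongrightarrow> - 0 - 0"
      by (intro tendsto_intros)
    also have "(\<lambda>n. - inverse (- (?N m * z) + of_nat n) - inverse (?N m * z + of_nat n)) = \<beta> m"
      by (simp only: \<beta> fun_eq_iff inverse_eq_divide) (metis minus_diff_eq minus_divide_right uminus_add_conv_diff)
    finally show ?thesis by simp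
  qed
  from telescope_sums[OF this] have b_row: "(\<lambda>n. \<beta> m (Suc n) - \<beta> m n) sums 0" for m
    by (simp add: \<beta>_def)
  have s_row: "s m sums R m" for m
    using Lipschitz_sums_2[OF uhp_mult_nat[OF z, of "Suc m"]] by (simp add: s_def R_def del: of_nat_Suc)
  have row: "(\<lambda>n. u (m, n)) sums R m" for m
    using sums_diff[OF s_row b_row] by (simp add: u_def)

  have s_col: "(\<lambda>m. s m n) sums C n" for n
  proof -
    have "(\<lambda>m. (1 / (?N n * v + ?N m)\<^sup>2 + 1 / (?N n * v - ?N m)\<^sup>2) / z\<^sup>2) sums C n"
      unfolding C_def by (intro sums_divide Lipschitz_sums_2 uhp_mult_nat v) auto
    moreover have "(1 / (?N n * v + ?N m)\<^sup>2 + 1 / (?N n * v - ?N m)\<^sup>2) / z\<^sup>2 = s m n" for m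
    proof -
      have "(?N n * v + ?N m) * z = ?N m * z - ?N n"
        "(?N n * v - ?N m) * z = - (?N m * z + ?N n)"
        using z0 by (simp_all add: v_def algebra_simps)
      then have "(?N n * v + ?N m)\<^sup>2 * z\<^sup>2 = (?N m * z - ?N n)\<^sup>2"
        "(?N n * v - ?N m)\<^sup>2 * z\<^sup>2 = (?N m * z + ?N n)\<^sup>2"
        by (metis power_mult_distrib, metis power_mult_distrib power2_minus)
      then show ?thesis
        unfolding s_def by (simp add: add_divide_distrib del: of_nat_Suc)
    qed
    ultimately show ?thesis by simp
  qed
  have \<beta>_col: "(\<lambda>m. \<beta> m n) sums \<gamma> n" for n
  proof (cases "n = 0")
    case True
    then show ?thesis by (simp add: \<beta>_def \<gamma>_def)
  next
    case False
    let ?w = "of_nat n * v"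
    have "(\<lambda>m. (- 1 / z) * (2 * ?w / ((?N m)\<^sup>2 - ?w\<^sup>2))) sums \<gamma> n"
      unfolding \<gamma>_def using False by (simp only: if_False) (intro sums_mult cot_partial_fraction_sums uhp_mult_nat v, auto)
    moreover have "(- 1 / z) * (2 * ?w / ((?N m)\<^sup>2 - ?w\<^sup>2)) = \<beta> m n" for m
    proof -
      have "(?N m)\<^sup>2 - ?w\<^sup>2 = ((?N m * z)\<^sup>2 - (of_nat n)\<^sup>2) / z\<^sup>2"
        using z0 by (simp add: v_def field_simps del: of_nat_Suc)
      then show ?thesis
        using z0 by (simp add: \<beta>_def v_def power2_eq_square del: of_nat_Suc)
    qed
    ultimately show ?thesis by simp
  qed
  have b_col: "(\<lambda>m. \<beta> m (Suc n) - \<beta> m n) sums (\<gamma> (Suc n) - \<gamma> n)" for n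
    by (intro sums_diff \<beta>_col)
  have col: "(\<lambda>m. u (m, n)) sums (C n - (\<gamma> (Suc n) - \<gamma> n))" for n
    using sums_diff[OF s_col b_col] by (simp add: u_def)
  obtain S where S: "R sums S" "(\<lambda>n. C n - (\<gamma> (Suc n) - \<gamma> n)) sums S"
    using double_sums_swap[OF u row col] by blast

  have "(\<lambda>n. \<gamma> (Suc n)) \<longlonglongrightarrow> (- 1 / z) * (0 + \<i> * of_real pi * (2 / (1 - 0) - 1))"
  proof -
    have "(\<lambda>n. qexp v ^ Suc n) \<longlonglongrightarrow> 0"
      using norm_qexp_less_1[OF v] by (intro LIMSEQ_Suc LIMSEQ_power_zero)
    then have 1: "(\<lambda>n. qexp (?N n * v)) \<longlonglongrightarrow> 0"
      by (simp only: qexp_power_Suc)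
    have "(\<lambda>n. inverse (?N n) * inverse v) \<longlonglongrightarrow> 0 * inverse v"
      by (intro tendsto_mult tendsto_const LIMSEQ_Suc lim_inverse_n)
    then have 2: "(\<lambda>n. 1 / (?N n * v)) \<longlonglongrightarrow> 0"
      by (simp add: field_simps del: of_nat_Suc)
    show ?thesis
      unfolding \<gamma>_def using 1 2 by (simp only: nat.simps if_False) (intro tendsto_intros, auto)
  qed
  then have "\<gamma> \<longlonglongrightarrow> - \<i> * of_real pi / z"
    by (subst (asm) filterlim_sequentially_Suc) simp
  from telescope_sums[OF this] have "(\<lambda>n. \<gamma> (Suc n) - \<gamma> n) sums (- \<i> * of_real pi / z)"
    by (simp add: \<gamma>_def)
  from sums_add[OF S(2) this] have "C sums (S - \<i> * of_real pi / z)"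
    by simp
  with S(1) show ?thesis
    using that unfolding R_def C_def v_def by blast
qed

definition eisP :: "complex \<Rightarrow> complex" where
  "eisP z = 1 - 24 * sigma_series 1 z"

text \<open>The constant term of P comes from the removed n = 0 terms, which sum to zeta(2) =
  pi^2/6; the term linear in z is the -i pi/z left by the exchange of summations.\<close>

lemma eisP_minus_inverse:
  assumes z: "z \<in> uhp"
  shows "eisP (- 1 / z) = z\<^sup>2 * eisP z - 6 * \<i> * z / of_real pi"
proof -
  define p where "p = complex_of_real pi"
  have p: "p \<noteq> 0" by (simp add: p_def)
  have z0: "z \<noteq> 0" using z by (rule uhp_neq_0)
  obtain S where S:
    "(\<lambda>m. lip2 (of_nat (Suc m) * z)) sums S"
    "(\<lambda>n. (lip2 (of_nat (Suc n) * (- 1 / z))) / z\<^sup>2)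
       sums (S - \<i> * of_real pi / z)"
    by (rule eisenstein_2_sums[OF z])
  have "(\<lambda>n. complex_of_real (1 / (real (Suc n))\<^sup>2)) sums of_real (pi\<^sup>2 / 6)"
    using inverse_squares_sums by (subst sums_of_real_iff) (simp add: add.commute)
  from sums_divide[OF this]
  have zeta: "(\<lambda>n. 1 / (of_nat (Suc n) * w)\<^sup>2) sums (of_real (pi\<^sup>2 / 6) / w\<^sup>2)" for w :: complex
    by (simp add: power_mult_distrib del: of_nat_Suc)
  have "(\<lambda>m. lip2 (of_nat (Suc m) * z)) sums
      ((two_pi_i)\<^sup>2 * sigma_series 1 z - of_real (pi\<^sup>2 / 6) / z\<^sup>2)"
    by (intro sums_diff sums_mult sigma_series_1 z zeta)
  from sums_unique2[OF S(1) this]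
  have 1: "S = - 4 * p\<^sup>2 * sigma_series 1 z - p\<^sup>2 / 6 / z\<^sup>2"
    by (simp add: p_def power_mult_distrib)
  have "(\<lambda>n. (lip2 (of_nat (Suc n) * (- 1 / z))) / z\<^sup>2) sums
      (((two_pi_i)\<^sup>2 * sigma_series 1 (- 1 / z) - of_real (pi\<^sup>2 / 6) / (- 1 / z)\<^sup>2) / z\<^sup>2)"
    by (intro sums_divide sums_diff sums_mult sigma_series_1 uhp_minus_inverse z zeta)
  from sums_unique2[OF S(2) this]
  have 2: "S - \<i> * p / z = (- 4 * p\<^sup>2 * sigma_series 1 (- 1 / z) - p\<^sup>2 / 6 * z\<^sup>2) / z\<^sup>2"
    by (simp add: p_def power_mult_distrib power_divide)
  have "z\<^sup>2 * (- 4 * p\<^sup>2 * sigma_series 1 z - p\<^sup>2 / 6 / z\<^sup>2 - \<i> * p / z) =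
      - 4 * p\<^sup>2 * sigma_series 1 (- 1 / z) - p\<^sup>2 / 6 * z\<^sup>2"
    using arg_cong[OF 2, of "\<lambda>x. z\<^sup>2 * x"] z0 unfolding 1 by simp
  moreover have "z\<^sup>2 * (- 4 * p\<^sup>2 * sigma_series 1 z - p\<^sup>2 / 6 / z\<^sup>2 - \<i> * p / z) =
      - 4 * p\<^sup>2 * z\<^sup>2 * sigma_series 1 z - p\<^sup>2 / 6 - \<i> * p * z"
    using z0 by (simp add: field_simps power2_eq_square)
  ultimately have eq: "- 4 * p\<^sup>2 * sigma_series 1 (- 1 / z) - p\<^sup>2 / 6 * z\<^sup>2 =
      - 4 * p\<^sup>2 * z\<^sup>2 * sigma_series 1 z - p\<^sup>2 / 6 - \<i> * p * z"
    by (simp only:)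
  define h where "h = p\<^sup>2 / 6"
  have "p\<^sup>2 = 6 * h" by (simp add: h_def)
  with eq[folded h_def] have "p\<^sup>2 * (24 * sigma_series 1 (- 1 / z)) = p\<^sup>2 * (24 * z\<^sup>2 * sigma_series 1 z + 1 - z\<^sup>2) + 6 * \<i> * p * z"
    by algebra
  then have "p\<^sup>2 * (24 * sigma_series 1 (- 1 / z)) = p\<^sup>2 * (24 * z\<^sup>2 * sigma_series 1 z + 1 - z\<^sup>2 + 6 * \<i> * z / p)"
    unfolding distrib_left[of "p\<^sup>2" _ "6 * \<i> * z / p"] using p by (simp add: power2_eq_square)
  then have "24 * sigma_series 1 (- 1 / z) = 24 * z\<^sup>2 * sigma_series 1 z + 1 - z\<^sup>2 + 6 * \<i> * z / p"
    using p by (simp only: mult_cancel_left power_eq_0_iff) simp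
  then show ?thesis
    unfolding eisP_def by (simp add: algebra_simps p_def)
qed

text \<open>In weight 4 the double series converges absolutely, so rows and columns have the same
  sum and no correction appears.\<close>

lemma eisenstein_4_sums:
  assumes z: "z \<in> uhp"
  obtains S where
    "(\<lambda>m. lip4 (of_nat (Suc m) * z)) sums S"
    "(\<lambda>n. (lip4 (of_nat (Suc n) * (- 1 / z))) / z^4) sums S"
proof -
  let ?N = "\<lambda>k. complex_of_nat (Suc k)"
  define u where "u = (\<lambda>(m, n). 1 / (?N m * z + ?N n)^4 + 1 / (?N m * z - ?N n)^4)"
  define v where "v = - 1 / z"
  have v: "v \<in> uhp" unfolding v_def by (rule uhp_minus_inverse[OF z])
  have z0: "z \<noteq> 0" using z by (rule uhp_neq_0)
  obtain c where c: "c > 0" "\<And>m t :: real. m \<ge> 0 \<Longrightarrow> c * (m + \<bar>t\<bar>) \<le> norm (of_real m * z + of_real t)"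
    using norm_lattice_point_ge[OF z] by blast
  have "norm (u (m, n)) \<le> (2 / c ^ 4 * real (Suc m) powr (- 3 / 2)) * real (Suc n) powr (- 3 / 2)" for m n
  proof -
    let ?t = "real (Suc m) + real (Suc n)"
    have t: "?t \<ge> 1" by simp
    have key: "norm (1 / x ^ 4) \<le> 1 / c ^ 4 * (1 / ?t ^ 3)" if "c * ?t \<le> norm x" for x :: complex
    proof -
      \<comment> \<open>One of the four powers is given away so that the cubic bound can be
        reused.\<close>
      have "c ^ 4 * ?t ^ 3 \<le> c ^ 4 * ?t ^ 4"
        using c(1) t by (intro mult_left_mono power_increasing) auto
      also have "\<dots> = (c * ?t) ^ 4"
        by (simp only: power_mult_distrib)
      also have "\<dots> \<le> norm x ^ 4"
        using that c(1) t by (intro power_mono) auto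
      finally have "c ^ 4 * ?t ^ 3 \<le> norm x ^ 4" .
      moreover have "0 < c ^ 4 * ?t ^ 3"
        using c(1) t by simp
      ultimately have "1 / norm x ^ 4 \<le> 1 / (c ^ 4 * ?t ^ 3)"
        by (intro divide_left_mono mult_pos_pos) auto
      then show ?thesis
        by (simp add: norm_divide norm_power)
    qed
    have 1: "norm (1 / (?N m * z + ?N n) ^ 4) \<le> 1 / c ^ 4 * (1 / ?t ^ 3)"
      using c(2)[of "real (Suc m)" "real (Suc n)"] by (intro key) (simp_all del: of_nat_Suc)
    have 2: "norm (1 / (?N m * z - ?N n) ^ 4) \<le> 1 / c ^ 4 * (1 / ?t ^ 3)"
      using c(2)[of "real (Suc m)" "- real (Suc n)"] by (intro key) (simp_all del: of_nat_Suc)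
    have "norm (u (m, n)) \<le> 2 / c ^ 4 * (1 / ?t ^ 3)"
      unfolding u_def case_prod_conv by (rule order_trans[OF norm_triangle_ineq]) (use add_mono[OF 1 2] in simp)
    also have "\<dots> \<le> 2 / c ^ 4 * (real (Suc m) powr (- 3 / 2) * real (Suc n) powr (- 3 / 2))"
      using c(1) by (intro mult_left_mono inverse_cube_le_powr) auto
    finally show ?thesis
      by (simp add: mult.assoc)
  qed
  then have u: "(\<lambda>p. norm (u p)) summable_on UNIV"
    by (rule summable_on_product_bound) (use c(1) summable_Suc_powr_minus_3_2 in \<open>auto intro!: summable_mult\<close>)
  define R where "R = (\<lambda>m. lip4 (?N m * z))"
  define C where "C = (\<lambda>n. (lip4 (?N n * v)) / z^4)"
  have row: "(\<lambda>n. u (m, n)) sums R m" for m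
    using Lipschitz_sums_4[OF uhp_mult_nat[OF z, of "Suc m"]] by (simp add: u_def R_def del: of_nat_Suc)
  have col: "(\<lambda>m. u (m, n)) sums C n" for n
  proof -
    have "(\<lambda>m. (1 / (?N n * v + ?N m)^4 + 1 / (?N n * v - ?N m)^4) / z^4) sums C n"
      unfolding C_def by (intro sums_divide Lipschitz_sums_4 uhp_mult_nat v) auto
    moreover have "(1 / (?N n * v + ?N m)^4 + 1 / (?N n * v - ?N m)^4) / z^4 = u (m, n)" for m
    proof -
      have "(?N n * v + ?N m) * z = ?N m * z - ?N n"
        "(?N n * v - ?N m) * z = - (?N m * z + ?N n)"
        using z0 by (simp_all add: v_def algebra_simps)
      then have "(?N n * v + ?N m)^4 * z^4 = (?N m * z - ?N n)^4"
        "(?N n * v - ?N m)^4 * z^4 = (?N m * z + ?N n)^4"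
        by (metis power_mult_distrib, metis power_mult_distrib power_minus_even even_numeral)
      then show ?thesis
        unfolding u_def case_prod_conv by (simp add: add_divide_distrib del: of_nat_Suc)
    qed
    ultimately show ?thesis by simp
  qed
  show ?thesis
    using double_sums_swap[OF u row col] that unfolding R_def C_def v_def by blast
qed

text \<open>The constant is \<open>\<zeta>(4) \<sqdot> 6 / (2\<pi>)\<^sup>4 = 1 / 240\<close>; its value comes out later from
  comparing with the square of the weight 2 series.\<close>

lemma sigma_series_3_minus_inverse:
  obtains c where "\<And>z. z \<in> uhp \<Longrightarrow> c + sigma_series 3 (- 1 / z) = z^4 * (c + sigma_series 3 z)"
proof -
  define k where "k = (two_pi_i)^4 / (6 :: complex)"
  have k: "k \<noteq> 0" by (simp add: k_def)
  have "summable (\<lambda>n. inverse (of_nat (Suc n) ^ 4 :: complex))"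
    by (subst summable_Suc_iff[where f = "\<lambda>n. inverse (of_nat n ^ 4 :: complex)"]) (rule inverse_power_summable, simp)
  then obtain d where d: "(\<lambda>n. 1 / (of_nat (Suc n) ^ 4 :: complex)) sums d"
    by (auto simp: summable_def inverse_eq_divide simp del: of_nat_Suc)
  have "d / k + sigma_series 3 (- 1 / z) = z^4 * (d / k + sigma_series 3 z)" if z: "z \<in> uhp" for z
  proof -
    have z0: "z \<noteq> 0" using z by (rule uhp_neq_0)
    obtain S where S:
      "(\<lambda>m. k * L4 (qexp (of_nat (Suc m) * z)) - 1 / (of_nat (Suc m) * z)^4) sums S"
      "(\<lambda>n. (k * L4 (qexp (of_nat (Suc n) * (- 1 / z))) - 1 / (of_nat (Suc n) * (- 1 / z))^4) / z^4) sums S"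
      unfolding k_def by (rule eisenstein_4_sums[OF z])
    have zeta: "(\<lambda>n. 1 / (of_nat (Suc n) * w)^4) sums (d / w^4)" for w
      using sums_divide[OF d, of "w^4"] by (simp add: power_mult_distrib del: of_nat_Suc)
    have "(\<lambda>m. k * L4 (qexp (of_nat (Suc m) * z)) - 1 / (of_nat (Suc m) * z)^4) sums
        (k * sigma_series 3 z - d / z^4)"
      by (intro sums_diff sums_mult sigma_series_3 z zeta)
    from sums_unique2[OF S(1) this]
    have 1: "S = k * sigma_series 3 z - d / z^4" .
    have "(\<lambda>n. (k * L4 (qexp (of_nat (Suc n) * (- 1 / z))) - 1 / (of_nat (Suc n) * (- 1 / z))^4) / z^4) sums
        ((k * sigma_series 3 (- 1 / z) - d / (- 1 / z)^4) / z^4)"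
      by (intro sums_divide sums_diff sums_mult sigma_series_3 uhp_minus_inverse z zeta)
    from sums_unique2[OF S(2) this]
    have 2: "S = (k * sigma_series 3 (- 1 / z) - d * z^4) / z^4"
      by (simp add: power_divide)
    then have "S * z^4 = k * sigma_series 3 (- 1 / z) - d * z^4"
      using z0 by simp
    then have "d + k * sigma_series 3 (- 1 / z) = z^4 * (d + k * sigma_series 3 z)"
      using z0 unfolding 1 by (simp add: left_diff_distrib) (simp add: algebra_simps)
    then show ?thesis
      using k by (simp add: field_simps)
  qed
  then show ?thesis using that by blast
qed

section \<open>Expansions in \<open>q\<close>\<close>

abbreviation im_top :: "complex filter" where
  "im_top \<equiv> filtercomap Im at_top"

lemma im_top_neq_bot [simp]: "im_top \<noteq> bot"
  by (rule filtercomap_neq_bot_surj[OF _ surjI[of Im "Complex 0"]]) auto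

lemma eventually_im_top: "eventually P im_top \<longleftrightarrow> (\<exists>Y. \<forall>z. Im z \<ge> Y \<longrightarrow> P z)"
  by (auto simp: eventually_filtercomap_at_top_linorder)

lemma eventually_uhp_im_top: "eventually (\<lambda>z. z \<in> uhp) im_top"
  unfolding eventually_im_top by (intro exI[of _ 1]) (auto simp: uhp_iff)

lemma filterlim_Im_im_top: "filterlim Im at_top im_top"
  by (rule filterlim_filtercomap)

lemma tendsto_norm_decreasing_im_top:
  assumes "c > 0"
  shows "((\<lambda>z. exp (- c * Im z)) \<longlongrightarrow> 0) im_top"
proof -
  have "((\<lambda>y. exp (- c * y)) \<longlongrightarrow> 0) at_top"
    using assms by real_asymp
  from filterlim_compose[OF this filterlim_Im_im_top] show ?thesis .
qed

lemma qexp_tendsto_0: "(qexp \<longlongrightarrow> 0) im_top"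
proof (rule tendsto_norm_zero_cancel)
  show "((\<lambda>z. norm (qexp z)) \<longlongrightarrow> 0) im_top"
    unfolding norm_qexp using tendsto_norm_decreasing_im_top[of "2 * pi"] by simp
qed

lemma qexp_surj:
  assumes "x \<noteq> 0" "norm x < 1"
  obtains z where "z \<in> uhp" "qexp z = x"
proof
  define z where "z = Ln x / (two_pi_i)"
  have "two_pi_i * z = Ln x"
    by (simp add: z_def)
  then show eq: "qexp z = x"
    using assms by simp
  have "exp (- 2 * pi * Im z) < 1"
    using assms(2) unfolding eq[symmetric] norm_qexp .
  then show "z \<in> uhp"
    by (simp add: uhp_iff zero_less_mult_iff)
qed

text \<open>Convergence is assumed only at values of q. Every real t strictly between |x| and 1 is
  such a value, and convergence at t gives absolute convergence at x.\<close>

lemma has_q_expansion_summable: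
  assumes "has_q_expansion f a" "norm x < 1"
  shows "summable (\<lambda>n. norm (a n * x ^ n))"
proof -
  obtain t where t: "norm x < t" "t < 1"
    using assms(2) dense by blast
  then have t0: "t > 0"
    by (meson le_less_trans norm_ge_zero)
  obtain z where z: "z \<in> uhp" "qexp z = of_real t"
    using qexp_surj[of "of_real t"] t t0 by auto
  have "summable (\<lambda>n. a n * of_real t ^ n)"
    using assms(1) z unfolding has_q_expansion_def sums_iff by (metis (no_types))
  then show ?thesis
    by (rule powser_insidea) (use t t0 in auto)
qed

lemma has_q_expansion_sums:
  "has_q_expansion f a \<Longrightarrow> z \<in> uhp \<Longrightarrow> (\<lambda>n. a n * qexp z ^ n) sums f z"
  by (simp add: has_q_expansion_def)

lemma has_q_expansion_powser_sums:
  assumes "has_q_expansion f a" "norm x < 1"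
  shows "(\<lambda>n. a n * x ^ n) sums (\<Sum>n. a n * x ^ n)"
  by (rule summable_sums[OF summable_norm_cancel[OF has_q_expansion_summable[OF assms]]])

text \<open>Once the vanishing terms are dropped, f/q^r is a power series in q, continuous at q = 0
  with value \<open>a r\<close>; and q tends to 0.\<close>

lemma has_q_expansion_order:
  assumes f: "has_q_expansion f a" and r: "\<And>n. n < r \<Longrightarrow> a n = 0"
  shows "((\<lambda>z. f z / qexp z ^ r) \<longlongrightarrow> a r) im_top"
proof -
  define A where "A = (\<lambda>x. \<Sum>n. a (n + r) * x ^ n)"
  have split: "(\<lambda>n. a (n + r) * x ^ n) sums ((\<Sum>n. a n * x ^ n) / x ^ r)" if "x \<noteq> 0" "norm x < 1" for x
  proof -
    have "(\<lambda>n. a (n + r) * x ^ (n + r)) sums ((\<Sum>n. a n * x ^ n) - (\<Sum>n<r. a n * x ^ n))"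
      using sums_split_initial_segment[OF has_q_expansion_powser_sums[OF f that(2)]] by blast
    then have "(\<lambda>n. a (n + r) * x ^ (n + r) / x ^ r) sums ((\<Sum>n. a n * x ^ n) / x ^ r)"
      using r by (intro sums_divide) simp
    then show ?thesis
      using that(1) by (simp add: power_add)
  qed
  have sm: "(\<lambda>n. a (n + r) * x ^ n) sums A x" if "norm x < 1" for x
  proof (cases "x = 0")
    case True
    then show ?thesis by (simp add: A_def powser_zero[of "\<lambda>n. a (n + r)"])
  next
    case False
    then show ?thesis using split[OF False that] unfolding A_def by (simp add: sums_iff)
  qed
  have "(A \<longlongrightarrow> a (0 + r)) (at 0)"
    by (rule powser_limit_0[where s = 1]) (use sm in auto)
  moreover have "A 0 = a r"
    by (simp add: A_def powser_zero[of "\<lambda>n. a (n + r)"])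
  ultimately have "isCont A 0"
    by (simp add: isCont_def)
  from isCont_tendsto_compose[OF this qexp_tendsto_0]
  have "((\<lambda>z. A (qexp z)) \<longlongrightarrow> a r) im_top"
    by (simp add: \<open>A 0 = a r\<close>)
  moreover have "eventually (\<lambda>z. A (qexp z) = f z / qexp z ^ r) im_top"
    using eventually_uhp_im_top
  proof eventually_elim
    case (elim z)
    have "A (qexp z) = (\<Sum>n. a n * qexp z ^ n) / qexp z ^ r"
      using split[of "qexp z"] norm_qexp_less_1[OF elim] by (simp add: A_def sums_iff)
    also have "(\<Sum>n. a n * qexp z ^ n) = f z"
      using has_q_expansion_sums[OF f elim] by (simp add: sums_iff)
    finally show ?case .
  qed
  ultimately show ?thesis
    by (rule Lim_transform_eventually)
qed

lemma has_q_expansion_tendsto: "has_q_expansion f a \<Longrightarrow> (f \<longlongrightarrow> a 0) im_top"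
  using has_q_expansion_order[of f a 0] by simp

lemma has_q_expansion_add:
  "has_q_expansion f a \<Longrightarrow> has_q_expansion g b \<Longrightarrow> has_q_expansion (\<lambda>z. f z + g z) (\<lambda>n. a n + b n)"
  by (simp add: has_q_expansion_def sums_add ring_distribs)

lemma has_q_expansion_diff:
  "has_q_expansion f a \<Longrightarrow> has_q_expansion g b \<Longrightarrow> has_q_expansion (\<lambda>z. f z - g z) (\<lambda>n. a n - b n)"
  by (simp add: has_q_expansion_def sums_diff ring_distribs)

lemma has_q_expansion_cmult:
  "has_q_expansion f a \<Longrightarrow> has_q_expansion (\<lambda>z. c * f z) (\<lambda>n. c * a n)"
  by (simp add: has_q_expansion_def sums_mult mult.assoc)

lemma has_q_expansion_const: "has_q_expansion (\<lambda>z. c) (\<lambda>n. if n = 0 then c else 0)"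
proof -
  have "(\<lambda>n. (if n = 0 then c else 0) * x ^ n) sums c" for x
    using sums_single[of 0 "\<lambda>_. c"] by (rule sums_cong[THEN iffD1, rotated]) auto
  then show ?thesis by (simp add: has_q_expansion_def)
qed

lemma has_q_expansion_mult:
  assumes "has_q_expansion f a" "has_q_expansion g b"
  shows "has_q_expansion (\<lambda>z. f z * g z) (\<lambda>n. \<Sum>i\<le>n. a i * b (n - i))"
  unfolding has_q_expansion_def
proof
  fix z assume z: "z \<in> uhp"
  have "(\<lambda>n. \<Sum>i\<le>n. (a i * qexp z ^ i) * (b (n - i) * qexp z ^ (n - i))) sums
      ((\<Sum>n. a n * qexp z ^ n) * (\<Sum>n. b n * qexp z ^ n))"
    by (intro Cauchy_product_sums has_q_expansion_summable[OF assms(1)] has_q_expansion_summable[OF assms(2)]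
        norm_qexp_less_1 z)
  also have "(\<Sum>n. a n * qexp z ^ n) * (\<Sum>n. b n * qexp z ^ n) = f z * g z"
    using assms[THEN has_q_expansion_sums, OF z] by (simp add: sums_iff)
  also have "(\<lambda>n. \<Sum>i\<le>n. (a i * qexp z ^ i) * (b (n - i) * qexp z ^ (n - i))) =
      (\<lambda>n. (\<Sum>i\<le>n. a i * b (n - i)) * qexp z ^ n)"
  proof
    fix n
    have eq: "(a i * qexp z ^ i) * (b (n - i) * qexp z ^ (n - i)) = (a i * b (n - i)) * qexp z ^ n" if "i \<le> n" for i
    proof -
      have "qexp z ^ n = qexp z ^ i * qexp z ^ (n - i)"
        using that by (simp flip: power_add)
      then show ?thesis by (simp only: mult_ac)
    qed
    show "(\<Sum>i\<le>n. (a i * qexp z ^ i) * (b (n - i) * qexp z ^ (n - i))) = (\<Sum>i\<le>n. a i * b (n - i)) * qexp z ^ n"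
      unfolding sum_distrib_right by (rule sum.cong[OF refl], rule eq) simp
  qed
  finally show "(\<lambda>n. (\<Sum>i\<le>n. a i * b (n - i)) * qexp z ^ n) sums (f z * g z)" .
qed

text \<open>Strong induction: when the coefficients below n agree, (f - g)/q^n tends to
  \<open>a n - b n\<close>.\<close>

lemma has_q_expansion_unique:
  assumes "has_q_expansion f a" "has_q_expansion g b" "\<And>z. z \<in> uhp \<Longrightarrow> f z = g z"
  shows "a = b"
proof
  fix n show "a n = b n"
  proof (induction n rule: less_induct)
    case (less n)
    have "((\<lambda>z. (f z - g z) / qexp z ^ n) \<longlongrightarrow> a n - b n) im_top"
      using less has_q_expansion_order[OF has_q_expansion_diff[OF assms(1,2)], of n] by simp
    moreover have "eventually (\<lambda>z. (f z - g z) / qexp z ^ n = 0) im_top"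
      using eventually_uhp_im_top by eventually_elim (simp add: assms(3))
    ultimately have "((\<lambda>z. 0) \<longlongrightarrow> a n - b n) im_top"
      by (rule Lim_transform_eventually)
    then show ?case
      by (simp add: tendsto_const_iff)
  qed
qed

text \<open>The function \<open>g\<close> is q df/dq, the derivative normalized to keep the factor 2
  pi i out of the coefficients.\<close>

lemma has_q_expansion_DERIV:
  assumes "has_q_expansion f a"
  obtains g where "has_q_expansion g (\<lambda>n. of_nat n * a n)"
    "\<And>z. z \<in> uhp \<Longrightarrow> (f has_field_derivative two_pi_i * g z) (at z)"
proof
  define F where "F = (\<lambda>x. \<Sum>n. a n * x ^ n)"
  have F: "(\<lambda>n. a n * x ^ n) sums F x" if "norm x < 1" for x
    unfolding F_def by (rule has_q_expansion_powser_sums[OF assms that])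
  have dF: "(F has_field_derivative (\<Sum>n. diffs a n * x ^ n)) (at x)" if "norm x < 1" for x
    unfolding F_def by (rule termdiffs_strong'[OF _ that]) (use F in \<open>auto simp: sums_iff\<close>)
  define g where "g = (\<lambda>z. qexp z * (\<Sum>n. diffs a n * qexp z ^ n))"
  show "has_q_expansion g (\<lambda>n. of_nat n * a n)"
    unfolding has_q_expansion_def g_def
    by (intro ballI x_times_deriv_powser_sums[OF F _ dF] norm_qexp_less_1)
  fix z assume z: "z \<in> uhp"
  have "((\<lambda>z. F (qexp z)) has_field_derivative two_pi_i * g z) (at z)"
    unfolding g_def by (rule DERIV_qexp_chain[OF dF[OF norm_qexp_less_1[OF z]]])
  then show "(f has_field_derivative two_pi_i * g z) (at z)"
    by (rule has_field_derivative_transform_within_open[OF _ open_uhp z])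
      (use has_q_expansion_sums[OF assms] in \<open>auto simp: F_def sums_iff\<close>)
qed

lemma has_q_expansion_holomorphic: "has_q_expansion f a \<Longrightarrow> f holomorphic_on uhp"
  by (metis has_q_expansion_DERIV holomorphic_on_open open_uhp)

lemma has_q_expansion_dilate:
  assumes "has_q_expansion f a" "d > 0"
  shows "has_q_expansion (\<lambda>z. f (of_nat d * z)) (\<lambda>n. if d dvd n then a (n div d) else 0)"
  unfolding has_q_expansion_def
proof
  fix z assume z: "z \<in> uhp"
  have eq: "qexp (of_nat d * z) = qexp z ^ d"
    by (simp only: exp_of_nat_mult[symmetric] mult_ac)
  have "(\<lambda>n. a n * (qexp z ^ d) ^ n) sums f (of_nat d * z)"
    using has_q_expansion_sums[OF assms(1) uhp_mult_nat[OF z assms(2)]] by (simp only: eq)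
  then have "(\<lambda>n. (if d dvd (d * n) then a ((d * n) div d) else 0) * qexp z ^ (d * n)) sums f (of_nat d * z)"
    using assms(2) by (simp add: power_mult)
  then show "(\<lambda>n. (if d dvd n then a (n div d) else 0) * qexp z ^ n) sums f (of_nat d * z)"
  proof (subst (asm) sums_mono_reindex)
    show "strict_mono ((*) d)" using assms(2) by (auto simp: strict_mono_def)
    show "(if d dvd n then a (n div d) else 0) * qexp z ^ n = 0" if "n \<notin> range ((*) d)" for n
      using that by (auto elim: dvdE)
  qed
qed

section \<open>The operator U_2 on coefficients\<close>

text \<open>At z/2 and (z+1)/2 the variable q takes the two square roots of its value at z. These
  differ by sign, so averaging removes the odd powers.\<close>

lemma has_q_expansion_even_part_sums:
  assumes "has_q_expansion f a" "z \<in> uhp"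
  shows "(\<lambda>n. a (2 * n) * qexp z ^ n) sums ((f (z / 2) + f ((z + 1) / 2)) / 2)"
proof -
  have u: "z / 2 \<in> uhp" "(z + 1) / 2 \<in> uhp"
    using assms(2) by (auto simp: uhp_iff)
  have e1: "qexp ((z + 1) / 2) = - qexp (z / 2)"
  proof -
    have "two_pi_i * ((z + 1) / 2) = two_pi_i * (z / 2) + of_real pi * \<i>"
      by (simp add: algebra_simps)
    then show ?thesis
      by (simp only: exp_add exp_pi_i) simp
  qed
  have e2: "qexp z = qexp (z / 2) ^ 2"
    by (simp add: power2_eq_square mult_ac flip: exp_add)
  have "(\<lambda>n. (a n * qexp (z / 2) ^ n + a n * qexp ((z + 1) / 2) ^ n) / 2) sums ((f (z / 2) + f ((z + 1) / 2)) / 2)"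
    by (intro sums_divide sums_add has_q_expansion_sums[OF assms(1)] u)
  also have "(\<lambda>n. (a n * qexp (z / 2) ^ n + a n * qexp ((z + 1) / 2) ^ n) / 2) =
      (\<lambda>n. if even n then a n * qexp (z / 2) ^ n else 0)"
    unfolding e1 by (auto simp: fun_eq_iff)
  finally have 1: "(\<lambda>n. if even n then a n * qexp (z / 2) ^ n else 0) sums ((f (z / 2) + f ((z + 1) / 2)) / 2)" .
  have "(\<lambda>n. if even (2 * n) then a (2 * n) * qexp (z / 2) ^ (2 * n) else 0) sums ((f (z / 2) + f ((z + 1) / 2)) / 2)"
    using 1
  proof (subst sums_mono_reindex[where f = "\<lambda>n. if even n then a n * qexp (z / 2) ^ n else 0"])
    show "strict_mono ((*) (2::nat))" by (auto simp: strict_mono_def)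
    show "(if even n then a n * qexp (z / 2) ^ n else 0) = 0" if "n \<notin> range ((*) 2)" for n
      using that by (auto elim: evenE)
  qed
  then show ?thesis
    unfolding e2 by (simp add: power_mult)
qed

text \<open>For even N only the divisor 1 of 2 is coprime to N, so the Hecke operator at 2 is U_2.
  Comparing first coefficients, the eigenvalue is \<open>a 2\<close>.\<close>

lemma hecke_2_eigen_coeff:
  assumes "hecke_eigenform 4 N f" "even N" "has_q_expansion f a" "a 1 = 1"
  shows "a (2 * n) = a 2 * a n"
proof -
  obtain c where c: "\<And>z. z \<in> uhp \<Longrightarrow> hecke 4 N 2 f z = c * f z"
    using assms(1) unfolding hecke_eigenform_def by (metis pos2)
  have A: "{a. a dvd 2 \<and> coprime a N} = {1::nat}"
  proof -
    have "d = 1 \<or> d = 2" if "d dvd 2" for d :: nat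
      using that two_is_prime_nat by (auto simp: prime_nat_iff)
    moreover have "\<not> coprime 2 N"
      using assms(2) by simp
    ultimately show ?thesis
      by (metis (mono_tags, lifting) Collect_cong coprime_1_left one_dvd singleton_conv)
  qed
  have h: "hecke 4 N 2 f z = (f (z / 2) + f ((z + 1) / 2)) / 2" for z
    unfolding hecke_def A by (simp add: lessThan_Suc numeral_2_eq_2 field_simps)
  have "has_q_expansion (\<lambda>z. c * f z) (\<lambda>n. a (2 * n))"
    unfolding has_q_expansion_def using has_q_expansion_even_part_sums[OF assms(3)] c h by simp
  from has_q_expansion_unique[OF this has_q_expansion_cmult[OF assms(3)]]
  have "a (2 * n) = c * a n" for n
    by (simp add: fun_eq_iff)
  from this[of n] this[of 1] show ?thesis
    using assms(4) by simp
qed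

section \<open>Functions of weight 0\<close>

abbreviation jac :: "int \<Rightarrow> int \<Rightarrow> complex \<Rightarrow> complex" where
  "jac c d z \<equiv> of_int c * z + of_int d"

text \<open>The matrix is passed as four integers so that identities between entries are plain ring
  identities; \<open>cusp_form_imp_mform\<close> translates from matrices.\<close>

definition mob :: "int \<Rightarrow> int \<Rightarrow> int \<Rightarrow> int \<Rightarrow> complex \<Rightarrow> complex" where
  "mob a b c d z = (of_int a * z + of_int b) / (jac c d z)"

lemma mob_denom_neq_0:
  assumes "a * d - b * c = (1::int)" "z \<in> uhp"
  shows "jac c d z \<noteq> 0"
proof
  assume eq: "jac c d z = 0"
  from arg_cong[OF eq, of Im] have "c = 0" using assms(2) by (simp add: uhp_iff)
  with eq have "d = 0" by simp
  with \<open>c = 0\<close> assms(1) show False by simp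
qed

lemma Im_mob:
  assumes "a * d - b * c = (1::int)"
  shows "Im (mob a b c d z) = Im z / (norm (jac c d z))\<^sup>2"
proof -
  have "real_of_int a * real_of_int d - real_of_int b * real_of_int c = 1"
    using assms by (metis of_int_1 of_int_diff of_int_mult)
  then have "(Im (of_int a * z + of_int b)) * (Re (jac c d z)) - (Re (of_int a * z + of_int b)) * (Im (jac c d z)) = Im z"
    by simp algebra
  then show ?thesis
    by (simp add: mob_def Im_divide cmod_power2)
qed

lemma mob_in_uhp:
  assumes "a * d - b * c = 1" "z \<in> uhp"
  shows "mob a b c d z \<in> uhp"
  using assms mob_denom_neq_0[OF assms] by (simp add: uhp_iff Im_mob)

lemma mob_automorphy:
  assumes "a' * d' - b' * c' = 1" "z \<in> uhp"
  shows "(of_int c * mob a' b' c' d' z + of_int d) * (jac c' d' z) =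
    of_int (c * a' + d * c') * z + of_int (c * b' + d * d')"
  using mob_denom_neq_0[OF assms] by (simp add: mob_def field_simps)

lemma mob_mob:
  assumes "a * d - b * c = 1" "a' * d' - b' * c' = 1" "z \<in> uhp"
  shows "mob a b c d (mob a' b' c' d' z) =
    mob (a * a' + b * c') (a * b' + b * d') (c * a' + d * c') (c * b' + d * d') z"
proof -
  let ?w = "mob a' b' c' d' z" and ?j = "jac c' d' z"
  have "mob a b c d ?w = ((of_int a * ?w + of_int b) * ?j) / ((of_int c * ?w + of_int d) * ?j)"
    using mob_denom_neq_0[OF assms(2,3)] by (simp add: mob_def)
  then show ?thesis
    by (simp only: mob_automorphy[OF assms(2,3)]) (simp add: mob_def)
qed

lemma mob_inverse:
  assumes "a * d - b * c = 1" "z \<in> uhp"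
  shows "mob a b c d (mob d (- b) (- c) a z) = z"
proof -
  have "mob a b c d (mob d (- b) (- c) a z) = mob 1 0 0 1 z"
    using assms by (subst mob_mob) (auto simp: algebra_simps)
  then show ?thesis by (simp add: mob_def)
qed

lemma mob_holomorphic:
  assumes "a * d - b * c = 1"
  shows "mob a b c d holomorphic_on uhp"
  unfolding mob_def by (intro holomorphic_intros) (use mob_denom_neq_0[OF assms] in auto)

section \<open>Weight 0 in level 1 by the maximum principle\<close>

text \<open>If |Re v| <= 1/2 and Im v < 1/2 then |v|^2 <= 1/2, so inversion at least doubles the
  imaginary part. The induction is on a k with 2^k Im z >= 1/2.\<close>

lemma reduce_Im_ge_half:
  assumes T: "\<And>z. z \<in> uhp \<Longrightarrow> F (z + 1) = F z" and S: "\<And>z. z \<in> uhp \<Longrightarrow> F (- 1 / z) = F z"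
    and z: "z \<in> uhp"
  obtains w where "w \<in> uhp" "Im w \<ge> 1 / 2" "\<bar>Re w\<bar> \<le> 1 / 2" "F w = F z"
proof -
  have Tn: "F (z + of_nat n) = F z" if "z \<in> uhp" for n z
  proof (induction n)
    case (Suc n)
    have "F (z + of_nat n + 1) = F (z + of_nat n)"
      by (rule T) (use that in \<open>simp add: uhp_iff\<close>)
    with Suc show ?case by (simp add: add_ac)
  qed simp
  have Tz: "F (z + of_int n) = F z" if "z \<in> uhp" for n z
  proof (cases "n \<ge> 0")
    case True
    then show ?thesis using Tn[OF that, of "nat n"] by simp
  next
    case False
    then show ?thesis using Tn[of "z + of_int n" "nat (- n)"] that by (simp add: uhp_iff)
  qed
  have tr: "\<exists>w. w \<in> uhp \<and> Im w = Im z \<and> \<bar>Re w\<bar> \<le> 1 / 2 \<and> F w = F z" if "z \<in> uhp" for z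
  proof -
    have "\<bar>of_int (round (Re z)) - Re z\<bar> \<le> 1 / 2"
      by (rule of_int_round_abs_le)
    then show ?thesis
      using Tz[OF that, of "- round (Re z)"] that
      by (intro exI[of _ "z + of_int (- round (Re z))"]) (auto simp: uhp_iff abs_minus_commute)
  qed
  have "\<exists>w. w \<in> uhp \<and> Im w \<ge> 1 / 2 \<and> \<bar>Re w\<bar> \<le> 1 / 2 \<and> F w = F z" if "z \<in> uhp" "2 ^ k * Im z \<ge> 1 / 2" for k z
    using that
  proof (induction k arbitrary: z)
    case 0
    then show ?case using tr[of z] by auto
  next
    case (Suc k)
    obtain v where v: "v \<in> uhp" "Im v = Im z" "\<bar>Re v\<bar> \<le> 1 / 2" "F v = F z"
      using tr[OF Suc.prems(1)] by blast
    show ?case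
    proof (cases "Im v \<ge> 1 / 2")
      case True
      with v show ?thesis by auto
    next
      case False
      have "(Re v)\<^sup>2 \<le> (1 / 2)\<^sup>2"
        using power_mono[OF v(3), of 2] by simp
      moreover have "(Im v)\<^sup>2 \<le> (1 / 2)\<^sup>2"
        using False v(1) by (intro power_mono) (auto simp: uhp_iff)
      ultimately have le: "(norm v)\<^sup>2 \<le> 1 / 2"
        unfolding cmod_power2 by (simp add: power2_eq_square)
      have pos: "(norm v)\<^sup>2 > 0"
        using uhp_neq_0[OF v(1)] by simp
      have "2 * Im v \<le> Im (- 1 / v)"
      proof -
        have "2 * Im v * (norm v)\<^sup>2 \<le> 2 * Im v * (1 / 2)"
          using le v(1) by (intro mult_left_mono) (auto simp: uhp_iff)
        then show ?thesis
          unfolding Im_minus_inverse using pos by (simp add: le_divide_eq)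
      qed
      then have "2 ^ k * (2 * Im v) \<le> 2 ^ k * Im (- 1 / v)"
        by (intro mult_left_mono) auto
      then have "1 / 2 \<le> 2 ^ k * Im (- 1 / v)"
        using Suc.prems(2) v(2) by simp
      from Suc.IH[OF uhp_minus_inverse[OF v(1)] this] show ?thesis
        using S[OF v(1)] v(4) by simp
    qed
  qed
  moreover have "\<exists>k. 2 ^ k * Im z \<ge> 1 / 2"
  proof -
    obtain k where "1 / (2 * Im z) < 2 ^ k"
      using real_arch_pow[of 2 "1 / (2 * Im z)"] by auto
    then show ?thesis
      using z by (intro exI[of _ k]) (simp add: uhp_iff field_simps)
  qed
  ultimately show ?thesis
    using z that by blast
qed

text \<open>If F z were nonzero, |F| would be smaller than |F z| above some height, so its maximum
  over a compact rectangle would be global. The maximum principle then makes F constant, against the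
  limit 0.\<close>

lemma level_1_weight_0_eq_0:
  assumes hol: "F holomorphic_on uhp"
    and T: "\<And>z. z \<in> uhp \<Longrightarrow> F (z + 1) = F z" and S: "\<And>z. z \<in> uhp \<Longrightarrow> F (- 1 / z) = F z"
    and lim: "(F \<longlongrightarrow> 0) im_top" and z: "z \<in> uhp"
  shows "F z = 0"
proof (rule ccontr)
  assume nz: "F z \<noteq> 0"
  obtain z1 where z1: "z1 \<in> uhp" "Im z1 \<ge> 1 / 2" "\<bar>Re z1\<bar> \<le> 1 / 2" "F z1 = F z"
    using reduce_Im_ge_half[OF T S z] by blast
  have "eventually (\<lambda>w. norm (F w) < norm (F z)) im_top"
    using order_tendstoD(2)[OF tendsto_norm_zero[OF lim], of "norm (F z)"] nz by simp
  then obtain Y where Y: "\<And>w. Im w \<ge> Y \<Longrightarrow> norm (F w) < norm (F z)"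
    unfolding eventually_im_top by blast
  define K where "K = cbox (Complex (- 1 / 2) (1 / 2)) (Complex (1 / 2) Y)"
  have K: "w \<in> K \<longleftrightarrow> \<bar>Re w\<bar> \<le> 1 / 2 \<and> 1 / 2 \<le> Im w \<and> Im w \<le> Y" for w
    by (auto simp: K_def in_cbox_complex_iff)
  have "z1 \<in> K"
    using z1 Y[of z1] unfolding K by (metis linear order_less_irrefl)
  moreover have "continuous_on K (\<lambda>w. norm (F w))"
    by (intro continuous_on_norm continuous_on_subset[OF holomorphic_on_imp_continuous_on[OF hol]])
      (auto simp: K uhp_iff)
  moreover have "compact K"
    unfolding K_def by (rule compact_cbox)
  ultimately obtain z0 where z0: "z0 \<in> K" "\<And>w. w \<in> K \<Longrightarrow> norm (F w) \<le> norm (F z0)"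
    using continuous_attains_sup[of K "\<lambda>w. norm (F w)"] by blast
  have z0': "z0 \<in> uhp" using z0(1) by (auto simp: K uhp_iff)
  have ge: "norm (F z) \<le> norm (F z0)"
    using z0(2)[OF \<open>z1 \<in> K\<close>] z1(4) by simp
  have "norm (F w) \<le> norm (F z0)" if w: "w \<in> uhp" for w
  proof -
    obtain v where v: "v \<in> uhp" "Im v \<ge> 1 / 2" "\<bar>Re v\<bar> \<le> 1 / 2" "F v = F w"
      using reduce_Im_ge_half[OF T S w] by blast
    show ?thesis
    proof (cases "Im v \<le> Y")
      case True
      then show ?thesis using z0(2)[of v] v by (simp add: K)
    next
      case False
      then show ?thesis using Y[of v] v ge by simp
    qed
  qed
  then have "F constant_on uhp"
    by (intro maximum_modulus_principle[OF hol open_uhp connected_uhp open_uhp order_refl z0'])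
  then obtain c where c: "\<And>w. w \<in> uhp \<Longrightarrow> F w = c"
    by (auto simp: constant_on_def)
  have "norm (F (Complex 0 (max 1 Y))) < norm (F z)"
    by (rule Y) simp
  moreover have "Complex 0 (max 1 Y) \<in> uhp"
    by (simp add: uhp_iff)
  ultimately show False
    using c z by simp
qed

section \<open>From level N to level 1 by a norm\<close>

text \<open>Identity theorem: unless f vanishes identically, the remaining product vanishes on the
  nonempty open set where f is nonzero, hence everywhere.\<close>

lemma holomorphic_prod_eq_0:
  assumes "finite A" "open S" "connected S" "S \<noteq> {}" "\<And>f. f \<in> A \<Longrightarrow> f holomorphic_on S"
    and "\<And>z. z \<in> S \<Longrightarrow> (\<Prod>f\<in>A. f z) = 0"
  shows "\<exists>f\<in>A. \<forall>z\<in>S. f z = (0 :: complex)"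
  using assms(1,5,6)
proof (induction A rule: finite_induct)
  case empty
  then show ?case using assms(4) by auto
next
  case (insert f A)
  show ?case
  proof (cases "\<forall>z\<in>S. f z = 0")
    case False
    then obtain z0 where z0: "z0 \<in> S" "f z0 \<noteq> 0" by blast
    have holf: "f holomorphic_on S" and holA: "(\<lambda>z. \<Prod>g\<in>A. g z) holomorphic_on S"
      using insert.prems(1) by (auto intro!: holomorphic_intros)
    define U where "U = {z \<in> S. f z \<noteq> 0}"
    have "open U"
      unfolding U_def using continuous_open_preimage[OF holomorphic_on_imp_continuous_on[OF holf] assms(2) open_Compl[OF closed_singleton[of 0]]]
      by (simp add: vimage_def Int_def)
    moreover have "(\<Prod>g\<in>A. g z) = 0" if "z \<in> U" for z
      using insert.prems(2)[of z] insert.hyps that by (auto simp: U_def)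
    ultimately have "(\<Prod>g\<in>A. g z) = 0" if "z \<in> S" for z
      using analytic_continuation_open[of U S "\<lambda>z. \<Prod>g\<in>A. g z" "\<lambda>_. 0" z] that z0 assms(2,3) holA
      by (auto simp: U_def)
    then show ?thesis
      using insert.IH insert.prems(1) by auto
  qed auto
qed

lemma finite_image_of_key:
  assumes "finite (key ` X)" "\<And>x y. x \<in> X \<Longrightarrow> y \<in> X \<Longrightarrow> key x = key y \<Longrightarrow> f x = f y"
  shows "finite (f ` X)"
proof -
  have "f ` X \<subseteq> (\<lambda>k. f (SOME x. x \<in> X \<and> key x = k)) ` (key ` X)"
  proof
    fix y assume "y \<in> f ` X"
    then obtain x where x: "x \<in> X" "y = f x" by blast
    then have "\<exists>x'. x' \<in> X \<and> key x' = key x" by blast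
    then have "(SOME x'. x' \<in> X \<and> key x' = key x) \<in> X \<and> key (SOME x'. x' \<in> X \<and> key x' = key x) = key x"
      by (rule someI_ex)
    then have "f (SOME x'. x' \<in> X \<and> key x' = key x) = y"
      using assms(2)[of _ x] x by blast
    then show "y \<in> (\<lambda>k. f (SOME x. x \<in> X \<and> key x = k)) ` (key ` X)"
      using x(1) by blast
  qed
  then show ?thesis
    using assms(1) finite_subset by blast
qed

lemma Bfun_mult:
  fixes f g :: "'a \<Rightarrow> complex"
  assumes "Bfun f F" "Bfun g F"
  shows "Bfun (\<lambda>z. f z * g z) F"
proof -
  obtain A B where AB: "A > 0" "eventually (\<lambda>z. norm (f z) \<le> A) F" "B > 0" "eventually (\<lambda>z. norm (g z) \<le> B) F"
    using assms by (elim BfunE) blast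
  have "eventually (\<lambda>z. norm (f z * g z) \<le> A * B) F"
    using AB(2,4) by eventually_elim (use AB(1) in \<open>auto simp: norm_mult intro!: mult_mono\<close>)
  then show ?thesis
    by (rule BfunI)
qed

lemma Bfun_prod:
  fixes A :: "(complex \<Rightarrow> complex) set"
  assumes "\<And>f. f \<in> A \<Longrightarrow> Bfun f F"
  shows "Bfun (\<lambda>z. \<Prod>f\<in>A. f z) F"
proof (cases "finite A")
  case True
  then show ?thesis
    using assms by (induction A rule: finite_induct) (auto intro!: Bfun_mult)
qed auto

text \<open>The norm to level 1 is taken over the finite set of functions \<open>R \<circ> A\<close> rather than over
  cosets, so that no system of representatives is needed.\<close>

lemma weight_0_eq_0:
  fixes R :: "complex \<Rightarrow> complex"
  assumes N: "N > 0" and hol: "R holomorphic_on uhp"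
    and inv: "\<And>a b c d z. a * d - b * c = 1 \<Longrightarrow> int N dvd c \<Longrightarrow> z \<in> uhp \<Longrightarrow> R (mob a b c d z) = R z"
    and bdd: "\<And>a b c d. a * d - b * c = 1 \<Longrightarrow> Bfun (\<lambda>z. R (mob a b c d z)) im_top"
    and lim: "(R \<longlongrightarrow> 0) im_top" and w: "w \<in> uhp"
  shows "R w = 0"
proof -
  define X where "X = {(a, b, c, d). a * d - b * c = (1::int)}"
  \<comment> \<open>The value 0 outside \<open>uhp\<close> makes functions that agree on
    \<open>uhp\<close> equal as elements of the set \<open>A\<close>.\<close>
  define \<psi> where "\<psi> = (\<lambda>(a, b, c, d) z. if z \<in> uhp then R (mob a b c d z) else 0)"
  define A where "A = \<psi> ` X"
  have AE: "\<exists>a b c d. a * d - b * c = 1 \<and> \<phi> = \<psi> (a, b, c, d)" if "\<phi> \<in> A" for \<phi>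
  proof -
    obtain x where x: "x \<in> X" "\<phi> = \<psi> x" using \<open>\<phi> \<in> A\<close> unfolding A_def by blast
    moreover obtain a b c d where "x = (a, b, c, d)" by (metis prod_cases4)
    ultimately show ?thesis by (auto simp: X_def)
  qed
  have Xm: "(a * a' + b * c', a * b' + b * d', c * a' + d * c', c * b' + d * d') \<in> X"
    if "(a, b, c, d) \<in> X" "(a', b', c', d') \<in> X" for a b c d a' b' c' d'
  proof -
    have "(a * a' + b * c') * (c * b' + d * d') - (a * b' + b * d') * (c * a' + d * c') = (a * d - b * c) * (a' * d' - b' * c')"
      by (simp add: algebra_simps)
    then show ?thesis using that by (simp add: X_def)
  qed
  have fin: "finite A"
    unfolding A_def
  \<comment> \<open>The coset of a matrix under level N is determined by its bottom row modulo N,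
    which takes finitely many values.\<close>
  proof (rule finite_image_of_key[where key = "\<lambda>(a, b, c, d). (c mod int N, d mod int N)"])
    have "(\<lambda>(a, b, c, d). (c mod int N, d mod int N)) ` X \<subseteq> {0..<int N} \<times> {0..<int N}"
      using N by auto
    then show "finite ((\<lambda>(a, b, c, d). (c mod int N, d mod int N)) ` X)"
      by (rule finite_subset) auto
  next
    fix x y assume xy: "x \<in> X" "y \<in> X"
      "(case x of (a, b, c, d) \<Rightarrow> (c mod int N, d mod int N)) = (case y of (a, b, c, d) \<Rightarrow> (c mod int N, d mod int N))"
    obtain a b c d a' b' c' d' where eq: "x = (a, b, c, d)" "y = (a', b', c', d')"
      by (metis prod_cases4)
    have det: "a * d - b * c = 1" "a' * d' - b' * c' = 1"
      using xy eq by (auto simp: X_def)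
    have "int N dvd c - c'" "int N dvd d - d'"
      using xy(3) eq by (auto simp: mod_eq_dvd_iff)
    then have "int N dvd (c - c') * d' - (d - d') * c'"
      by (simp add: dvd_diff)
    then have dv: "int N dvd c * d' - d * c'"
      by (simp add: algebra_simps)
    \<comment> \<open>The entries are those of the first matrix times the inverse of the second; by
      \<open>dv\<close> the product lies in the level N group.\<close>
    have g: "(a * d' - b * c') * (d * a' - c * b') - (b * a' - a * b') * (c * d' - d * c') = 1"
      using det by algebra
    have "R (mob a b c d z) = R (mob a' b' c' d' z)" if "z \<in> uhp" for z
    proof -
      have "mob a b c d z = mob (a * d' - b * c') (b * a' - a * b') (c * d' - d * c') (d * a' - c * b') (mob a' b' c' d' z)"
      proof (subst mob_mob[OF g det(2) that])
        have "(a * d' - b * c') * a' + (b * a' - a * b') * c' = a" "(a * d' - b * c') * b' + (b * a' - a * b') * d' = b"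
          "(c * d' - d * c') * a' + (d * a' - c * b') * c' = c" "(c * d' - d * c') * b' + (d * a' - c * b') * d' = d"
          using det by algebra+
        then show "mob a b c d z = mob ((a * d' - b * c') * a' + (b * a' - a * b') * c') ((a * d' - b * c') * b' + (b * a' - a * b') * d')
            ((c * d' - d * c') * a' + (d * a' - c * b') * c') ((c * d' - d * c') * b' + (d * a' - c * b') * d') z"
          by simp
      qed
      then show ?thesis
        using inv[OF g dv mob_in_uhp[OF det(2) that]] by simp
    qed
    then show "\<psi> x = \<psi> y"
      by (auto simp: \<psi>_def eq)
  qed
  define F where "F = (\<lambda>z. \<Prod>\<phi>\<in>A. \<phi> z)"
  \<comment> \<open>Precomposition with an element of the full modular group permutes
    \<open>A\<close>, with the inverse matrix giving the inverse permutation.\<close>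
  have inv_F: "F (mob p q r s z) = F z" if pqrs: "p * s - q * r = 1" and z: "z \<in> uhp" for p q r s z
  proof -
    define G where "G = (\<lambda>p q r s \<phi> z. if z \<in> uhp then \<phi> (mob p q r s z) else (0 :: complex))"
    have GA: "G p q r s \<phi> \<in> A" if "\<phi> \<in> A" "p * s - q * r = 1" for \<phi> p q r s
    proof -
      obtain a b c d where abcd: "(a, b, c, d) \<in> X" "\<phi> = \<psi> (a, b, c, d)"
        using AE[OF \<open>\<phi> \<in> A\<close>] by (auto simp: X_def)
      have pX: "(p, q, r, s) \<in> X" using that(2) by (simp add: X_def)
      have "G p q r s \<phi> = \<psi> (a * p + b * r, a * q + b * s, c * p + d * r, c * q + d * s)"
        using abcd that(2) by (auto simp: G_def \<psi>_def fun_eq_iff X_def mob_mob mob_in_uhp)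
      then show ?thesis
        using Xm[OF abcd(1) pX] by (auto simp: A_def)
    qed
    have G_inv: "G p q r s (G s (- q) (- r) p \<phi>) = \<phi>" if "\<phi> \<in> A" "p * s - q * r = 1" for \<phi> p q r s
    proof -
      have "s * p - (- q) * (- r) = 1" using that(2) by (simp add: algebra_simps)
      from mob_inverse[OF this] have "mob s (- q) (- r) p (mob p q r s z) = z" if "z \<in> uhp" for z
        using that by simp
      then show ?thesis
        using that by (auto simp: G_def A_def \<psi>_def fun_eq_iff mob_in_uhp)
    qed
    have det': "s * p - (- q) * (- r) = 1" using pqrs by (simp add: algebra_simps)
    have "bij_betw (G p q r s) A A"
      by (rule bij_betw_byWitness[where f' = "G s (- q) (- r) p"])
        (use GA[OF _ pqrs] GA[OF _ det'] G_inv[OF _ pqrs] G_inv[OF _ det'] in auto)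
    then have "F z = (\<Prod>\<phi>\<in>A. G p q r s \<phi> z)"
      unfolding F_def by (rule prod.reindex_bij_betw[symmetric])
    also have "\<dots> = F (mob p q r s z)"
      unfolding F_def using z by (simp add: G_def)
    finally show ?thesis by simp
  qed
  have holA: "\<phi> holomorphic_on uhp" if "\<phi> \<in> A" for \<phi>
  proof -
    obtain a b c d where abcd: "a * d - b * c = 1" "\<phi> = \<psi> (a, b, c, d)"
      using AE[OF \<open>\<phi> \<in> A\<close>] by blast
    have "(R \<circ> mob a b c d) holomorphic_on uhp"
      by (rule holomorphic_on_compose_gen[OF mob_holomorphic[OF abcd(1)] hol]) (use mob_in_uhp[OF abcd(1)] in auto)
    then show ?thesis
      by (rule holomorphic_transform) (simp add: abcd(2) \<psi>_def)
  qed
  have holF: "F holomorphic_on uhp"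
    unfolding F_def using holA by (intro holomorphic_intros)
  have bddA: "Bfun \<phi> im_top" if "\<phi> \<in> A" for \<phi>
  proof -
    obtain a b c d where abcd: "a * d - b * c = 1" "\<phi> = \<psi> (a, b, c, d)"
      using AE[OF \<open>\<phi> \<in> A\<close>] by blast
    obtain B where "B > 0" "eventually (\<lambda>z. norm (R (mob a b c d z)) \<le> B) im_top"
      using bdd[OF abcd(1)] by (elim BfunE)
    then show ?thesis
      by (intro BfunI[where K = B]) (auto elim!: eventually_mono simp: abcd(2) \<psi>_def)
  qed
  have I: "\<psi> (1, 0, 0, 1) \<in> A"
    by (simp add: A_def X_def)
  \<comment> \<open>The identity matrix contributes a factor tending to 0 and the other factors are
    bounded, so the product tends to 0.\<close>
  have "(\<psi> (1, 0, 0, 1) \<longlongrightarrow> 0) im_top"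
    using lim by (rule Lim_transform_eventually)
      (use eventually_uhp_im_top in \<open>eventually_elim, simp add: \<psi>_def mob_def\<close>)
  moreover have "Bfun (\<lambda>z. \<Prod>\<phi>\<in>A - {\<psi> (1, 0, 0, 1)}. \<phi> z) im_top"
    by (rule Bfun_prod) (use bddA in auto)
  ultimately have "Zfun (\<lambda>z. \<psi> (1, 0, 0, 1) z * (\<Prod>\<phi>\<in>A - {\<psi> (1, 0, 0, 1)}. \<phi> z)) im_top"
    by (intro bounded_bilinear.Zfun_prod_Bfun[OF bounded_bilinear_mult]) (simp_all add: tendsto_Zfun_iff)
  moreover have "F = (\<lambda>z. \<psi> (1, 0, 0, 1) z * (\<Prod>\<phi>\<in>A - {\<psi> (1, 0, 0, 1)}. \<phi> z))"
    unfolding F_def by (rule ext) (rule prod.remove[OF fin I])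
  ultimately have limF: "(F \<longlongrightarrow> 0) im_top"
    by (simp add: tendsto_Zfun_iff)
  have "F z = 0" if "z \<in> uhp" for z
    using inv_F[of 1 1 1 0] inv_F[of 0 0 "- 1" 1] that
    by (intro level_1_weight_0_eq_0[OF holF _ _ limF that]) (auto simp: mob_def)
  then obtain \<phi> where \<phi>: "\<phi> \<in> A" "\<And>z. z \<in> uhp \<Longrightarrow> \<phi> z = 0"
    using holomorphic_prod_eq_0[OF fin open_uhp connected_uhp _ holA] w unfolding F_def by blast
  obtain a b c d where abcd: "a * d - b * c = 1" "\<phi> = \<psi> (a, b, c, d)"
    using AE[OF \<phi>(1)] by blast
  have "d * a - (- b) * (- c) = 1" using abcd(1) by (simp add: algebra_simps)
  from mob_in_uhp[OF this w] have "\<phi> (mob d (- b) (- c) a w) = R w"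
    unfolding abcd(2) \<psi>_def using mob_inverse[OF abcd(1) w] by simp
  with \<phi>(2)[OF mob_in_uhp[OF \<open>d * a - (- b) * (- c) = 1\<close> w]] show ?thesis
    by simp
qed

section \<open>The discriminant and Ramanujan's identity\<close>

text \<open>The Euclidean algorithm on the first column: reduce a modulo c by a translation, then
  exchange the rows by S, until c = 0.\<close>

lemma SL2Z_induct [consumes 1, case_names one T S]:
  fixes a b c d :: int
  assumes "a * d - b * c = 1" and one: "Q 1 0 0 1"
    and T: "\<And>a b c d n. a * d - b * c = 1 \<Longrightarrow> Q a b c d \<Longrightarrow> Q (a + n * c) (b + n * d) c d"
    and S: "\<And>a b c d. a * d - b * c = 1 \<Longrightarrow> Q a b c d \<Longrightarrow> Q (- c) (- d) a b"
  shows "Q a b c d"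
  using assms(1)
proof (induction "nat \<bar>c\<bar>" arbitrary: a b c d rule: less_induct)
  case less
  show ?case
  proof (cases "c = 0")
    case True
    then have "a * d = 1" using less.prems by simp
    then consider "a = 1" "d = 1" | "a = - 1" "d = - 1"
      using pos_zmult_eq_1_iff_lemma zmult_eq_1_iff by blast
    then show ?thesis
    proof cases
      case 1
      then show ?thesis using T[OF _ one, of b] True by simp
    next
      case 2
      \<comment> \<open>The square of S is minus the identity.\<close>
      have "Q (- 1) 0 0 (- 1)"
        using S[OF _ S[OF _ one]] by simp
      from T[OF _ this, of "- b"] show ?thesis
        using 2 True by simp
    qed
  next
    case False
    define n a' b' where "n = a div c" and "a' = a - n * c" and "b' = b - n * d"
    have "a' = a mod c"
      by (simp add: a'_def n_def minus_div_mult_eq_mod)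
    then have lt: "\<bar>- a'\<bar> < \<bar>c\<bar>"
      using False abs_mod_less by simp
    have det: "c * (- b') - d * (- a') = 1"
      using less.prems by (simp add: a'_def b'_def algebra_simps)
    have "Q c d (- a') (- b')"
      using lt det by (intro less.hyps) auto
    from S[OF det this] have "Q a' b' c d" by simp
    moreover have "a' * d - b' * c = 1" using det by (simp add: algebra_simps)
    ultimately have "Q (a' + n * c) (b' + n * d) c d" by (intro T)
    then show ?thesis by (simp add: a'_def b'_def)
  qed
qed

lemma mob_T: "a * d - b * c = 1 \<Longrightarrow> z \<in> uhp \<Longrightarrow> mob (a + n * c) (b + n * d) c d z = mob a b c d z + of_int n"
  using mob_denom_neq_0[of a d b c z] by (simp add: mob_def field_simps)

lemma mob_S: "mob (- c) (- d) a b z = - 1 / mob a b c d z"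
  by (simp add: mob_def minus_divide_left)

lemma mob_num: "a * d - b * c = 1 \<Longrightarrow> z \<in> uhp \<Longrightarrow>
    mob a b c d z * (jac c d z) = of_int a * z + of_int b"
  using mob_denom_neq_0[of a d b c z] by (simp add: mob_def)

lemma qexp_add_int: "qexp (z + of_int n) = qexp z"
proof -
  have "qexp (z + of_int n) = qexp z * exp (of_int (2 * n) * of_real pi * \<i>)"
    by (simp add: algebra_simps flip: exp_add)
  moreover have "exp (of_int (2 * n) * of_real pi * \<i>) = (1 :: complex)"
    using exp_integer_2pi[of "of_int n"] by (simp add: mult_ac)
  ultimately show ?thesis by simp
qed

lemma has_q_expansion_periodic:
  assumes "has_q_expansion f a" "z \<in> uhp"
  shows "f (z + of_int n) = f z"
proof -
  have "z + of_int n \<in> uhp" using assms(2) by (simp add: uhp_iff)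
  from has_q_expansion_sums[OF assms(1) this]
  have "(\<lambda>k. a k * qexp z ^ k) sums f (z + of_int n)"
    by (simp only: qexp_add_int)
  with has_q_expansion_sums[OF assms] show ?thesis
    by (rule sums_unique2[symmetric])
qed

lemma weight_k_mob:
  assumes T: "\<And>z n. z \<in> uhp \<Longrightarrow> f (z + of_int n) = f z"
    and S: "\<And>z. z \<in> uhp \<Longrightarrow> f (- 1 / z) = z ^ k * f z"
    and "a * d - b * c = 1" "z \<in> uhp"
  shows "f (mob a b c d z) = (jac c d z) ^ k * f z"
  using assms(3)
proof (induction rule: SL2Z_induct)
  case one
  then show ?case by (simp add: mob_def)
next
  case (T a b c d n)
  then show ?case using assms(1)[OF mob_in_uhp[OF T.hyps assms(4)]] assms(4) by (simp add: mob_T)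
next
  case (S a b c d)
  have "f (mob (- c) (- d) a b z) = mob a b c d z ^ k * f (mob a b c d z)"
    unfolding mob_S by (rule assms(2)[OF mob_in_uhp[OF S.hyps assms(4)]])
  also have "\<dots> = (mob a b c d z * (jac c d z)) ^ k * f z"
    unfolding S.IH by (simp add: power_mult_distrib)
  finally show ?case
    unfolding mob_num[OF S.hyps assms(4)] .
qed

section \<open>Quasimodularity of P\<close>

definition eisP_coeff :: "nat \<Rightarrow> complex" where
  "eisP_coeff n = (if n = 0 then 1 else 0) - 24 * of_nat (divisor_sigma 1 n)"

lemma eisP_q_expansion: "has_q_expansion eisP eisP_coeff"
  unfolding eisP_def eisP_coeff_def
  by (intro has_q_expansion_diff has_q_expansion_const has_q_expansion_cmult)
    (simp add: has_q_expansion_def sigma_series_1 del: One_nat_def)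

lemma eisP_mob:
  assumes "a * d - b * c = 1" "z \<in> uhp"
  shows "eisP (mob a b c d z) = (jac c d z)\<^sup>2 * eisP z
    - 6 * \<i> / of_real pi * of_int c * (jac c d z)"
  using assms(1)
proof (induction rule: SL2Z_induct)
  case one
  then show ?case by (simp add: mob_def)
next
  case (T a b c d n)
  then show ?case
    using has_q_expansion_periodic[OF eisP_q_expansion mob_in_uhp[OF T.hyps assms(2)]] assms(2) by (simp add: mob_T)
next
  case (S a b c d)
  define w j \<kappa> where "w = mob a b c d z" and "j = jac c d z" and "\<kappa> = 6 * \<i> / complex_of_real pi"
  have num: "w * j = of_int a * z + of_int b"
    unfolding w_def j_def by (rule mob_num[OF S.hyps assms(2)])
  have det: "of_int a * of_int d - of_int b * of_int c = (1 :: complex)"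
    using S.hyps by (metis of_int_1 of_int_diff of_int_mult)
  \<comment> \<open>This form of the determinant relation merges the correction from S with the one
    from the induction hypothesis.\<close>
  have 1: "of_int c * (of_int a * z + of_int b) + 1 = of_int a * j"
    using det unfolding j_def by algebra
  have "eisP (mob (- c) (- d) a b z) = w\<^sup>2 * eisP w - \<kappa> * w"
    unfolding mob_S w_def \<kappa>_def using eisP_minus_inverse[OF mob_in_uhp[OF S.hyps assms(2)]] by simp
  also have "eisP w = j\<^sup>2 * eisP z - \<kappa> * of_int c * j"
    unfolding w_def j_def \<kappa>_def by (rule S.IH)
  also have "w\<^sup>2 * (j\<^sup>2 * eisP z - \<kappa> * of_int c * j) - \<kappa> * w = (w * j)\<^sup>2 * eisP z - \<kappa> * w * (of_int c * (w * j) + 1)"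
    by (simp add: algebra_simps power2_eq_square)
  also have "\<dots> = (w * j)\<^sup>2 * eisP z - \<kappa> * of_int a * (w * j)"
    unfolding num 1 unfolding num[symmetric] by (simp add: mult_ac)
  finally show ?case
    unfolding num \<kappa>_def .
qed

text \<open>This is Delta, q times the product of (1 - q^n)^24: expanding the logarithm of the
  product gives the coefficients sigma_1(n)/n, because the reciprocals of the divisors of n sum to
  sigma_1(n)/n. As an exponential it visibly has no zeros.\<close>

definition mdelta :: "complex \<Rightarrow> complex" where
  "mdelta z = exp (two_pi_i * z - 24 * (\<Sum>n. of_nat (divisor_sigma 1 n) / of_nat n * qexp z ^ n))"

lemma log_mdelta_q_expansion:
  "has_q_expansion (\<lambda>z. \<Sum>n. of_nat (divisor_sigma 1 n) / of_nat n * qexp z ^ n) (\<lambda>n. of_nat (divisor_sigma 1 n) / of_nat n)"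
  unfolding has_q_expansion_def
proof (intro ballI summable_sums)
  fix z assume z: "z \<in> uhp"
  have "has_q_expansion (sigma_series 1) (\<lambda>n. of_nat (divisor_sigma 1 n))"
    unfolding has_q_expansion_def using sigma_series_1 by blast
  from has_q_expansion_summable[OF this norm_qexp_less_1[OF z]]
  have "summable (\<lambda>n. norm (of_nat (divisor_sigma 1 n) * qexp z ^ n))" .
  then show "summable (\<lambda>n. of_nat (divisor_sigma 1 n) / of_nat n * qexp z ^ n)"
  proof (rule summable_comparison_test'[where N = 1])
    fix n :: nat assume n: "n \<ge> 1"
    have "real (divisor_sigma 1 n) / real n \<le> real (divisor_sigma 1 n) / 1"
      using n by (intro divide_left_mono) auto
    then show "norm (of_nat (divisor_sigma 1 n) / of_nat n * qexp z ^ n) \<le> norm (of_nat (divisor_sigma 1 n) * qexp z ^ n)"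
      unfolding norm_mult norm_divide norm_of_nat by (intro mult_right_mono) auto
  qed
qed

lemma mdelta_neq_0 [simp]: "mdelta z \<noteq> 0"
  by (simp add: mdelta_def)

lemma mdelta_DERIV:
  assumes "z \<in> uhp"
  shows "(mdelta has_field_derivative two_pi_i * eisP z * mdelta z) (at z)"
proof -
  let ?L = "\<lambda>z. \<Sum>n. of_nat (divisor_sigma 1 n) / of_nat n * qexp z ^ n"
  obtain g where g: "has_q_expansion g (\<lambda>n. of_nat n * (of_nat (divisor_sigma 1 n) / of_nat n))"
    "\<And>z. z \<in> uhp \<Longrightarrow> (?L has_field_derivative two_pi_i * g z) (at z)"
    using has_q_expansion_DERIV[OF log_mdelta_q_expansion] by blast
  have "(\<lambda>n. of_nat n * (of_nat (divisor_sigma 1 n) / of_nat n) * qexp z ^ n) sums g z"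
    by (rule has_q_expansion_sums[OF g(1) assms])
  also have "(\<lambda>n. of_nat n * (of_nat (divisor_sigma 1 n) / of_nat n) * qexp z ^ n) = (\<lambda>n. of_nat (divisor_sigma 1 n) * qexp z ^ n)"
  proof
    fix n show "of_nat n * (of_nat (divisor_sigma 1 n) / of_nat n) * qexp z ^ n = of_nat (divisor_sigma 1 n) * qexp z ^ n"
      by (cases "n = 0") auto
  qed
  finally have "g z = sigma_series 1 z"
    using sigma_series_1(1)[OF assms] by (rule sums_unique2)
  then have eq: "two_pi_i * 1 - 24 * (two_pi_i * g z) = two_pi_i * eisP z"
    by (simp add: eisP_def algebra_simps)
  have "((\<lambda>z. two_pi_i * z - 24 * ?L z) has_field_derivative two_pi_i * eisP z) (at z)"
    unfolding eq[symmetric] by (intro DERIV_diff DERIV_cmult DERIV_ident g(2)[OF assms])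
  from DERIV_chain2[OF DERIV_exp this] show ?thesis
    unfolding mdelta_def[abs_def] by (simp add: mult_ac)
qed

lemma mdelta_holomorphic: "mdelta holomorphic_on uhp"
  using mdelta_DERIV by (auto simp: holomorphic_on_open[OF open_uhp])

lemma mdelta_periodic: "mdelta (z + of_int n) = mdelta z"
proof -
  have "exp (two_pi_i * (z + of_int n)) = exp (two_pi_i * z)"
    by (rule qexp_add_int)
  then show ?thesis
    unfolding mdelta_def exp_diff by (simp only: qexp_add_int)
qed

lemma mdelta_over_q_tendsto: "((\<lambda>z. mdelta z / qexp z) \<longlongrightarrow> 1) im_top"
proof -
  let ?L = "\<lambda>z. \<Sum>n. of_nat (divisor_sigma 1 n) / of_nat n * qexp z ^ n"
  have "(?L \<longlongrightarrow> 0) im_top"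
    using has_q_expansion_tendsto[OF log_mdelta_q_expansion] by simp
  then have "((\<lambda>z. exp (- 24 * ?L z)) \<longlongrightarrow> exp (- 24 * 0)) im_top"
    by (intro tendsto_intros)
  moreover have "exp (- 24 * ?L z) = mdelta z / qexp z" for z
    by (simp add: mdelta_def exp_diff exp_minus inverse_eq_divide)
  ultimately show ?thesis
    by simp
qed

text \<open>The linear correction of P under inversion contributes 12/z to the logarithmic
  derivative, which is that of z^12. So the quotient \<open>h\<close> is constant, and the fixed
  point i of the inversion shows that the constant is 1.\<close>

lemma mdelta_minus_inverse:
  assumes z: "z \<in> uhp"
  shows "mdelta (- 1 / z) = z ^ 12 * mdelta z"
proof -
  define h where "h = (\<lambda>z. mdelta (- 1 / z) / (z ^ 12 * mdelta z))"
  have "(h has_field_derivative 0) (at w within uhp)" if w: "w \<in> uhp" for w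
  proof -
    have w0: "w \<noteq> 0" using w by (rule uhp_neq_0)
    let ?c = "2 * complex_of_real pi * \<i>"
    define P D E where "P = eisP w" and "D = mdelta w" and "E = mdelta (- 1 / w)"
    have e: "eisP (- 1 / w) = w\<^sup>2 * P - 6 * \<i> * w / of_real pi"
      unfolding P_def by (rule eisP_minus_inverse[OF w])
    have i: "((\<lambda>z. - 1 / z) has_field_derivative 1 / w\<^sup>2) (at w)"
      using w0 by (auto intro!: derivative_eq_intros simp: power2_eq_square)
    have 1: "((\<lambda>z. mdelta (- 1 / z)) has_field_derivative ?c * eisP (- 1 / w) * E * (1 / w\<^sup>2)) (at w)"
      unfolding E_def by (rule DERIV_chain2[OF mdelta_DERIV[OF uhp_minus_inverse[OF w]] i])
    have 2: "((\<lambda>z. z ^ 12 * mdelta z) has_field_derivative 12 * w ^ 11 * D + ?c * P * D * w ^ 12) (at w)"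
      unfolding P_def D_def by (auto intro!: derivative_eq_intros mdelta_DERIV[OF w])
    have nz: "w ^ 12 * mdelta w \<noteq> 0" using w0 by simp
    have "?c * eisP (- 1 / w) * E * (1 / w\<^sup>2) * (w ^ 12 * D) = E * (12 * w ^ 11 * D + ?c * P * D * w ^ 12)"
      unfolding e using w0 by (simp add: field_simps eval_nat_numeral)
    then have "(h has_field_derivative 0) (at w)"
      unfolding h_def using DERIV_divide[OF 1 2 nz] by (simp add: D_def E_def)
    then show ?thesis by (rule has_field_derivative_at_within)
  qed
  then have "\<exists>c. \<forall>w\<in>uhp. h w = c"
    by (intro has_field_derivative_zero_constant[OF convex_uhp])
  then obtain c where c: "\<And>w. w \<in> uhp \<Longrightarrow> h w = c" by blast
  have "\<i> ^ 12 = (1 :: complex)" by (simp add: eval_nat_numeral)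
  moreover have "- 1 / \<i> = \<i>" by (simp add: field_simps)
  ultimately have "h \<i> = 1" by (simp add: h_def)
  with c[of \<i>] have "c = 1" by (simp add: uhp_iff)
  with c[OF z] show ?thesis
    using uhp_neq_0[OF z] by (simp add: h_def)
qed

lemma mdelta_mob:
  assumes "a * d - b * c = 1" "z \<in> uhp"
  shows "mdelta (mob a b c d z) = (jac c d z) ^ 12 * mdelta z"
  by (rule weight_k_mob[OF mdelta_periodic mdelta_minus_inverse assms])

section \<open>The weight 4 series and Ramanujan's identity\<close>

definition eisE :: "complex \<Rightarrow> complex" where
  "eisE z = 1 + 240 * sigma_series 3 z"

definition eisE_coeff :: "nat \<Rightarrow> complex" where
  "eisE_coeff n = (if n = 0 then 1 else 0) + 240 * of_nat (divisor_sigma 3 n)"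

lemma sigma_series_3_q_expansion: "has_q_expansion (sigma_series 3) (\<lambda>n. of_nat (divisor_sigma 3 n))"
  by (simp add: has_q_expansion_def sigma_series_3)

lemma eisE_q_expansion: "has_q_expansion eisE eisE_coeff"
  unfolding eisE_def eisE_coeff_def
  by (intro has_q_expansion_add has_q_expansion_const has_q_expansion_cmult sigma_series_3_q_expansion)

lemma divisor_sigma_Suc_0 [simp]: "divisor_sigma k (Suc 0) = 1"
  by (simp add: divisor_sigma_def)

text \<open>Both sides of Ramanujan's identity \<open>P\<^sup>2 - 12 q dP/dq = E\<^sub>4\<close> are invariant of weight 4, and a
  form of weight 4 and level 1 without constant term vanishes: divide its cube by \<open>\<Delta>\<close>.\<close>

lemma eisE_minus_inverse_and_ramanujan:
  assumes g: "has_q_expansion g (\<lambda>n. of_nat n * eisP_coeff n)"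
    "\<And>z. z \<in> uhp \<Longrightarrow> (eisP has_field_derivative two_pi_i * g z) (at z)"
    and z: "z \<in> uhp"
  shows "eisE (- 1 / z) = z ^ 4 * eisE z" "(eisP z)\<^sup>2 - 12 * g z = eisE z"
proof -
  let ?p = "complex_of_real pi"
  define H where "H = (\<lambda>z. eisP z * eisP z - 12 * g z)"
  have H_q: "has_q_expansion H (\<lambda>n. (\<Sum>i\<le>n. eisP_coeff i * eisP_coeff (n - i)) - 12 * (of_nat n * eisP_coeff n))"
    unfolding H_def by (intro has_q_expansion_diff has_q_expansion_mult has_q_expansion_cmult g eisP_q_expansion)
  have H_S: "H (- 1 / w) = w ^ 4 * H w" if w: "w \<in> uhp" for w
  proof -
    have w0: "w \<noteq> 0" using w by (rule uhp_neq_0)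
    have i: "((\<lambda>z. - 1 / z) has_field_derivative 1 / w\<^sup>2) (at w)"
      using w0 by (auto intro!: derivative_eq_intros simp: power2_eq_square)
    have 1: "((\<lambda>z. eisP (- 1 / z)) has_field_derivative 2 * ?p * \<i> * g (- 1 / w) * (1 / w\<^sup>2)) (at w)"
      by (rule DERIV_chain2[OF g(2)[OF uhp_minus_inverse[OF w]] i])
    have 2: "((\<lambda>z. z\<^sup>2 * eisP z - 6 * \<i> * z / ?p) has_field_derivative
        2 * w * eisP w + 2 * ?p * \<i> * g w * w\<^sup>2 - 6 * \<i> / ?p) (at w)"
      by (auto intro!: derivative_eq_intros g(2)[OF w])
    \<comment> \<open>Differentiating the inversion formula of P; the corrections in q dP/dq and in
      P^2 then cancel in \<open>H\<close>.\<close>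
    have "2 * ?p * \<i> * g (- 1 / w) * (1 / w\<^sup>2) = 2 * w * eisP w + 2 * ?p * \<i> * g w * w\<^sup>2 - 6 * \<i> / ?p"
      by (rule DERIV_unique_on_open[OF open_uhp w eisP_minus_inverse 1 2])
    then have E: "2 * ?p * \<i> * g (- 1 / w) = w\<^sup>2 * (2 * w * eisP w + 2 * ?p * \<i> * g w * w\<^sup>2 - 6 * \<i> / ?p)"
      using w0 by (simp add: divide_eq_eq mult.commute)
    define r where "r = inverse ?p"
    have r: "?p * r = 1" "6 * \<i> / ?p = 6 * \<i> * r" "6 * \<i> * w / ?p = 6 * \<i> * w * r"
      by (simp_all add: r_def divide_inverse)
    have "(2 * ?p * \<i>) * g (- 1 / w) = (2 * ?p * \<i>) * (w ^ 4 * g w - \<i> * w ^ 3 * eisP w * r - 3 * w\<^sup>2 * r\<^sup>2)"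
      using E r(1) i_squared unfolding r(2) by algebra
    then have gS: "g (- 1 / w) = w ^ 4 * g w - \<i> * w ^ 3 * eisP w * r - 3 * w\<^sup>2 * r\<^sup>2"
      by simp
    show ?thesis
      unfolding H_def eisP_minus_inverse[OF w] gS r(3) using i_squared by algebra
  qed
  obtain c where c: "\<And>z. z \<in> uhp \<Longrightarrow> c + sigma_series 3 (- 1 / z) = z^4 * (c + sigma_series 3 z)"
    using sigma_series_3_minus_inverse by blast
  \<comment> \<open>\<open>H\<close> has constant term 1, so this combination has none, whatever c
    is.\<close>
  define f where "f = (\<lambda>z. c * H z - (c + sigma_series 3 z))"
  define a where "a = (\<lambda>n. c * ((\<Sum>i\<le>n. eisP_coeff i * eisP_coeff (n - i)) - 12 * (of_nat n * eisP_coeff n)) -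
      ((if n = 0 then c else 0) + of_nat (divisor_sigma 3 n)))"
  have f_q: "has_q_expansion f a"
    unfolding f_def a_def by (intro has_q_expansion_diff has_q_expansion_add has_q_expansion_cmult
        has_q_expansion_const H_q sigma_series_3_q_expansion)
  have a0: "a 0 = 0" by (simp add: a_def eisP_coeff_def)
  have f_S: "f (- 1 / w) = w ^ 4 * f w" if "w \<in> uhp" for w
    unfolding f_def H_S[OF that] c[OF that] by (simp add: algebra_simps)
  have f0: "f w = 0" if w: "w \<in> uhp" for w
  proof -
    have "(\<lambda>z. f z ^ 3 / mdelta z) w = 0"
    proof (rule level_1_weight_0_eq_0[OF _ _ _ _ w])
      show "(\<lambda>z. f z ^ 3 / mdelta z) holomorphic_on uhp"
        using has_q_expansion_holomorphic[OF f_q] mdelta_holomorphic by (intro holomorphic_intros) auto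
      show "f (z + 1) ^ 3 / mdelta (z + 1) = f z ^ 3 / mdelta z" if "z \<in> uhp" for z
        using has_q_expansion_periodic[OF f_q that, of 1] mdelta_periodic[of z 1] by simp
      show "f (- 1 / z) ^ 3 / mdelta (- 1 / z) = f z ^ 3 / mdelta z" if "z \<in> uhp" for z
        unfolding f_S[OF that] mdelta_minus_inverse[OF that]
        using uhp_neq_0[OF that] by (simp add: power_mult_distrib flip: power_mult)
      have "((\<lambda>z. f z / qexp z ^ 1) \<longlongrightarrow> a 1) im_top"
        using a0 by (intro has_q_expansion_order[OF f_q]) simp
      then have "((\<lambda>z. (f z / qexp z ^ 1) ^ 3 * qexp z ^ 2 * inverse (mdelta z / qexp z)) \<longlongrightarrow> (a 1) ^ 3 * 0 ^ 2 * inverse 1) im_top"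
        by (intro tendsto_intros qexp_tendsto_0 mdelta_over_q_tendsto) auto
      then show "((\<lambda>z. f z ^ 3 / mdelta z) \<longlongrightarrow> 0) im_top"
        by (simp add: power_divide field_simps eval_nat_numeral)
    qed
    then show ?thesis by simp
  qed
  have "a = (\<lambda>n. if n = 0 then 0 else 0)"
    by (rule has_q_expansion_unique[OF f_q has_q_expansion_const[of 0] f0])
  \<comment> \<open>The coefficient of q is c (-48 + 288) - 1, which fixes c.\<close>
  then have "a 1 = 0" by simp
  then have c_eq: "c = 1 / 240"
    by (simp add: a_def eisP_coeff_def field_simps)
  show "eisE (- 1 / z) = z ^ 4 * eisE z"
    using arg_cong[OF c[OF z], of "\<lambda>x. 240 * x"] unfolding c_eq eisE_def by (simp add: algebra_simps)
  show "(eisP z)\<^sup>2 - 12 * g z = eisE z"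
    using arg_cong[OF f0[OF z], of "\<lambda>x. 240 * x"] unfolding f_def c_eq eisE_def H_def
    by (simp add: power2_eq_square right_diff_distrib distrib_left)
qed

lemma eisE_mob:
  assumes "a * d - b * c = 1" "z \<in> uhp"
  shows "eisE (mob a b c d z) = (jac c d z) ^ 4 * eisE z"
proof -
  obtain g where "has_q_expansion g (\<lambda>n. of_nat n * eisP_coeff n)"
    "\<And>z. z \<in> uhp \<Longrightarrow> (eisP has_field_derivative two_pi_i * g z) (at z)"
    using has_q_expansion_DERIV[OF eisP_q_expansion] by blast
  note S = eisE_minus_inverse_and_ramanujan(1)[OF this]
  show ?thesis
    by (rule weight_k_mob[OF has_q_expansion_periodic[OF eisE_q_expansion] S assms])
qed

lemma eisP_square_coeff:
  "(\<Sum>i\<le>n. eisP_coeff i * eisP_coeff (n - i)) = eisE_coeff n + 12 * of_nat n * eisP_coeff n"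
proof -
  obtain g where g: "has_q_expansion g (\<lambda>n. of_nat n * eisP_coeff n)"
    "\<And>z. z \<in> uhp \<Longrightarrow> (eisP has_field_derivative two_pi_i * g z) (at z)"
    using has_q_expansion_DERIV[OF eisP_q_expansion] by blast
  have "has_q_expansion (\<lambda>z. eisE z + 12 * g z) (\<lambda>n. eisE_coeff n + 12 * (of_nat n * eisP_coeff n))"
    by (intro has_q_expansion_add has_q_expansion_cmult g eisE_q_expansion)
  from has_q_expansion_unique[OF has_q_expansion_mult[OF eisP_q_expansion eisP_q_expansion] this]
  show ?thesis
    using eisE_minus_inverse_and_ramanujan(2)[OF g] by (simp add: fun_eq_iff power2_eq_square diff_eq_eq mult.assoc)
qed

section \<open>Modular forms on \<open>\<Gamma>\<^sub>0(N)\<close>\<close>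

text \<open>Holomorphy at the cusps is encoded as existence of a limit of every transform. This
  passes to sums and products without expansions in fractional powers of q.\<close>

definition mform :: "nat \<Rightarrow> nat \<Rightarrow> (complex \<Rightarrow> complex) \<Rightarrow> bool" where
  "mform k N f \<longleftrightarrow> f holomorphic_on uhp \<and>
    (\<forall>a b c d z. a * d - b * c = 1 \<longrightarrow> int N dvd c \<longrightarrow> z \<in> uhp \<longrightarrow>
      f (mob a b c d z) = (jac c d z) ^ k * f z) \<and>
    (\<forall>a b c d. a * d - b * c = 1 \<longrightarrow>
      (\<exists>L. ((\<lambda>z. f (mob a b c d z) / (jac c d z) ^ k) \<longlongrightarrow> L) im_top))"

lemma mform_holomorphic: "mform k N f \<Longrightarrow> f holomorphic_on uhp"
  by (simp add: mform_def)

lemma mform_mob: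
  "mform k N f \<Longrightarrow> a * d - b * c = 1 \<Longrightarrow> int N dvd c \<Longrightarrow> z \<in> uhp \<Longrightarrow>
    f (mob a b c d z) = (jac c d z) ^ k * f z"
  by (simp add: mform_def)

lemma mform_limit:
  assumes "mform k N f" "a * d - b * c = 1"
  obtains L where "((\<lambda>z. f (mob a b c d z) / (jac c d z) ^ k) \<longlongrightarrow> L) im_top"
  using assms unfolding mform_def by blast

lemma mform_add:
  assumes "mform k N f" "mform k N g"
  shows "mform k N (\<lambda>z. f z + g z)"
  unfolding mform_def
proof (intro conjI allI impI)
  show "(\<lambda>z. f z + g z) holomorphic_on uhp"
    using assms by (intro holomorphic_intros mform_holomorphic)
  fix a b c d :: int assume det: "a * d - b * c = 1"
  obtain L where L: "((\<lambda>z. f (mob a b c d z) / (jac c d z) ^ k) \<longlongrightarrow> L) im_top"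
    using mform_limit[OF assms(1) det] by blast
  obtain M where M: "((\<lambda>z. g (mob a b c d z) / (jac c d z) ^ k) \<longlongrightarrow> M) im_top"
    using mform_limit[OF assms(2) det] by blast
  from tendsto_add[OF L M]
  show "\<exists>L. ((\<lambda>z. (f (mob a b c d z) + g (mob a b c d z)) / (jac c d z) ^ k) \<longlongrightarrow> L) im_top"
    by (auto simp: add_divide_distrib)
qed (use assms in \<open>simp add: mform_mob algebra_simps\<close>)

lemma mform_mult:
  assumes "mform k N f" "mform l N g"
  shows "mform (k + l) N (\<lambda>z. f z * g z)"
  unfolding mform_def
proof (intro conjI allI impI)
  show "(\<lambda>z. f z * g z) holomorphic_on uhp"
    using assms by (intro holomorphic_intros mform_holomorphic)
  fix a b c d :: int assume det: "a * d - b * c = 1"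
  obtain L where L: "((\<lambda>z. f (mob a b c d z) / (jac c d z) ^ k) \<longlongrightarrow> L) im_top"
    using mform_limit[OF assms(1) det] by blast
  obtain M where M: "((\<lambda>z. g (mob a b c d z) / (jac c d z) ^ l) \<longlongrightarrow> M) im_top"
    using mform_limit[OF assms(2) det] by blast
  from tendsto_mult[OF L M]
  show "\<exists>L. ((\<lambda>z. (f (mob a b c d z) * g (mob a b c d z)) / (jac c d z) ^ (k + l)) \<longlongrightarrow> L) im_top"
    by (auto simp: power_add)
qed (use assms in \<open>simp add: mform_mob power_add algebra_simps\<close>)

lemma mform_cmult:
  assumes "mform k N f"
  shows "mform k N (\<lambda>z. x * f z)"
proof -
  have "mform 0 N (\<lambda>_. x)"
    by (auto simp: mform_def)
  from mform_mult[OF this assms] show ?thesis by simp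
qed

lemma mform_diff: "mform k N f \<Longrightarrow> mform k N g \<Longrightarrow> mform k N (\<lambda>z. f z - g z)"
  using mform_add[OF _ mform_cmult[of k N g "- 1"]] by simp

lemma mform_cong:
  assumes "\<And>z. z \<in> uhp \<Longrightarrow> f z = g z" "mform k N f"
  shows "mform k N g"
  unfolding mform_def
proof (intro conjI allI impI)
  show "g holomorphic_on uhp"
    using mform_holomorphic[OF assms(2)] assms(1) by (rule holomorphic_transform)
  fix a b c d :: int assume det: "a * d - b * c = 1"
  show "g (mob a b c d z) = (jac c d z) ^ k * g z" if "int N dvd c" "z \<in> uhp" for z
    using mform_mob[OF assms(2) det that] assms(1)[OF mob_in_uhp[OF det that(2)]] assms(1)[OF that(2)] by simp
  obtain L where L: "((\<lambda>z. f (mob a b c d z) / (jac c d z) ^ k) \<longlongrightarrow> L) im_top"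
    using mform_limit[OF assms(2) det] by blast
  moreover have "eventually (\<lambda>z. f (mob a b c d z) / (jac c d z) ^ k = g (mob a b c d z) / (jac c d z) ^ k) im_top"
    using eventually_uhp_im_top by eventually_elim (simp add: assms(1) mob_in_uhp[OF det])
  ultimately show "\<exists>L. ((\<lambda>z. g (mob a b c d z) / (jac c d z) ^ k) \<longlongrightarrow> L) im_top"
    by (intro exI) (rule Lim_transform_eventually)
qed

lemma cusp_form_imp_mform:
  assumes "cusp_form k N f"
  shows "mform k N f"
  unfolding mform_def
proof (intro conjI allI impI)
  show "f holomorphic_on uhp" using assms by (simp add: cusp_form_def)
  fix a b c d :: int assume det: "a * d - b * c = 1"
  define A :: "int^2^2" where "A = vector [vector [a, b], vector [c, d]]"
  have A: "A $ 1 $ 1 = a" "A $ 1 $ 2 = b" "A $ 2 $ 1 = c" "A $ 2 $ 2 = d"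
    by (simp_all add: A_def)
  have SL: "A \<in> SL2Z" using det by (simp add: SL2Z_def det_2 A)
  have sl: "slash k f A z = f (mob a b c d z) / (jac c d z) ^ k" for z
    by (simp add: slash_def A mob_def)
  have "(slash k f A \<longlongrightarrow> 0) im_top" using assms SL by (simp add: cusp_form_def)
  then show "\<exists>L. ((\<lambda>z. f (mob a b c d z) / (jac c d z) ^ k) \<longlongrightarrow> L) im_top"
    by (auto simp: sl[abs_def])
  show "f (mob a b c d z) = (jac c d z) ^ k * f z" if "int N dvd c" "z \<in> uhp" for z
  proof -
    have "A \<in> Gamma0 N" using SL that(1) by (simp add: Gamma0_def A)
    then have "slash k f A z = f z" using assms that(2) by (simp add: cusp_form_def)
    then show ?thesis
      using mob_denom_neq_0[OF det that(2)] by (simp add: sl divide_eq_eq mult.commute)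
  qed
qed

text \<open>The matrix \<open>diag(t, 1) A\<close> is an element of \<open>SL\<^sub>2(\<int>)\<close> times an upper triangular matrix
  with diagonal \<open>(g, h)\<close>, where \<open>g = gcd t c\<close> and \<open>g h = t\<close>.\<close>

lemma dilate_mob:
  fixes a b c e t :: int
  assumes det: "a * e - b * c = 1" and t: "t > 0"
  obtains a' b' c' e' h x where
    "a' * e' - b' * c' = 1" "h > 0" "gcd t c * h = t" "c' * gcd t c = c"
    "\<And>z. z \<in> uhp \<Longrightarrow> (of_int (gcd t c) * z + of_int x) / of_int h \<in> uhp"
    "\<And>z. z \<in> uhp \<Longrightarrow> of_int t * mob a b c e z = mob a' b' c' e' ((of_int (gcd t c) * z + of_int x) / of_int h)"
    "\<And>z. z \<in> uhp \<Longrightarrow> of_int c' * ((of_int (gcd t c) * z + of_int x) / of_int h) + of_int e' = (jac c e z) / of_int h"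
proof -
  define g where "g = gcd t c"
  have g: "g > 0" using t by (simp add: g_def)
  obtain h where h: "t = g * h" unfolding g_def by (meson dvdE gcd_dvd1)
  obtain c' where c': "c = g * c'" unfolding g_def by (meson dvdE gcd_dvd2)
  have h0: "h > 0" using t g h by (simp add: zero_less_mult_iff)
  \<comment> \<open>(h a, c') is the first column (t a, c) of diag(t, 1) A divided by g; it can be
    completed to a unimodular matrix when it is coprime.\<close>
  have "coprime h c'"
    using g h c' unfolding g_def by (metis gcd_coprime_exists div_gcd_coprime gcd_eq_0_iff mult.commute nonzero_mult_div_cancel_left order_less_irrefl)
  moreover have "coprime a c'"
    unfolding coprime_iff_gcd_eq_1
    by (rule coprime_imp_gcd_eq_1, rule coprimeI)
      (metis c' det dvd_diff dvd_mult dvd_mult2)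
  ultimately have "coprime (h * a) c'" by simp
  then obtain u v where uv: "u * (h * a) + v * c' = 1"
    using bezout_int[of "h * a" c'] by (auto simp: coprime_iff_gcd_eq_1)
  \<comment> \<open>\<open>x\<close> is the upper right entry of the inverse of the completed matrix
    times diag(t, 1) A.\<close>
  define e' b' x where "e' = u" and "b' = - v" and "x = e' * t * b - b' * e"
  have det': "(h * a) * e' - b' * c' = 1" using uv by (simp add: e'_def b'_def algebra_simps)
  have x1: "c' * x + e' * h = e"
    using det det' unfolding x_def h c' by algebra
  have x2: "h * a * x + b' * h = t * b"
    using det det' unfolding x_def h c' by algebra
  have Im: "(of_int g * z + of_int x) / of_int h \<in> uhp" if "z \<in> uhp" for z
    using that g h0 by (simp add: uhp_iff)
  have hz: "of_int h \<noteq> (0 :: complex)" using h0 by simp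
  have den: "of_int c' * ((of_int g * z + of_int x) / of_int h) + of_int e' = (jac c e z) / of_int h" for z :: complex
  proof -
    have "of_int c' * of_int x + of_int e' * of_int h = (of_int e :: complex)"
      using x1 by (metis of_int_add of_int_mult)
    then show ?thesis
      unfolding c' using hz by (simp add: field_simps)
  qed
  have num: "of_int (h * a) * ((of_int g * z + of_int x) / of_int h) + of_int b' = of_int t * (of_int a * z + of_int b) / of_int h" for z :: complex
  proof -
    have "of_int h * of_int a * of_int x + of_int b' * of_int h = (of_int t * of_int b :: complex)"
      using x2 by (metis of_int_add of_int_mult)
    then show ?thesis
      unfolding h using hz by (simp add: field_simps)
  qed
  have mob: "of_int t * mob a b c e z = mob (h * a) b' c' e' ((of_int g * z + of_int x) / of_int h)" for z
    unfolding mob_def num den using hz by simp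
  have "g * h = t" "c' * g = c" using h c' by simp_all
  then show ?thesis
    using that[of "h * a" e' b' c' h x, folded g_def, OF det' h0 _ _ Im mob den] by blast
qed

lemma filterlim_affine_im_top:
  assumes "g > 0" "h > 0"
  shows "filterlim (\<lambda>z. (of_int g * z + of_int x) / of_int h) im_top im_top"
proof -
  have "filterlim (\<lambda>y. real_of_int g / real_of_int h * y) at_top at_top"
    using assms by (intro filterlim_tendsto_pos_mult_at_top[OF tendsto_const _ filterlim_ident]) auto
  from filterlim_compose[OF this filterlim_Im_im_top]
  show ?thesis
    by (simp add: filterlim_filtercomap_iff o_def)
qed

text \<open>Serves two purposes. If t divides c then h = 1, and periodicity gives invariance of
  f(tz); for any c the argument on the right tends to infinity with z, which gives the behaviour at
  the cusp.\<close>

lemma level_1_dilate_mob: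
  fixes f :: "complex \<Rightarrow> complex"
  assumes f: "\<And>a b c d z. a * d - b * c = 1 \<Longrightarrow> z \<in> uhp \<Longrightarrow> f (mob a b c d z) = (jac c d z) ^ k * f z"
    and det: "a * e - b * c = 1" and t: "t > 0"
  obtains h x where "h > 0" "gcd (int t) c * h = int t"
    "\<And>z. z \<in> uhp \<Longrightarrow> f (of_nat t * mob a b c e z) / (jac c e z) ^ k =
      f ((of_int (gcd (int t) c) * z + of_int x) / of_int h) / of_int h ^ k"
proof -
  obtain a' b' c' e' h x where *: "a' * e' - b' * c' = 1" "h > 0" "gcd (int t) c * h = int t"
    "\<And>z. z \<in> uhp \<Longrightarrow> (of_int (gcd (int t) c) * z + of_int x) / of_int h \<in> uhp"
    "\<And>z. z \<in> uhp \<Longrightarrow> of_int (int t) * mob a b c e z = mob a' b' c' e' ((of_int (gcd (int t) c) * z + of_int x) / of_int h)"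
    "\<And>z. z \<in> uhp \<Longrightarrow> of_int c' * ((of_int (gcd (int t) c) * z + of_int x) / of_int h) + of_int e' = (jac c e z) / of_int h"
    using dilate_mob[OF det, of "int t"] t by (metis of_nat_0_less_iff)
  show ?thesis
  proof (rule that[OF *(2,3)])
    fix z assume z: "z \<in> uhp"
    have "f (of_nat t * mob a b c e z) = f (mob a' b' c' e' ((of_int (gcd (int t) c) * z + of_int x) / of_int h))"
      using *(5)[OF z] by simp
    also have "\<dots> = ((jac c e z) / of_int h) ^ k * f ((of_int (gcd (int t) c) * z + of_int x) / of_int h)"
      unfolding f[OF *(1) *(4)[OF z]] *(6)[OF z] ..
    finally show "f (of_nat t * mob a b c e z) / (jac c e z) ^ k =
        f ((of_int (gcd (int t) c) * z + of_int x) / of_int h) / of_int h ^ k"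
      using mob_denom_neq_0[OF det z] by (simp add: power_divide)
  qed
qed

lemma eisE_dilate_mform:
  assumes "t > 0" "t dvd N"
  shows "mform 4 N (\<lambda>z. eisE (of_nat t * z))"
  unfolding mform_def
proof (intro conjI allI impI)
  show "(\<lambda>z. eisE (of_nat t * z)) holomorphic_on uhp"
    by (rule has_q_expansion_holomorphic[OF has_q_expansion_dilate[OF eisE_q_expansion assms(1)]])
  fix a b c e :: int assume det: "a * e - b * c = 1"
  obtain h x where h: "h > 0" "gcd (int t) c * h = int t"
    "\<And>z. z \<in> uhp \<Longrightarrow> eisE (of_nat t * mob a b c e z) / (jac c e z) ^ 4 =
      eisE ((of_int (gcd (int t) c) * z + of_int x) / of_int h) / of_int h ^ 4"
    using level_1_dilate_mob[OF eisE_mob det assms(1)] by blast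
  have g: "gcd (int t) c > 0" using assms(1) by simp
  have "((\<lambda>z. eisE ((of_int (gcd (int t) c) * z + of_int x) / of_int h) / of_int h ^ 4) \<longlongrightarrow> eisE_coeff 0 / of_int h ^ 4) im_top"
    using h(1) by (intro tendsto_intros filterlim_compose[OF has_q_expansion_tendsto[OF eisE_q_expansion] filterlim_affine_im_top[OF g h(1)]]) auto
  moreover have "eventually (\<lambda>z. eisE ((of_int (gcd (int t) c) * z + of_int x) / of_int h) / of_int h ^ 4 = eisE (of_nat t * mob a b c e z) / (jac c e z) ^ 4) im_top"
    using eventually_uhp_im_top by eventually_elim (simp add: h(3))
  ultimately show "\<exists>L. ((\<lambda>z. eisE (of_nat t * mob a b c e z) / (jac c e z) ^ 4) \<longlongrightarrow> L) im_top"
    by (intro exI) (rule Lim_transform_eventually)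
  show "eisE (of_nat t * mob a b c e z) = (jac c e z) ^ 4 * eisE (of_nat t * z)" if "int N dvd c" "z \<in> uhp" for z
  proof -
    have "int t dvd c" using assms(2) that(1) by (meson dvd_trans of_nat_dvd_iff)
    then have gt: "gcd (int t) c = int t" by (simp add: gcd_proj1_if_dvd_int)
    then have "h = 1" using h(2) assms(1) by simp
    then show ?thesis
      using h(3)[OF that(2)] gt mob_denom_neq_0[OF det that(2)]
        has_q_expansion_periodic[OF eisE_q_expansion uhp_mult_nat[OF that(2) assms(1)], of x]
      by (simp add: divide_eq_eq mult.commute)
  qed
qed

text \<open>The correction term of t P(tz) is the same for every t, hence cancels in the difference
  \<open>eisPsi\<close>.\<close>

lemma eisP_dilate_mob:
  assumes det: "a * e - b * c = 1" and t: "t > 0"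
  obtains h x where "h > 0" "gcd (int t) c * h = int t"
    "\<And>z. z \<in> uhp \<Longrightarrow> of_nat t * eisP (of_nat t * mob a b c e z) / (jac c e z)\<^sup>2 =
      of_int (gcd (int t) c) / of_int h * eisP ((of_int (gcd (int t) c) * z + of_int x) / of_int h)
      - 6 * \<i> / of_real pi * (of_int c / (jac c e z))"
proof -
  define g where "g = gcd (int t) c"
  obtain a' b' c' e' h x where *: "a' * e' - b' * c' = 1" "h > 0" "g * h = int t" "c' * g = c"
    "\<And>z. z \<in> uhp \<Longrightarrow> (of_int g * z + of_int x) / of_int h \<in> uhp"
    "\<And>z. z \<in> uhp \<Longrightarrow> of_int (int t) * mob a b c e z = mob a' b' c' e' ((of_int g * z + of_int x) / of_int h)"
    "\<And>z. z \<in> uhp \<Longrightarrow> of_int c' * ((of_int g * z + of_int x) / of_int h) + of_int e' = (jac c e z) / of_int h"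
    unfolding g_def using dilate_mob[OF det, of "int t"] t by (metis of_nat_0_less_iff)
  show ?thesis
  proof (rule that[of h x, folded g_def, OF *(2,3)])
    fix z assume z: "z \<in> uhp"
    define w j where "w = (of_int g * z + of_int x) / of_int h" and "j = jac c e z"
    have j: "j \<noteq> 0" unfolding j_def by (rule mob_denom_neq_0[OF det z])
    have hz: "of_int h \<noteq> (0 :: complex)" using *(2) by simp
    have "eisP (of_nat t * mob a b c e z) = eisP (mob a' b' c' e' w)"
      using *(6)[OF z] by (simp add: w_def)
    also have "\<dots> = (j / of_int h)\<^sup>2 * eisP w - 6 * \<i> / of_real pi * of_int c' * (j / of_int h)"
      unfolding w_def j_def eisP_mob[OF *(1) *(5)[OF z]] *(7)[OF z] ..
    finally have 1: "eisP (of_nat t * mob a b c e z) = (j / of_int h)\<^sup>2 * eisP w - 6 * \<i> / of_real pi * of_int c' * (j / of_int h)" .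
    have t': "of_nat t = (of_int g * of_int h :: complex)"
      using *(3) by (metis of_int_mult of_int_of_nat_eq)
    have c': "of_int c = (of_int c' * of_int g :: complex)"
      using *(4) by (metis of_int_mult)
    have "of_nat t * eisP (of_nat t * mob a b c e z) / j\<^sup>2 =
        of_int g / of_int h * eisP w - 6 * \<i> / of_real pi * (of_int c / j)"
      unfolding 1 unfolding t' c' using j hz by (simp add: field_simps power2_eq_square)
    then show "of_nat t * eisP (of_nat t * mob a b c e z) / (jac c e z)\<^sup>2 =
        of_int g / of_int h * eisP ((of_int g * z + of_int x) / of_int h)
        - 6 * \<i> / of_real pi * (of_int c / (jac c e z))"
      unfolding w_def j_def .
  qed
qed

definition eisPsi :: "nat \<Rightarrow> complex \<Rightarrow> complex" where
  "eisPsi t z = eisP z - of_nat t * eisP (of_nat t * z)"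

lemma eisPsi_mform:
  assumes "t > 0" "t dvd N"
  shows "mform 2 N (eisPsi t)"
  unfolding mform_def
proof (intro conjI allI impI)
  show "eisPsi t holomorphic_on uhp"
    unfolding eisPsi_def
    by (intro holomorphic_intros has_q_expansion_holomorphic[OF eisP_q_expansion]
        has_q_expansion_holomorphic[OF has_q_expansion_dilate[OF eisP_q_expansion assms(1)]])
  fix a b c e :: int assume det: "a * e - b * c = 1"
  let ?\<kappa> = "6 * \<i> / complex_of_real pi"
  have P: "eisP (mob a b c e z) / (jac c e z)\<^sup>2 = eisP z - ?\<kappa> * (of_int c / (jac c e z))" if "z \<in> uhp" for z
  proof -
    define j where "j = jac c e z"
    have "j \<noteq> 0" unfolding j_def by (rule mob_denom_neq_0[OF det that])
    then show ?thesis
      unfolding eisP_mob[OF det that] unfolding j_def[symmetric] by (simp add: diff_divide_distrib power2_eq_square)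
  qed
  obtain h x where h: "h > 0" "gcd (int t) c * h = int t"
    "\<And>z. z \<in> uhp \<Longrightarrow> of_nat t * eisP (of_nat t * mob a b c e z) / (jac c e z)\<^sup>2 =
      of_int (gcd (int t) c) / of_int h * eisP ((of_int (gcd (int t) c) * z + of_int x) / of_int h)
      - ?\<kappa> * (of_int c / (jac c e z))"
    using eisP_dilate_mob[OF det assms(1)] by blast
  have Psi: "eisPsi t (mob a b c e z) / (jac c e z)\<^sup>2 =
      eisP z - of_int (gcd (int t) c) / of_int h * eisP ((of_int (gcd (int t) c) * z + of_int x) / of_int h)" if "z \<in> uhp" for z
    unfolding eisPsi_def diff_divide_distrib P[OF that] h(3)[OF that] by simp
  have g: "gcd (int t) c > 0" using assms(1) by simp
  have "((\<lambda>z. eisP z - of_int (gcd (int t) c) / of_int h * eisP ((of_int (gcd (int t) c) * z + of_int x) / of_int h)) \<longlongrightarrow>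
      eisP_coeff 0 - of_int (gcd (int t) c) / of_int h * eisP_coeff 0) im_top"
    by (intro tendsto_intros has_q_expansion_tendsto[OF eisP_q_expansion]
        filterlim_compose[OF has_q_expansion_tendsto[OF eisP_q_expansion] filterlim_affine_im_top[OF g h(1)]])
  moreover have "eventually (\<lambda>z. eisP z - of_int (gcd (int t) c) / of_int h * eisP ((of_int (gcd (int t) c) * z + of_int x) / of_int h) =
      eisPsi t (mob a b c e z) / (jac c e z)\<^sup>2) im_top"
    using eventually_uhp_im_top by eventually_elim (simp add: Psi)
  ultimately show "\<exists>L. ((\<lambda>z. eisPsi t (mob a b c e z) / (jac c e z)\<^sup>2) \<longlongrightarrow> L) im_top"
    by (intro exI) (rule Lim_transform_eventually)
  show "eisPsi t (mob a b c e z) = (jac c e z)\<^sup>2 * eisPsi t z" if "int N dvd c" "z \<in> uhp" for z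
  proof -
    have "int t dvd c" using assms(2) that(1) by (meson dvd_trans of_nat_dvd_iff)
    then have gt: "gcd (int t) c = int t" by (simp add: gcd_proj1_if_dvd_int)
    then have "h = 1" using h(2) assms(1) by simp
    then have "eisPsi t (mob a b c e z) / (jac c e z)\<^sup>2 = eisPsi t z"
      using has_q_expansion_periodic[OF eisP_q_expansion uhp_mult_nat[OF that(2) assms(1)], of x]
      by (subst Psi[OF that(2)]) (simp add: gt eisPsi_def)
    then show ?thesis
      using mob_denom_neq_0[OF det that(2)] by (simp add: divide_eq_eq mult.commute)
  qed
qed

section \<open>Eta quotients with all zeros at infinity\<close>

lemma Bfun_if_norm_tendsto:
  assumes "((\<lambda>z. norm (f z)) \<longlongrightarrow> L) F"
  shows "Bfun f F"
proof (rule BfunI)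
  show "eventually (\<lambda>z. norm (f z) \<le> L + 1) F"
    using order_tendstoD(2)[OF assms, of "L + 1"] by (auto elim: eventually_mono)
qed

text \<open>Isolates what the denominator D has to satisfy. At the cusps other than infinity only
  its absolute value is required to converge, so no roots of unity have to be tracked.\<close>

lemma weight_4_eta_quotient_comparison:
  assumes N: "N > 0" and f: "mform 4 N f" "has_q_expansion f a" "\<And>n. n < r \<Longrightarrow> a n = 0"
    and D: "D holomorphic_on uhp" "\<And>z. z \<in> uhp \<Longrightarrow> D z \<noteq> 0"
      "\<And>a b c d z. a * d - b * c = 1 \<Longrightarrow> int N dvd c \<Longrightarrow> z \<in> uhp \<Longrightarrow>
        D (mob a b c d z) = (jac c d z) ^ 72 * D z"
      "\<And>a b c d. a * d - b * c = 1 \<Longrightarrow> \<not> int N dvd c \<Longrightarrow>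
        \<exists>K>0. ((\<lambda>z. norm (D (mob a b c d z) / (jac c d z) ^ 72)) \<longlongrightarrow> K) im_top"
      "((\<lambda>z. qexp z ^ (18 * r) / D z) \<longlongrightarrow> \<delta>) im_top"
    and w: "w \<in> uhp"
  shows "f w ^ 18 = a r ^ 18 * \<delta> * D w"
proof -
  define R where "R = (\<lambda>z. f z ^ 18 / D z - a r ^ 18 * \<delta>)"
  have inv: "R (mob a b c d z) = R z" if "a * d - b * c = 1" "int N dvd c" "z \<in> uhp" for a b c d z
    unfolding R_def D(3)[OF that] mform_mob[OF f(1) that]
    using mob_denom_neq_0[OF that(1,3)] by (simp add: power_mult_distrib flip: power_mult)
  have "((\<lambda>z. (f z / qexp z ^ r) ^ 18 * (qexp z ^ (18 * r) / D z) - a r ^ 18 * \<delta>) \<longlongrightarrow> a r ^ 18 * \<delta> - a r ^ 18 * \<delta>) im_top"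
    by (intro tendsto_intros has_q_expansion_order[OF f(2)] f(3) D(5))
  then have lim: "(R \<longlongrightarrow> 0) im_top"
    by (simp add: R_def power_divide mult.commute flip: power_mult)
  have bdd: "Bfun (\<lambda>z. R (mob p q c d z)) im_top" if det: "p * d - q * c = 1" for p q c d
  proof (cases "int N dvd c")
    case True
    have "eventually (\<lambda>z. R z = R (mob p q c d z)) im_top"
      using eventually_uhp_im_top by eventually_elim (simp add: inv[OF det True])
    with lim have "((\<lambda>z. R (mob p q c d z)) \<longlongrightarrow> 0) im_top"
      by (rule Lim_transform_eventually)
    then show ?thesis
      by (rule Bfun_if_norm_tendsto[OF tendsto_norm])
  next
    case False
    obtain K where K: "K > 0" "((\<lambda>z. norm (D (mob p q c d z) / (jac c d z) ^ 72)) \<longlongrightarrow> K) im_top"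
      using D(4)[OF det False] by blast
    obtain L where L: "((\<lambda>z. f (mob p q c d z) / (jac c d z) ^ 4) \<longlongrightarrow> L) im_top"
      using mform_limit[OF f(1) det] by blast
    have "((\<lambda>z. norm (f (mob p q c d z) / (jac c d z) ^ 4) ^ 18 /
        norm (D (mob p q c d z) / (jac c d z) ^ 72)) \<longlongrightarrow> norm L ^ 18 / K) im_top"
      using K(1) by (intro tendsto_intros L K(2)) simp
    moreover have "eventually (\<lambda>z. norm (f (mob p q c d z) / (jac c d z) ^ 4) ^ 18 /
        norm (D (mob p q c d z) / (jac c d z) ^ 72) = norm (f (mob p q c d z) ^ 18 / D (mob p q c d z))) im_top"
      using eventually_uhp_im_top
    proof eventually_elim
      case (elim z)
      show ?case
        using mob_denom_neq_0[OF det elim] by (simp add: norm_divide norm_power power_divide flip: power_mult)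
    qed
    ultimately have "((\<lambda>z. norm (f (mob p q c d z) ^ 18 / D (mob p q c d z))) \<longlongrightarrow> norm L ^ 18 / K) im_top"
      by (rule Lim_transform_eventually)
    then have "Bfun (\<lambda>z. f (mob p q c d z) ^ 18 / D (mob p q c d z)) im_top"
      by (rule Bfun_if_norm_tendsto)
    then obtain B where "eventually (\<lambda>z. norm (f (mob p q c d z) ^ 18 / D (mob p q c d z)) \<le> B) im_top"
      by (elim BfunE)
    then have "eventually (\<lambda>z. norm (R (mob p q c d z)) \<le> B + norm (a r ^ 18 * \<delta>)) im_top"
      unfolding R_def by eventually_elim (rule order_trans[OF norm_triangle_ineq4], simp)
    then show ?thesis
      by (rule BfunI)
  qed
  have "R w = 0"
    using D(1,2) mform_holomorphic[OF f(1)]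
    by (intro weight_0_eq_0[OF N _ inv bdd lim w]) (auto simp: R_def intro!: holomorphic_intros)
  then show ?thesis
    using D(2)[OF w] by (simp add: R_def field_simps)
qed

lemma mdelta_dilate_mob:
  assumes "a * e - b * c = 1" "t > 0" "int t dvd c" "z \<in> uhp"
  shows "mdelta (of_nat t * mob a b c e z) = (jac c e z) ^ 12 * mdelta (of_nat t * z)"
proof -
  obtain h x where h: "h > 0" "gcd (int t) c * h = int t"
    "\<And>z. z \<in> uhp \<Longrightarrow> mdelta (of_nat t * mob a b c e z) / (jac c e z) ^ 12 =
      mdelta ((of_int (gcd (int t) c) * z + of_int x) / of_int h) / of_int h ^ 12"
    using level_1_dilate_mob[OF mdelta_mob assms(1,2)] by blast
  have gt: "gcd (int t) c = int t" using assms(3) by simp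
  then have "h = 1" using h(2) assms(2) by simp
  then show ?thesis
    using h(3)[OF assms(4)] gt mob_denom_neq_0[OF assms(1,4)] mdelta_periodic[of "of_nat t * z" x]
    by (simp add: divide_eq_eq mult.commute)
qed

text \<open>Delta(w) behaves like exp(2 pi i w) at w = (g z + x)/h, and g/h = g^2/t because g h = t.
  The exponential factor compensates exactly this decay.\<close>

lemma mdelta_dilate_cusp_limit:
  assumes "a * e - b * c = 1" "t > 0"
  shows "\<exists>K>0. ((\<lambda>z. norm (mdelta (of_nat t * mob a b c e z) / (jac c e z) ^ 12) *
    exp (2 * pi * (of_int ((gcd (int t) c)\<^sup>2) / of_nat t) * Im z)) \<longlongrightarrow> K) im_top"
proof -
  define g where "g = gcd (int t) c"
  obtain h x where h: "h > 0" "g * h = int t"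
    "\<And>z. z \<in> uhp \<Longrightarrow> mdelta (of_nat t * mob a b c e z) / (jac c e z) ^ 12 =
      mdelta ((of_int g * z + of_int x) / of_int h) / of_int h ^ 12"
    unfolding g_def using level_1_dilate_mob[OF mdelta_mob assms] by blast
  have g: "g > 0" using assms(2) by (simp add: g_def)
  define w where "w = (\<lambda>z::complex. (of_int g * z + of_int x) / of_int h)"
  have t: "real t = real_of_int g * real_of_int h" using h(2) by (metis of_int_mult of_int_of_nat_eq)
  have "real_of_int (g\<^sup>2) / real t = real_of_int g / real_of_int h"
    unfolding t using g h(1) by (simp add: power2_eq_square)
  then have Imw: "Im (w z) = of_int (g\<^sup>2) / real t * Im z" for z
    by (simp add: w_def)
  have lim: "filterlim w im_top im_top"
    unfolding w_def by (rule filterlim_affine_im_top[OF g h(1)])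
  have "((\<lambda>z. norm (mdelta (w z) / qexp (w z)) / of_int h ^ 12) \<longlongrightarrow> norm (1::complex) / of_int h ^ 12) im_top"
    by (rule tendsto_divide[OF tendsto_norm[OF filterlim_compose[OF mdelta_over_q_tendsto lim]] tendsto_const]) (use h(1) in simp)
  moreover have "eventually (\<lambda>z. norm (mdelta (w z) / qexp (w z)) / of_int h ^ 12 =
      norm (mdelta (of_nat t * mob a b c e z) / (jac c e z) ^ 12) *
      exp (2 * pi * (of_int (g\<^sup>2) / of_nat t) * Im z)) im_top"
    using eventually_uhp_im_top
  proof eventually_elim
    case (elim z)
    have "norm (qexp (w z)) = inverse (exp (2 * pi * (of_int (g\<^sup>2) / of_nat t) * Im z))"
      unfolding norm_qexp Imw by (simp add: exp_minus[symmetric] mult.assoc)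
    moreover have "(of_int g * z + of_int x) / of_int h = w z"
      by (simp add: w_def)
    ultimately show ?case
      unfolding h(3)[OF elim] using h(1)
      by (simp only: norm_divide) (simp add: norm_power divide_inverse)
  qed
  ultimately have "((\<lambda>z. norm (mdelta (of_nat t * mob a b c e z) / (jac c e z) ^ 12) *
      exp (2 * pi * (of_int (g\<^sup>2) / of_nat t) * Im z)) \<longlongrightarrow> norm (1::complex) / of_int h ^ 12) im_top"
    by (rule Lim_transform_eventually)
  moreover have "norm (1::complex) / of_int h ^ 12 > 0" using h(1) by simp
  ultimately show ?thesis
    unfolding g_def by blast
qed

lemma mdelta_dilate_tendsto:
  assumes "t > 0"
  shows "((\<lambda>z. mdelta (of_nat t * z) / qexp z ^ t) \<longlongrightarrow> 1) im_top"
proof -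
  have "filterlim (\<lambda>z. of_nat t * z) im_top im_top"
    using filterlim_affine_im_top[of "int t" 1 0] assms by simp
  from filterlim_compose[OF mdelta_over_q_tendsto this] show ?thesis
    by (simp only: exp_of_nat_mult[symmetric] mult_ac)
qed

lemma mdelta_dilate_holomorphic: "t > 0 \<Longrightarrow> (\<lambda>z. mdelta (of_nat t * z)) holomorphic_on uhp"
  using holomorphic_on_compose_gen[of "\<lambda>z. of_nat t * z" uhp mdelta uhp] mdelta_holomorphic uhp_mult_nat
  by (auto simp: o_def intro!: holomorphic_intros)

text \<open>Delta is the 24th power of the eta function and has weight 12, so the weight is 12 times
  the sum of the exponents.\<close>

definition eta_quotient :: "nat set \<Rightarrow> (nat \<Rightarrow> int) \<Rightarrow> complex \<Rightarrow> complex" where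
  "eta_quotient T r z = (\<Prod>t\<in>T. mdelta (of_nat t * z) powi r t)"

lemma eta_quotient_neq_0: "finite T \<Longrightarrow> eta_quotient T r z \<noteq> 0"
  by (simp add: eta_quotient_def)

lemma prod_powi:
  fixes x :: "'a :: field"
  assumes "x \<noteq> 0" "finite T"
  shows "(\<Prod>t\<in>T. x powi r t) = x powi (\<Sum>t\<in>T. r t)"
  using assms(2) by (induction T rule: finite_induct) (simp_all add: power_int_add assms(1))

text \<open>Here \<open>g\<^sup>2 / t\<close> with \<open>g = gcd t c\<close> is the order of \<open>\<Delta>(tz)\<close> at the cusp \<open>a / c\<close>; the hypotheses
  say that the eta quotient has weight 72 and all its zeros at \<open>\<infinity>\<close>.\<close>

lemma weight_4_eta_quotient:
  assumes N: "N > 0" and f: "mform 4 N f" "has_q_expansion f a" "\<And>n. n < m \<Longrightarrow> a n = 0"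
    and T: "finite T" "\<And>t. t \<in> T \<Longrightarrow> t > 0 \<and> t dvd N" "(\<Sum>t\<in>T. r t) = 6"
    and cusps: "\<And>c. \<not> int N dvd c \<Longrightarrow> (\<Sum>t\<in>T. of_int (r t) * (of_int ((gcd (int t) c)\<^sup>2) / real t)) = 0"
    and ord: "(\<Sum>t\<in>T. int t * r t) + int k = 18 * int m"
    and w: "w \<in> uhp"
  shows "f w ^ 18 = a m ^ 18 * 0 ^ k * eta_quotient T r w"
proof (rule weight_4_eta_quotient_comparison[OF N f _ _ _ _ _ w])
  let ?D = "eta_quotient T r"
  show "?D holomorphic_on uhp"
    unfolding eta_quotient_def using T(2) by (intro holomorphic_intros mdelta_dilate_holomorphic) auto
  show "?D z \<noteq> 0" for z
    by (rule eta_quotient_neq_0[OF T(1)])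
  show "?D (mob a b c d z) = (jac c d z) ^ 72 * ?D z"
    if "a * d - b * c = 1" "int N dvd c" "z \<in> uhp" for a b c d z
  proof -
    define j where "j = jac c d z"
    have j: "j \<noteq> 0" unfolding j_def by (rule mob_denom_neq_0[OF that(1,3)])
    have "?D (mob a b c d z) = (\<Prod>t\<in>T. (j ^ 12 * mdelta (of_nat t * z)) powi r t)"
      unfolding eta_quotient_def
    proof (rule prod.cong[OF refl])
      fix t assume "t \<in> T"
      with T(2) that(2) have "t > 0" "int t dvd c"
        by (auto intro: dvd_trans[of _ "int N"])
      from mdelta_dilate_mob[OF that(1) this that(3)]
      show "mdelta (of_nat t * mob a b c d z) powi r t = (j ^ 12 * mdelta (of_nat t * z)) powi r t"
        by (simp add: j_def)
    qed
    also have "\<dots> = (j ^ 12) powi (\<Sum>t\<in>T. r t) * ?D z"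
      unfolding eta_quotient_def power_int_mult_distrib prod.distrib using j T(1) by (simp add: prod_powi)
    also have "(j ^ 12) powi (\<Sum>t\<in>T. r t) = j ^ 72"
      unfolding T(3) by (simp flip: power_mult)
    finally show ?thesis unfolding j_def .
  qed
  show "\<exists>K>0. ((\<lambda>z. norm (?D (mob a b c d z) / (jac c d z) ^ 72)) \<longlongrightarrow> K) im_top"
    if det: "a * d - b * c = 1" and c: "\<not> int N dvd c" for a b c d
  proof -
    define Y where "Y = (\<lambda>t z. norm (mdelta (of_nat t * mob a b c d z) / (jac c d z) ^ 12))"
    define \<rho> where "\<rho> = (\<lambda>t. real_of_int ((gcd (int t) c)\<^sup>2) / of_nat t)"
    have "\<forall>t\<in>T. \<exists>K>0. ((\<lambda>z. Y t z * exp (2 * pi * \<rho> t * Im z)) \<longlongrightarrow> K) im_top"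
      unfolding Y_def \<rho>_def using mdelta_dilate_cusp_limit[OF det] T(2) by blast
    then obtain K where K: "\<And>t. t \<in> T \<Longrightarrow> K t > 0"
      "\<And>t. t \<in> T \<Longrightarrow> ((\<lambda>z. Y t z * exp (2 * pi * \<rho> t * Im z)) \<longlongrightarrow> K t) im_top"
      by metis
    have "((\<lambda>z. \<Prod>t\<in>T. (Y t z * exp (2 * pi * \<rho> t * Im z)) powi r t) \<longlongrightarrow> (\<Prod>t\<in>T. K t powi r t)) im_top"
      using K by (intro tendsto_prod tendsto_power_int) force+
    moreover have "eventually (\<lambda>z. (\<Prod>t\<in>T. (Y t z * exp (2 * pi * \<rho> t * Im z)) powi r t) =
        norm (?D (mob a b c d z) / (jac c d z) ^ 72)) im_top"
      using eventually_uhp_im_top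
    proof eventually_elim
      case (elim z)
      define j where "j = jac c d z"
      have j: "j \<noteq> 0" unfolding j_def by (rule mob_denom_neq_0[OF det elim])
      \<comment> \<open>The compensating exponentials multiply to 1, since the total order at this
        cusp is 0.\<close>
      have "(\<Prod>t\<in>T. exp (2 * pi * \<rho> t * Im z) powi r t) = exp (2 * pi * Im z * (\<Sum>t\<in>T. of_int (r t) * \<rho> t))"
        using T(1) by (simp add: exp_power_int exp_sum sum_distrib_left mult_ac)
      also have "\<dots> = 1"
        using cusps[OF c] by (simp add: \<rho>_def)
      finally have "(\<Prod>t\<in>T. (Y t z * exp (2 * pi * \<rho> t * Im z)) powi r t) = (\<Prod>t\<in>T. Y t z powi r t)"
        by (simp add: power_int_mult_distrib prod.distrib)
      also have "\<dots> = norm (\<Prod>t\<in>T. (mdelta (of_nat t * mob a b c d z) / j ^ 12) powi r t)"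
        by (simp add: Y_def j_def norm_power_int flip: prod_norm)
      also have "(\<Prod>t\<in>T. (mdelta (of_nat t * mob a b c d z) / j ^ 12) powi r t) = ?D (mob a b c d z) / (j ^ 12) powi (\<Sum>t\<in>T. r t)"
        unfolding eta_quotient_def power_int_divide_distrib prod_dividef using j T(1) by (simp add: prod_powi)
      also have "(j ^ 12) powi (\<Sum>t\<in>T. r t) = j ^ 72"
        unfolding T(3) by (simp flip: power_mult)
      finally show ?case unfolding j_def .
    qed
    ultimately have "((\<lambda>z. norm (?D (mob a b c d z) / (jac c d z) ^ 72)) \<longlongrightarrow> (\<Prod>t\<in>T. K t powi r t)) im_top"
      by (rule Lim_transform_eventually)
    moreover have "(\<Prod>t\<in>T. K t powi r t) > 0"
      using K(1) by (intro prod_pos) (simp add: zero_less_power_int)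
    ultimately show ?thesis by blast
  qed
  \<comment> \<open>At infinity the quotient has order 18 m - k. The limit \<open>0 ^ k\<close> is 1
    when k = 0 and 0 when f vanishes to an order beyond what the valence allows.\<close>
  have "((\<lambda>z. qexp z ^ k / (\<Prod>t\<in>T. (mdelta (of_nat t * z) / qexp z ^ t) powi r t)) \<longlongrightarrow> 0 ^ k / (\<Prod>t\<in>T. 1 powi r t)) im_top"
    using T(2) by (intro tendsto_divide tendsto_power qexp_tendsto_0 tendsto_prod tendsto_power_int mdelta_dilate_tendsto) auto
  also have "(\<lambda>z. qexp z ^ k / (\<Prod>t\<in>T. (mdelta (of_nat t * z) / qexp z ^ t) powi r t)) = (\<lambda>z. qexp z ^ (18 * m) / ?D z)"
  proof
    fix z
    have "(\<Prod>t\<in>T. (mdelta (of_nat t * z) / qexp z ^ t) powi r t) = ?D z / qexp z powi (\<Sum>t\<in>T. int t * r t)"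
      unfolding eta_quotient_def power_int_divide_distrib prod_dividef power_int_power using T(1) by (simp add: prod_powi)
    moreover have "qexp z ^ (18 * m) = qexp z powi (\<Sum>t\<in>T. int t * r t) * qexp z ^ k"
    proof -
      have "qexp z ^ (18 * m) = qexp z powi ((\<Sum>t\<in>T. int t * r t) + int k)"
        unfolding ord by (metis of_nat_mult of_nat_numeral power_int_of_nat)
      then show ?thesis by (simp add: power_int_add)
    qed
    ultimately show "qexp z ^ k / (\<Prod>t\<in>T. (mdelta (of_nat t * z) / qexp z ^ t) powi r t) = qexp z ^ (18 * m) / ?D z"
      by (simp add: mult.commute)
  qed
  finally show "((\<lambda>z. qexp z ^ (18 * m) / ?D z) \<longlongrightarrow> 0 ^ k) im_top" by simp
qed

section \<open>The eta quotients of levels 7 and 14\<close>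

lemma gcd_prime_not_dvd: "prime (p :: int) \<Longrightarrow> \<not> p dvd c \<Longrightarrow> gcd p c = 1"
  by (simp add: prime_imp_coprime flip: coprime_iff_gcd_eq_1)

lemma prime_2_7_int: "prime (2 :: int)" "prime (7 :: int)"
  by simp_all

text \<open>Delta(7z)^7/Delta(z) has order 49 - 1 = 48 at infinity, less than 18 * 3 = 54; the
  excess is 6.\<close>

lemma weight_4_level_7_order_3:
  assumes "mform 4 7 f" "has_q_expansion f a" "\<And>n. n < 3 \<Longrightarrow> a n = 0" "w \<in> uhp"
  shows "f w = 0"
proof -
  define r :: "nat \<Rightarrow> int" where "r = (\<lambda>t. if t = 1 then - 1 else 7)"
  have "f w ^ 18 = a 3 ^ 18 * 0 ^ 6 * eta_quotient {1, 7} r w"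
    by (rule weight_4_eta_quotient[OF _ assms(1-3) _ _ _ _ _ assms(4)])
      (auto simp: r_def gcd_prime_not_dvd prime_2_7_int)
  then show ?thesis by simp
qed

text \<open>For t dividing 14 these are t * mu(14/t). The order at the cusp a/c is then the product
  of gcd(p, c)^2 - 1 over p = 2 and p = 7: zero unless 14 divides c, and 3 * 48 = 144
  otherwise.\<close>

definition eta_exponent_14 :: "nat \<Rightarrow> int" where
  "eta_exponent_14 t = (if t = 1 then 1 else if t = 2 then - 2 else if t = 7 then - 7 else 14)"

lemma eta_exponent_14_cusps:
  fixes c :: int
  assumes "\<not> int 14 dvd c"
  shows "(\<Sum>t\<in>{1, 2, 7, 14}. of_int (eta_exponent_14 t) * (of_int ((gcd (int t) c)\<^sup>2) / real t)) = 0"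
proof -
  have "\<not> (2 dvd c \<and> 7 dvd c)"
    using assms by simp presburger
  then consider "2 dvd c" "\<not> 7 dvd c" | "\<not> 2 dvd c" "7 dvd c" | "\<not> 2 dvd c" "\<not> 7 dvd c"
    by blast
  then show ?thesis
  proof cases
    case 1
    then obtain k where k: "c = 2 * k" by (elim dvdE)
    then have "gcd 14 c = gcd (2 * 7) (2 * k)" by simp
    also have "\<dots> = 2 * gcd 7 k" by (subst gcd_mult_left) simp
    also have "gcd 7 k = 1" using 1 k by (intro gcd_prime_not_dvd prime_2_7_int) auto
    finally show ?thesis using 1 by (simp add: gcd_prime_not_dvd prime_2_7_int eta_exponent_14_def)
  next
    case 2
    then obtain k where k: "c = 7 * k" by (elim dvdE)
    then have "gcd 14 c = gcd (7 * 2) (7 * k)" by simp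
    also have "\<dots> = 7 * gcd 2 k" by (subst gcd_mult_left) simp
    also have "gcd 2 k = 1" using 2 k by (intro gcd_prime_not_dvd prime_2_7_int) auto
    finally show ?thesis using 2 by (simp add: gcd_prime_not_dvd prime_2_7_int eta_exponent_14_def)
  next
    case 3
    then have "coprime (2 * 7) c"
      unfolding coprime_mult_left_iff by (intro conjI prime_imp_coprime prime_2_7_int)
    then have "gcd 14 c = 1" by simp
    then show ?thesis using 3 by (simp add: gcd_prime_not_dvd prime_2_7_int eta_exponent_14_def)
  qed
qed

definition eta_quotient_14 :: "complex \<Rightarrow> complex" where
  "eta_quotient_14 = eta_quotient {1, 2, 7, 14} eta_exponent_14"

text \<open>Here 144 = 18 * 8 holds exactly, so the comparison leaves the constant
  \<open>a 8 ^ 18\<close>.\<close>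

lemma weight_4_level_14_order_8:
  assumes "mform 4 14 f" "has_q_expansion f a" "\<And>n. n < 8 \<Longrightarrow> a n = 0" "w \<in> uhp"
  shows "f w ^ 18 = a 8 ^ 18 * eta_quotient_14 w"
proof -
  have "f w ^ 18 = a 8 ^ 18 * 0 ^ 0 * eta_quotient {1, 2, 7, 14} eta_exponent_14 w"
    by (rule weight_4_eta_quotient[OF _ assms(1-3) _ _ _ eta_exponent_14_cusps _ assms(4)])
      (auto simp: eta_exponent_14_def)
  then show ?thesis by (simp add: eta_quotient_14_def)
qed

lemma eta_quotient_DERIV:
  assumes "finite T" "\<And>t. t \<in> T \<Longrightarrow> t > 0" "z \<in> uhp"
  shows "(eta_quotient T r has_field_derivative
    two_pi_i * (\<Sum>t\<in>T. of_int (r t) * (of_nat t * eisP (of_nat t * z))) * eta_quotient T r z) (at z)"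
  using assms(1,2)
proof (induction T rule: finite_induct)
  case empty
  then show ?case by (simp add: eta_quotient_def[abs_def])
next
  case (insert t T)
  let ?k = "2 * complex_of_real pi * \<i>" and ?e = "\<lambda>t. of_nat t * eisP (of_nat t * z)"
  have "((\<lambda>z. of_nat t * z) has_field_derivative of_nat t) (at z)"
    by (auto intro!: derivative_eq_intros)
  from DERIV_chain2[OF mdelta_DERIV[OF uhp_mult_nat[OF assms(3)]] this]
  have "((\<lambda>z. mdelta (of_nat t * z)) has_field_derivative ?k * ?e t * mdelta (of_nat t * z)) (at z)"
    using insert.prems by (simp add: mult_ac)
  from DERIV_power_int[OF this disjI2[OF mdelta_neq_0], of "r t"]
  have "((\<lambda>z. mdelta (of_nat t * z) powi r t) has_field_derivative
      ?k * (of_int (r t) * ?e t) * mdelta (of_nat t * z) powi r t) (at z)"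
    by (rule DERIV_cong) (simp add: power_int_diff mult_ac)
  from DERIV_mult[OF this insert.IH] insert show ?case
    by (simp add: eta_quotient_def[abs_def] algebra_simps)
qed

lemma eta_quotient_14_DERIV:
  assumes "z \<in> uhp"
  shows "(eta_quotient_14 has_field_derivative two_pi_i *
    (eisP z - 4 * eisP (of_nat 2 * z) - 49 * eisP (of_nat 7 * z) + 196 * eisP (of_nat 14 * z)) * eta_quotient_14 z) (at z)"
proof -
  have "(\<Sum>t\<in>{1, 2, 7, 14}. of_int (eta_exponent_14 t) * (of_nat t * eisP (of_nat t * z))) =
      eisP z - 4 * eisP (of_nat 2 * z) - 49 * eisP (of_nat 7 * z) + 196 * eisP (of_nat 14 * z)"
    by (simp add: eta_exponent_14_def)
  then show ?thesis
    using eta_quotient_DERIV[of "{1, 2, 7, 14}" z eta_exponent_14] assms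
    unfolding eta_quotient_14_def by (metis (no_types, lifting) empty_iff finite.emptyI finite.insertI insert_iff zero_less_numeral zero_less_one)
qed

section \<open>Forms of weight 4 and level 14\<close>

definition dil :: "nat \<Rightarrow> (nat \<Rightarrow> complex) \<Rightarrow> nat \<Rightarrow> complex" where
  "dil t a n = (if t dvd n then a (n div t) else 0)"

lemma dilate_q_expansion: "has_q_expansion f a \<Longrightarrow> t > 0 \<Longrightarrow> has_q_expansion (\<lambda>z. f (of_nat t * z)) (dil t a)"
  using has_q_expansion_dilate[of f a t] by (simp add: dil_def[abs_def])

text \<open>Coefficients of the logarithmic derivative, with respect to q d/dq, of
  \<open>eta_quotient_14\<close>.\<close>

definition order_8_coeff :: "nat \<Rightarrow> complex" where
  "order_8_coeff n = eisP_coeff n - 4 * dil 2 eisP_coeff n - 49 * dil 7 eisP_coeff n + 196 * dil 14 eisP_coeff n"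

text \<open>The valence formula leaves room for a form \<open>q\<^sup>8 + \<dots>\<close> of weight 4 and level 14; it would have to be
  an 18th root of the eta quotient, whose logarithmic derivative determines its coefficients.\<close>

lemma weight_4_level_14_order_8_recurrence:
  assumes f: "mform 4 14 f" "has_q_expansion f a" "\<And>n. n < 8 \<Longrightarrow> a n = 0"
  shows "18 * (of_nat n * a n) = (\<Sum>i\<le>n. a i * order_8_coeff (n - i))"
proof -
  obtain g where g: "has_q_expansion g (\<lambda>n. of_nat n * a n)"
    "\<And>z. z \<in> uhp \<Longrightarrow> (f has_field_derivative two_pi_i * g z) (at z)"
    using has_q_expansion_DERIV[OF f(2)] by blast
  define l where "l = (\<lambda>z. eisP z - 4 * eisP (of_nat 2 * z) - 49 * eisP (of_nat 7 * z) + 196 * eisP (of_nat 14 * z))"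
  have l: "has_q_expansion l order_8_coeff"
    unfolding l_def order_8_coeff_def[abs_def]
    by (intro has_q_expansion_add has_q_expansion_diff has_q_expansion_cmult eisP_q_expansion dilate_q_expansion) auto
  have eq: "f z ^ 18 = a 8 ^ 18 * eta_quotient_14 z" if "z \<in> uhp" for z
    by (rule weight_4_level_14_order_8[OF f that])
  show ?thesis
  proof (cases "a 8 = 0")
    case True
    have "a = (\<lambda>n. if n = 0 then 0 else 0)"
      by (rule has_q_expansion_unique[OF f(2) has_q_expansion_const[of 0]]) (use eq True in auto)
    then show ?thesis by simp
  next
    case False
    \<comment> \<open>Differentiate f^18 = const * eta quotient and cancel f^17; f has no zeros
      because the eta quotient has none.\<close>
    have "18 * g z = f z * l z" if z: "z \<in> uhp" for z
    proof -
      have 1: "((\<lambda>z. f z ^ 18) has_field_derivative of_nat 18 * (two_pi_i * g z * f z ^ (18 - Suc 0))) (at z)"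
        by (rule DERIV_power[OF g(2)[OF z]])
      have 2: "((\<lambda>z. a 8 ^ 18 * eta_quotient_14 z) has_field_derivative a 8 ^ 18 * (two_pi_i * l z * eta_quotient_14 z)) (at z)"
        unfolding l_def by (rule DERIV_cmult[OF eta_quotient_14_DERIV[OF z]])
      have "of_nat 18 * (two_pi_i * g z * f z ^ (18 - Suc 0)) = a 8 ^ 18 * (two_pi_i * l z * eta_quotient_14 z)"
        by (rule DERIV_unique_on_open[OF open_uhp z eq 1 2])
      also have "\<dots> = two_pi_i * (l z * f z ^ 18)"
        unfolding eq[OF z] by simp
      finally have "(two_pi_i) * (18 * g z * f z ^ 17) = (two_pi_i) * (l z * f z ^ 18)"
        by (simp add: mult_ac)
      then have "18 * g z * f z ^ 17 = l z * f z ^ 18"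
        by (metis mult_cancel_left complex_i_not_zero mult_eq_0_iff of_real_eq_0_iff pi_neq_zero zero_neq_numeral)
      moreover have "f z \<noteq> 0"
        using eq[OF z] False by (auto simp: eta_quotient_14_def eta_quotient_neq_0)
      moreover have "l z * f z ^ 18 = f z * l z * f z ^ 17"
        using power_Suc[of "f z" 17] by simp
      ultimately show ?thesis by simp
    qed
    from has_q_expansion_unique[OF has_q_expansion_cmult[OF g(1)] has_q_expansion_mult[OF f(2) l] this]
    show ?thesis by (simp add: fun_eq_iff)
  qed
qed

text \<open>The Sturm bound of this space, by the case \<open>a 8 = 0\<close> of the
  comparison.\<close>

lemma weight_4_level_14_order_9:
  assumes "mform 4 14 f" "has_q_expansion f a" "\<And>n. n \<le> 8 \<Longrightarrow> a n = 0"
  shows "a n = 0"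
proof -
  have "a = (\<lambda>n. if n = 0 then 0 else 0)"
    by (rule has_q_expansion_unique[OF assms(2) has_q_expansion_const[of 0]])
      (use weight_4_level_14_order_8[OF assms(1,2)] assms(3) in auto)
  then show ?thesis by (simp add: fun_eq_iff)
qed

section \<open>Tables of coefficients\<close>

lemma divisor_sigma_sum:
  assumes "n > 0"
  shows "divisor_sigma j n = (\<Sum>d\<le>n. if d dvd n then d ^ j else 0)"
proof -
  have "{d. d dvd n} = {d \<in> {..n}. d dvd n}"
    using assms by (auto dest: dvd_imp_le)
  then show ?thesis
    unfolding divisor_sigma_def by (simp only:) (rule sum.inter_filter, simp)
qed

lemma eisP_coeff_values:
  shows "eisP_coeff 0 = 1"
    "eisP_coeff (Suc 0) = - 24"
    "eisP_coeff 2 = - 72"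
    "eisP_coeff 3 = - 96"
    "eisP_coeff 4 = - 168"
    "eisP_coeff 5 = - 144"
    "eisP_coeff 6 = - 288"
    "eisP_coeff 7 = - 192"
    "eisP_coeff 8 = - 360"
    "eisP_coeff 9 = - 312"
    "eisP_coeff 10 = - 432"
    "eisP_coeff 11 = - 288"
    "eisP_coeff 12 = - 672"
    "eisP_coeff 13 = - 336"
    "eisP_coeff 14 = - 576"
  by (simp_all add: eisP_coeff_def divisor_sigma_sum atMost_nat_numeral)

lemma eisE_coeff_values:
  shows "eisE_coeff 0 = 1"
    "eisE_coeff (Suc 0) = 240"
    "eisE_coeff 2 = 2160"
    "eisE_coeff 3 = 6720"
    "eisE_coeff 4 = 17520"
    "eisE_coeff 5 = 30240"
    "eisE_coeff 6 = 60480"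
    "eisE_coeff 7 = 82560"
    "eisE_coeff 8 = 140400"
    "eisE_coeff 10 = 272160"
    "eisE_coeff 12 = 490560"
    "eisE_coeff 14 = 743040"
  by (simp_all add: eisE_coeff_def divisor_sigma_sum atMost_nat_numeral)

lemma order_8_coeff_values:
  shows "order_8_coeff 0 = 144"
    "order_8_coeff (Suc 0) = - 24"
    "order_8_coeff 2 = 24"
    "order_8_coeff 3 = - 96"
    "order_8_coeff 4 = 120"
    "order_8_coeff 5 = - 144"
    "order_8_coeff 6 = 96"
  by (simp_all add: order_8_coeff_def dil_def eisP_coeff_values)

text \<open>As \<open>order_8_coeff 0\<close> is 144 = 18 * 8, the recurrence has the factor 18 (n -
  8) in front of \<open>a n\<close>, and determines it for n > 8.\<close>

lemma weight_4_level_14_order_8_coeffs: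
  assumes f: "mform 4 14 f" "has_q_expansion f a" "\<And>n. n < 8 \<Longrightarrow> a n = 0"
  shows "a 10 = 14 / 9 * a 8" "a 12 = 1211 / 243 * a 8" "a 14 = 64430 / 6561 * a 8"
proof -
  note rec = weight_4_level_14_order_8_recurrence[OF f]
  have z: "a 0 = 0" "a (Suc 0) = 0" "a 2 = 0" "a 3 = 0" "a 4 = 0" "a 5 = 0" "a 6 = 0" "a 7 = 0"
    by (simp_all add: f(3))
  \<comment> \<open>6561 = 3^8 clears all denominators up to \<open>a 14\<close>.\<close>
  define b where "b = a 8 / 6561"
  have b: "a 8 = 6561 * b" by (simp add: b_def)
  have "18 * (9 * a 9) = a 8 * (- 24) + a 9 * 144"
    using rec[of 9] by (simp add: atMost_nat_numeral order_8_coeff_values z add_ac)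
  then have "18 * a 9 = 18 * (- 8748 * b)"
    using b  by algebra
  then have a9: "a 9 = - 8748 * b" by simp
  have "18 * (10 * a 10) = a 8 * 24 + a 9 * (- 24) + a 10 * 144"
    using rec[of 10] by (simp add: atMost_nat_numeral order_8_coeff_values z add_ac)
  then have "36 * a 10 = 36 * (10206 * b)"
    using b a9 by algebra
  then have a10: "a 10 = 10206 * b" by simp
  have "18 * (11 * a 11) = a 8 * (- 96) + a 9 * 24 + a 10 * (- 24) + a 11 * 144"
    using rec[of 11] by (simp add: atMost_nat_numeral order_8_coeff_values z add_ac)
  then have "54 * a 11 = 54 * (- 20088 * b)"
    using b a9 a10 by algebra
  then have a11: "a 11 = - 20088 * b" by simp
  have "18 * (12 * a 12) = a 8 * 120 + a 9 * (- 96) + a 10 * 24 + a 11 * (- 24) + a 12 * 144"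
    using rec[of 12] by (simp add: atMost_nat_numeral order_8_coeff_values z add_ac)
  then have "72 * a 12 = 72 * (32697 * b)"
    using b a9 a10 a11 by algebra
  then have a12: "a 12 = 32697 * b" by simp
  have "18 * (13 * a 13) = a 8 * (- 144) + a 9 * 120 + a 10 * (- 96) + a 11 * 24 + a 12 * (- 24) + a 13 * 144"
    using rec[of 13] by (simp add: atMost_nat_numeral order_8_coeff_values z add_ac)
  then have "90 * a 13 = 90 * (- 47124 * b)"
    using b a9 a10 a11 a12 by algebra
  then have a13: "a 13 = - 47124 * b" by simp
  have "18 * (14 * a 14) = a 8 * 96 + a 9 * (- 144) + a 10 * 120 + a 11 * (- 96) + a 12 * 24 + a 13 * (- 24) + a 14 * 144"
    using rec[of 14] by (simp add: atMost_nat_numeral order_8_coeff_values z add_ac)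
  then have "108 * a 14 = 108 * (64430 * b)"
    using b a9 a10 a11 a12 a13 by algebra
  then have a14: "a 14 = 64430 * b" by simp
  show "a 10 = 14 / 9 * a 8" "a 12 = 1211 / 243 * a 8" "a 14 = 64430 / 6561 * a 8"
    by (simp_all add: a10 a12 a14 b)
qed

definition psi_coeff :: "nat \<Rightarrow> nat \<Rightarrow> complex" where
  "psi_coeff t n = eisP_coeff n - of_nat t * dil t eisP_coeff n"

lemma eisPsi_q_expansion: "t > 0 \<Longrightarrow> has_q_expansion (eisPsi t) (psi_coeff t)"
  unfolding eisPsi_def[abs_def] psi_coeff_def[abs_def]
  by (intro has_q_expansion_diff has_q_expansion_cmult eisP_q_expansion dilate_q_expansion)

definition psi_prod_coeff :: "nat \<Rightarrow> nat \<Rightarrow> nat \<Rightarrow> complex" where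
  "psi_prod_coeff s t n = (\<Sum>i\<le>n. psi_coeff s i * psi_coeff t (n - i))"

lemma eisPsi_mult_q_expansion:
  "s > 0 \<Longrightarrow> t > 0 \<Longrightarrow> has_q_expansion (\<lambda>z. eisPsi s z * eisPsi t z) (psi_prod_coeff s t)"
  unfolding psi_prod_coeff_def[abs_def] by (intro has_q_expansion_mult eisPsi_q_expansion)

lemma eisPsi_mult_mform:
  "s > 0 \<Longrightarrow> t > 0 \<Longrightarrow> s dvd N \<Longrightarrow> t dvd N \<Longrightarrow> mform 4 N (\<lambda>z. eisPsi s z * eisPsi t z)"
  using mform_mult[OF eisPsi_mform[of s N] eisPsi_mform[of t N]] by simp

lemma psi_coeff_2_values:
  shows "psi_coeff 2 0 = - 1"
    "psi_coeff 2 (Suc 0) = - 24"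
    "psi_coeff 2 2 = - 24"
    "psi_coeff 2 3 = - 96"
    "psi_coeff 2 4 = - 24"
    "psi_coeff 2 5 = - 144"
    "psi_coeff 2 6 = - 96"
    "psi_coeff 2 7 = - 192"
    "psi_coeff 2 8 = - 24"
    "psi_coeff 2 9 = - 312"
    "psi_coeff 2 10 = - 144"
    "psi_coeff 2 11 = - 288"
    "psi_coeff 2 12 = - 96"
    "psi_coeff 2 13 = - 336"
    "psi_coeff 2 14 = - 192"
  by (simp_all add: psi_coeff_def dil_def eisP_coeff_values)

lemma psi_coeff_7_values:
  shows "psi_coeff 7 0 = - 6"
    "psi_coeff 7 (Suc 0) = - 24"
    "psi_coeff 7 2 = - 72"
    "psi_coeff 7 3 = - 96"
    "psi_coeff 7 4 = - 168"
    "psi_coeff 7 5 = - 144"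
    "psi_coeff 7 6 = - 288"
    "psi_coeff 7 7 = - 24"
    "psi_coeff 7 8 = - 360"
    "psi_coeff 7 9 = - 312"
    "psi_coeff 7 10 = - 432"
    "psi_coeff 7 11 = - 288"
    "psi_coeff 7 12 = - 672"
    "psi_coeff 7 13 = - 336"
    "psi_coeff 7 14 = - 72"
  by (simp_all add: psi_coeff_def dil_def eisP_coeff_values)

lemma psi_coeff_14_values:
  shows "psi_coeff 14 0 = - 13"
    "psi_coeff 14 (Suc 0) = - 24"
    "psi_coeff 14 2 = - 72"
    "psi_coeff 14 3 = - 96"
    "psi_coeff 14 4 = - 168"
    "psi_coeff 14 5 = - 144"
    "psi_coeff 14 6 = - 288"
    "psi_coeff 14 7 = - 192"
    "psi_coeff 14 8 = - 360"
    "psi_coeff 14 9 = - 312"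
    "psi_coeff 14 10 = - 432"
    "psi_coeff 14 11 = - 288"
    "psi_coeff 14 12 = - 672"
    "psi_coeff 14 13 = - 336"
    "psi_coeff 14 14 = - 240"
  by (simp_all add: psi_coeff_def dil_def eisP_coeff_values)

lemma psi_prod_coeff_7_7_values:
  shows "psi_prod_coeff 7 7 0 = 36"
    "psi_prod_coeff 7 7 (Suc 0) = 288"
    "psi_prod_coeff 7 7 2 = 1440"
    "psi_prod_coeff 7 7 3 = 4608"
    "psi_prod_coeff 7 7 4 = 11808"
    "psi_prod_coeff 7 7 5 = 23616"
    "psi_prod_coeff 7 7 6 = 43776"
    "psi_prod_coeff 7 7 7 = 67104"
    "psi_prod_coeff 7 7 8 = 102816"
    "psi_prod_coeff 7 7 10 = 194112"
    "psi_prod_coeff 7 7 12 = 354816"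
    "psi_prod_coeff 7 7 14 = 612000"
  by (simp_all add: psi_prod_coeff_def atMost_nat_numeral psi_coeff_7_values)

lemma psi_prod_coeff_14_14_values:
  shows "psi_prod_coeff 14 14 0 = 169"
    "psi_prod_coeff 14 14 (Suc 0) = 624"
    "psi_prod_coeff 14 14 2 = 2448"
    "psi_prod_coeff 14 14 3 = 5952"
    "psi_prod_coeff 14 14 4 = 14160"
    "psi_prod_coeff 14 14 5 = 25632"
    "psi_prod_coeff 14 14 6 = 47808"
    "psi_prod_coeff 14 14 7 = 71808"
    "psi_prod_coeff 14 14 8 = 115920"
    "psi_prod_coeff 14 14 10 = 232416"
    "psi_prod_coeff 14 14 12 = 412608"
    "psi_prod_coeff 14 14 14 = 653664"
  by (simp_all add: psi_prod_coeff_def atMost_nat_numeral psi_coeff_14_values)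

lemma psi_prod_coeff_2_7_values:
  shows "psi_prod_coeff 2 7 0 = 6"
    "psi_prod_coeff 2 7 (Suc 0) = 168"
    "psi_prod_coeff 2 7 2 = 792"
    "psi_prod_coeff 2 7 3 = 2976"
    "psi_prod_coeff 2 7 4 = 6648"
    "psi_prod_coeff 2 7 5 = 14832"
    "psi_prod_coeff 2 7 6 = 22752"
    "psi_prod_coeff 2 7 7 = 42648"
    "psi_prod_coeff 2 7 8 = 51192"
    "psi_prod_coeff 2 7 10 = 91152"
    "psi_prod_coeff 2 7 12 = 167136"
    "psi_prod_coeff 2 7 14 = 266184"
  by (simp_all add: psi_prod_coeff_def atMost_nat_numeral psi_coeff_2_values psi_coeff_7_values)

lemma psi_prod_coeff_2_14_values:
  shows "psi_prod_coeff 2 14 0 = 13"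
    "psi_prod_coeff 2 14 (Suc 0) = 336"
    "psi_prod_coeff 2 14 2 = 960"
    "psi_prod_coeff 2 14 3 = 3648"
    "psi_prod_coeff 2 14 4 = 6816"
    "psi_prod_coeff 2 14 5 = 15840"
    "psi_prod_coeff 2 14 6 = 23424"
    "psi_prod_coeff 2 14 7 = 44160"
    "psi_prod_coeff 2 14 8 = 55392"
    "psi_prod_coeff 2 14 10 = 108288"
    "psi_prod_coeff 2 14 12 = 192000"
    "psi_prod_coeff 2 14 14 = 299952"
  by (simp_all add: psi_prod_coeff_def atMost_nat_numeral psi_coeff_2_values psi_coeff_14_values)

section \<open>Identification of the cusp forms\<close>

text \<open>Besides the four dilates of E_4, products of weight 2 Eisenstein series are included;
  they reach the cusp forms while keeping every coefficient explicit.\<close>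

definition comb :: "complex list \<Rightarrow> complex \<Rightarrow> complex" where
  "comb cs z =
    cs ! 0 * eisE (of_nat 1 * z) + cs ! 1 * eisE (of_nat 2 * z) +
    cs ! 2 * eisE (of_nat 7 * z) + cs ! 3 * eisE (of_nat 14 * z) +
    cs ! 4 * (eisPsi 7 z * eisPsi 7 z) + cs ! 5 * (eisPsi 14 z * eisPsi 14 z) +
    cs ! 6 * (eisPsi 2 z * eisPsi 7 z) + cs ! 7 * (eisPsi 2 z * eisPsi 14 z)"

definition comb_coeff :: "complex list \<Rightarrow> nat \<Rightarrow> complex" where
  "comb_coeff cs n =
    cs ! 0 * dil 1 eisE_coeff n + cs ! 1 * dil 2 eisE_coeff n +
    cs ! 2 * dil 7 eisE_coeff n + cs ! 3 * dil 14 eisE_coeff n +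
    cs ! 4 * psi_prod_coeff 7 7 n + cs ! 5 * psi_prod_coeff 14 14 n +
    cs ! 6 * psi_prod_coeff 2 7 n + cs ! 7 * psi_prod_coeff 2 14 n"

lemma comb_mform: "mform 4 14 (comb cs)"
  unfolding comb_def[abs_def]
  by (intro mform_add mform_cmult eisE_dilate_mform eisPsi_mult_mform) auto

lemma comb_q_expansion: "has_q_expansion (comb cs) (comb_coeff cs)"
  unfolding comb_def[abs_def] comb_coeff_def[abs_def]
  by (intro has_q_expansion_add has_q_expansion_cmult dilate_q_expansion eisE_q_expansion eisPsi_mult_q_expansion) auto

lemmas psi_prod_values = psi_prod_coeff_7_7_values psi_prod_coeff_14_14_values
  psi_prod_coeff_2_7_values psi_prod_coeff_2_14_values

text \<open>The coefficient lists come from row reduction of the eight generators of \<open>comb\<close>: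
  \<open>basis_i\<close> is the combination \<open>q\<^sup>i + O(q\<^sup>8)\<close>.\<close>

definition basis_3 :: "complex list" where
  "basis_3 = [41 / 46080, - 1 / 1280, 31 / 1536, 7 / 144, - 13 / 32256, - 23 / 64512, - 11 / 5376, 5 / 3584]"

lemma basis_3_values:
  shows "comb_coeff basis_3 0 = 0"
    "comb_coeff basis_3 (Suc 0) = 0"
    "comb_coeff basis_3 2 = 0"
    "comb_coeff basis_3 3 = 1"
    "comb_coeff basis_3 4 = 0"
    "comb_coeff basis_3 5 = 0"
    "comb_coeff basis_3 6 = 0"
    "comb_coeff basis_3 7 = 0"
    "comb_coeff basis_3 8 = 1"
    "comb_coeff basis_3 10 = 22"
    "comb_coeff basis_3 12 = 25"
    "comb_coeff basis_3 14 = 46"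
  by (simp_all add: basis_3_def comb_coeff_def dil_def eisE_coeff_values psi_prod_values)

definition basis_5 :: "complex list" where
  "basis_5 = [- 7 / 46080, - 1 / 11520, - 41 / 2560, 1 / 320, 1 / 32256, 5 / 64512, 1 / 1792, - 11 / 32256]"

lemma basis_5_values:
  shows "comb_coeff basis_5 0 = 0"
    "comb_coeff basis_5 (Suc 0) = 0"
    "comb_coeff basis_5 2 = 0"
    "comb_coeff basis_5 3 = 0"
    "comb_coeff basis_5 4 = 0"
    "comb_coeff basis_5 5 = 1"
    "comb_coeff basis_5 6 = 0"
    "comb_coeff basis_5 7 = 0"
    "comb_coeff basis_5 8 = - 1"
    "comb_coeff basis_5 10 = - 6"
    "comb_coeff basis_5 12 = - 9"
    "comb_coeff basis_5 14 = - 38"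
  by (simp_all add: basis_5_def comb_coeff_def dil_def eisE_coeff_values psi_prod_values)

definition basis_6 :: "complex list" where
  "basis_6 = [1 / 23040, - 1 / 5760, 1 / 576, - 1 / 320, 1 / 4032, - 1 / 32256, - 1 / 2016, 1 / 16128]"

lemma basis_6_values:
  shows "comb_coeff basis_6 0 = 0"
    "comb_coeff basis_6 (Suc 0) = 0"
    "comb_coeff basis_6 2 = 0"
    "comb_coeff basis_6 3 = 0"
    "comb_coeff basis_6 4 = 0"
    "comb_coeff basis_6 5 = 0"
    "comb_coeff basis_6 6 = 1"
    "comb_coeff basis_6 7 = 0"
    "comb_coeff basis_6 8 = 3"
    "comb_coeff basis_6 10 = 9"
    "comb_coeff basis_6 12 = 15"
    "comb_coeff basis_6 14 = 39"
  by (simp_all add: basis_6_def comb_coeff_def dil_def eisE_coeff_values psi_prod_values)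

definition basis_7 :: "complex list" where
  "basis_7 = [0, 0, 1 / 240, - 1 / 240, 0, 0, 0, 0]"

lemma basis_7_values:
  shows "comb_coeff basis_7 0 = 0"
    "comb_coeff basis_7 (Suc 0) = 0"
    "comb_coeff basis_7 2 = 0"
    "comb_coeff basis_7 3 = 0"
    "comb_coeff basis_7 4 = 0"
    "comb_coeff basis_7 5 = 0"
    "comb_coeff basis_7 6 = 0"
    "comb_coeff basis_7 7 = 1"
    "comb_coeff basis_7 8 = 0"
    "comb_coeff basis_7 10 = 0"
    "comb_coeff basis_7 12 = 0"
    "comb_coeff basis_7 14 = 8"
  by (simp_all add: basis_7_def comb_coeff_def dil_def eisE_coeff_values psi_prod_values)

text \<open>A combination without constant term, with first coefficient 1 and a(2n) = 2 a(n) for n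
  up to 7. It is matched with the given primitive form through these finitely many relations;
  \<open>newform_2\<close> plays the same role for the eigenvalue -2.\<close>

definition newform_1 :: "complex list" where
  "newform_1 = [- 1 / 320, 1 / 120, 49 / 384, - 49 / 96, - 1 / 384, 1 / 384, 1 / 192, 0]"

lemma newform_1_values:
  shows "comb_coeff newform_1 0 = 0"
    "comb_coeff newform_1 (Suc 0) = 1"
    "comb_coeff newform_1 2 = 2"
    "comb_coeff newform_1 3 = - 2"
    "comb_coeff newform_1 4 = 4"
    "comb_coeff newform_1 5 = - 12"
    "comb_coeff newform_1 6 = - 4"
    "comb_coeff newform_1 7 = 7"
    "comb_coeff newform_1 8 = 8"
    "comb_coeff newform_1 10 = - 24"
    "comb_coeff newform_1 12 = - 8"
    "comb_coeff newform_1 14 = 14"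
  by (simp_all add: newform_1_def comb_coeff_def dil_def eisE_coeff_values psi_prod_values)

definition newform_2 :: "complex list" where
  "newform_2 = [1 / 240, 1 / 60, 833 / 2880, 833 / 720, - 5 / 576, - 5 / 576, - 25 / 2016, 5 / 168]"

lemma newform_2_values:
  shows "comb_coeff newform_2 0 = 0"
    "comb_coeff newform_2 (Suc 0) = 1"
    "comb_coeff newform_2 2 = - 2"
    "comb_coeff newform_2 3 = 8"
    "comb_coeff newform_2 4 = 4"
    "comb_coeff newform_2 5 = - 14"
    "comb_coeff newform_2 6 = - 16"
    "comb_coeff newform_2 7 = - 7"
    "comb_coeff newform_2 8 = - 8"
    "comb_coeff newform_2 10 = 28"
    "comb_coeff newform_2 12 = 32"
    "comb_coeff newform_2 14 = 14"
  by (simp_all add: newform_2_def comb_coeff_def dil_def eisE_coeff_values psi_prod_values)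

text \<open>Subtracting the basis forms leaves a form of order at least 8, whose coefficient at q^8
  is \<open>t\<close> and whose later coefficients are known multiples of \<open>t\<close>. The
  integers are the basis coefficients at q^10, q^12 and q^14.\<close>

lemma level_14_relations:
  assumes g: "mform 4 14 g" "has_q_expansion g d" and z: "d 0 = 0" "d 1 = 0" "d 2 = 0" "d 4 = 0"
  defines "t \<equiv> d 8 - d 3 + d 5 - 3 * d 6"
  shows "d 10 = 22 * d 3 - 6 * d 5 + 9 * d 6 + 14 / 9 * t"
    and "d 12 = 25 * d 3 - 9 * d 5 + 15 * d 6 + 1211 / 243 * t"
    and "d 14 = 46 * d 3 - 38 * d 5 + 39 * d 6 + 8 * d 7 + 64430 / 6561 * t"
proof -
  define h where "h = (\<lambda>z. g z - (d 3 * comb basis_3 z + d 5 * comb basis_5 z + d 6 * comb basis_6 z + d 7 * comb basis_7 z))"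
  define e where "e = (\<lambda>n. d n - (d 3 * comb_coeff basis_3 n + d 5 * comb_coeff basis_5 n + d 6 * comb_coeff basis_6 n + d 7 * comb_coeff basis_7 n))"
  have h: "mform 4 14 h" "has_q_expansion h e"
    unfolding h_def e_def
    by (intro mform_diff mform_add mform_cmult g(1) comb_mform,
        intro has_q_expansion_diff has_q_expansion_add has_q_expansion_cmult g(2) comb_q_expansion)
  note vals = basis_3_values basis_5_values basis_6_values basis_7_values
  have "e n = 0" if "n < 8" for n
  proof -
    have "n \<in> {0, 1, 2, 3, 4, 5, 6, 7}" using that by auto
    then show ?thesis using z by (auto simp: e_def vals)
  qed
  then have c: "e 10 = 14 / 9 * e 8" "e 12 = 1211 / 243 * e 8" "e 14 = 64430 / 6561 * e 8"
    using weight_4_level_14_order_8_coeffs[OF h] by blast+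
  have e: "e 8 = t" "e 10 = d 10 - (22 * d 3 - 6 * d 5 + 9 * d 6)" "e 12 = d 12 - (25 * d 3 - 9 * d 5 + 15 * d 6)"
    "e 14 = d 14 - (46 * d 3 - 38 * d 5 + 39 * d 6 + 8 * d 7)"
    by (simp_all add: e_def vals t_def algebra_simps)
  show "d 10 = 22 * d 3 - 6 * d 5 + 9 * d 6 + 14 / 9 * t"
    "d 12 = 25 * d 3 - 9 * d 5 + 15 * d 6 + 1211 / 243 * t"
    "d 14 = 46 * d 3 - 38 * d 5 + 39 * d 6 + 8 * d 7 + 64430 / 6561 * t"
    using c unfolding e diff_eq_eq by (simp_all only: add.commute)
qed

text \<open>The relations at q^10 and q^12 involve only \<open>d 3\<close> and \<open>d 5\<close>
  and form a nonsingular 2 by 2 system; the relation at q^14 then reads s * d 7 = 8 * d 7.\<close>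

lemma U2_eigen_kernel:
  assumes g: "mform 4 14 g" "has_q_expansion g d" and s: "s = 2 \<or> s = - 2"
    and z: "d 0 = 0" "d 1 = 0" "d 2 = 0" "d 4 = 0" "d 8 = 0"
    and e: "d 6 = s * d 3" "d 10 = s * d 5" "d 12 = 4 * d 3" "d 14 = s * d 7"
  shows "d n = 0"
proof -
  define x y w where "x = d 3" and "y = d 5" and "w = d 7"
  define v where "v = (y - x - 3 * (s * x)) / 6561"
  have v: "6561 * v = y - x - 3 * (s * x)"
    by (simp add: v_def)
  have t: "d 8 - d 3 + d 5 - 3 * d 6 = 6561 * v"
    unfolding v by (simp add: x_def y_def e z)
  note r = level_14_relations[OF g z(1-4), unfolded t, unfolded e, folded x_def y_def w_def]
  have r1: "s * y = 22 * x - 6 * y + 9 * (s * x) + 10206 * v"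
    and r2: "4 * x = 25 * x - 9 * y + 15 * (s * x) + 32697 * v"
    and r3: "s * w = 46 * x - 38 * y + 39 * (s * x) + 8 * w + 64430 * v"
    using r by simp_all
  have "x = 0 \<and> y = 0 \<and> w = 0"
    using s
  proof
    assume s: "s = 2"
    \<comment> \<open>Up to sign, the determinant of the system for s = 2 after multiplying the two
      relations by 9 and 243; for s = -2 it is 18360.\<close>
    have "28584 * x = 0" "28584 * y = 0"
      using r1 r2 v unfolding s by algebra+
    then have "x = 0" "y = 0" by simp_all
    moreover from this r3 v have "6 * w = 0" unfolding s by simp
    ultimately show ?thesis by simp
  next
    assume s: "s = - 2"
    have "18360 * x = 0" "18360 * y = 0"
      using r1 r2 v unfolding s by algebra+
    then have "x = 0" "y = 0" by simp_all
    moreover from this r3 v have "10 * w = 0" unfolding s by simp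
    ultimately show ?thesis by simp
  qed
  then have 0: "d 3 = 0" "d 5 = 0" "d 7 = 0" by (auto simp: x_def y_def w_def)
  have "d n = 0" if "n \<le> 8" for n
  proof -
    have "n \<in> {0, 1, 2, 3, 4, 5, 6, 7, 8}" using that by auto
    then show ?thesis using z 0 e(1) by auto
  qed
  then show ?thesis
    by (rule weight_4_level_14_order_9[OF g])
qed

text \<open>The normalization and the eigenvalue fix the coefficients at 0, 1, 2, 4 and 8, so the
  difference of the two forms falls under the kernel lemma.\<close>

lemma U2_eigenform_coeff:
  assumes f: "mform 4 14 f" "has_q_expansion f a" "\<And>n. a (2 * n) = s * a n" "a 1 = 1"
    and g: "mform 4 14 g" "has_q_expansion g b" and s: "s = 2 \<or> s = - 2"
    and b: "b 0 = 0" "b 1 = 1" "b 2 = s" "b 4 = 4" "b 8 = 4 * s" "b 6 = s * b 3" "b 10 = s * b 5"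
      "b 12 = 4 * b 3" "b 14 = s * b 7"
  shows "a = b"
proof
  fix n
  have s2: "s * s = 4" using s by auto
  have a: "a 0 = 0" "a 2 = s" "a 4 = 4" "a 8 = 4 * s" "a 6 = s * a 3" "a 10 = s * a 5" "a 12 = 4 * a 3" "a 14 = s * a 7"
    using f(3)[of 0] f(3)[of 1] f(3)[of 2] f(3)[of 4] f(3)[of 3] f(3)[of 5] f(3)[of 6] f(3)[of 7] f(4) s s2 by auto
  have "a n - b n = 0"
  proof (rule U2_eigen_kernel[OF mform_diff[OF f(1) g(1)] has_q_expansion_diff[OF f(2) g(2)] s])
  qed (simp_all only: a b f(4) right_diff_distrib diff_self)
  then show "a n = b n" by simp
qed

lemma primitive_form_mform: "primitive_form k N f \<Longrightarrow> mform k N f"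
  by (simp add: primitive_form_def hecke_eigenform_def cusp_form_imp_mform)

lemma newform_1_unique:
  assumes "primitive_form 4 14 f" "has_q_expansion f a" "a 1 = 1" "a 2 = 2"
  shows "a = comb_coeff newform_1"
proof (rule U2_eigenform_coeff[OF primitive_form_mform[OF assms(1)] assms(2) _ assms(3) comb_mform comb_q_expansion])
  show "a (2 * n) = 2 * a n" for n
    using hecke_2_eigen_coeff[of 14 f a n] assms by (simp add: primitive_form_def)
qed (simp_all add: newform_1_values)

lemma newform_2_unique:
  assumes "primitive_form 4 14 f" "has_q_expansion f a" "a 1 = 1" "a 2 = - 2"
  shows "a = comb_coeff newform_2"
proof (rule U2_eigenform_coeff[OF primitive_form_mform[OF assms(1)] assms(2) _ assms(3) comb_mform comb_q_expansion])
  show "a (2 * n) = - 2 * a n" for n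
    using hecke_2_eigen_coeff[of 14 f a n] assms by (simp add: primitive_form_def)
qed (simp_all add: newform_2_values)

section \<open>The cusp form of level 7\<close>

definition comb7 :: "complex \<Rightarrow> complex \<Rightarrow> complex \<Rightarrow> complex \<Rightarrow> complex" where
  "comb7 c1 c2 c3 z = c1 * eisE (of_nat 1 * z) + c2 * eisE (of_nat 7 * z) + c3 * (eisPsi 7 z * eisPsi 7 z)"

definition comb7_coeff :: "complex \<Rightarrow> complex \<Rightarrow> complex \<Rightarrow> nat \<Rightarrow> complex" where
  "comb7_coeff c1 c2 c3 n = c1 * dil 1 eisE_coeff n + c2 * dil 7 eisE_coeff n + c3 * psi_prod_coeff 7 7 n"

lemma comb7_mform: "7 dvd N \<Longrightarrow> mform 4 N (comb7 c1 c2 c3)"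
  unfolding comb7_def[abs_def]
  by (intro mform_add mform_cmult eisE_dilate_mform eisPsi_mult_mform) auto

lemma comb7_q_expansion: "has_q_expansion (comb7 c1 c2 c3) (comb7_coeff c1 c2 c3)"
  unfolding comb7_def[abs_def] comb7_coeff_def[abs_def]
  by (intro has_q_expansion_add has_q_expansion_cmult dilate_q_expansion eisE_q_expansion eisPsi_mult_q_expansion) auto

text \<open>Inversion sends 7 * (-1/z) to -1/(z/7), which costs 7^4 = 2401 in E_4(7z). In
  \<open>eisPsi 7\<close> it leaves 1 - 1/7, whose square is 36/49.\<close>

lemma comb7_cusp_0_limit:
  "((\<lambda>z. comb7 c1 c2 c3 (- 1 / z) / z ^ 4) \<longlongrightarrow> c1 + c2 / 2401 + c3 * 36 / 49) im_top"
proof -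
  let ?k = "6 * \<i> / complex_of_real pi"
  have E: "eisE (- 1 / z) = z ^ 4 * eisE z" and P: "eisP (- 1 / z) = z\<^sup>2 * eisP z - ?k * z" if "z \<in> uhp" for z
    using eisE_mob[of 0 0 "- 1" 1 z] eisP_mob[of 0 0 "- 1" 1 z] that by (simp_all add: mob_def)
  have u: "z / 7 \<in> uhp" "7 * (- 1 / z) = - 1 / (z / 7)" if "z \<in> uhp" for z
    using that by (simp_all add: uhp_iff)
  have fl: "filterlim (\<lambda>z. z / 7) im_top im_top"
    using filterlim_affine_im_top[of 1 7 0] by simp
  have E7: "((\<lambda>z. eisE (z / 7)) \<longlongrightarrow> 1) im_top" and P7: "((\<lambda>z. eisP (z / 7)) \<longlongrightarrow> 1) im_top"
    using filterlim_compose[OF has_q_expansion_tendsto[OF eisE_q_expansion] fl]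
      filterlim_compose[OF has_q_expansion_tendsto[OF eisP_q_expansion] fl]
    by (simp_all add: eisE_coeff_values eisP_coeff_values)
  have E1: "(eisE \<longlongrightarrow> 1) im_top" and P1: "(eisP \<longlongrightarrow> 1) im_top"
    using has_q_expansion_tendsto[OF eisE_q_expansion] has_q_expansion_tendsto[OF eisP_q_expansion]
    by (simp_all add: eisE_coeff_values eisP_coeff_values)
  have "((\<lambda>z. c1 * eisE z + c2 * (eisE (z / 7) / 2401) + c3 * ((eisP z - eisP (z / 7) / 7) * (eisP z - eisP (z / 7) / 7))) \<longlongrightarrow>
      c1 * 1 + c2 * (1 / 2401) + c3 * ((1 - 1 / 7) * (1 - 1 / 7))) im_top"
    by (intro tendsto_intros E1 E7 P1 P7) auto
  moreover have "eventually (\<lambda>z. c1 * eisE z + c2 * (eisE (z / 7) / 2401) + c3 * ((eisP z - eisP (z / 7) / 7) * (eisP z - eisP (z / 7) / 7)) =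
      comb7 c1 c2 c3 (- 1 / z) / z ^ 4) im_top"
    using eventually_uhp_im_top
  proof eventually_elim
    case (elim z)
    have z0: "z \<noteq> 0" using elim by (rule uhp_neq_0)
    have e7: "eisE (7 * (- 1 / z)) = (z / 7) ^ 4 * eisE (z / 7)" "eisP (7 * (- 1 / z)) = (z / 7)\<^sup>2 * eisP (z / 7) - ?k * (z / 7)"
      unfolding u(2)[OF elim] by (rule E[OF u(1)[OF elim]], rule P[OF u(1)[OF elim]])
    have psi: "eisPsi 7 (- 1 / z) = z\<^sup>2 * (eisP z - eisP (z / 7) / 7)"
      unfolding eisPsi_def of_nat_numeral e7 P[OF elim] by (simp add: power2_eq_square algebra_simps)
    show ?case
      unfolding comb7_def of_nat_numeral of_nat_1 mult_1_left e7 psi E[OF elim]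
      using z0 by (simp add: field_simps eval_nat_numeral)
  qed
  ultimately have "((\<lambda>z. comb7 c1 c2 c3 (- 1 / z) / z ^ 4) \<longlongrightarrow> c1 * 1 + c2 * (1 / 2401) + c3 * ((1 - 1 / 7) * (1 - 1 / 7))) im_top"
    by (rule Lim_transform_eventually)
  then show ?thesis by simp
qed

text \<open>The three constants are the solution of: value 0 at infinity, value 0 at the cusp 0, and
  first coefficient 1.\<close>

definition cusp7 :: "complex \<Rightarrow> complex" where
  "cusp7 = comb7 (- 1 / 160) (- 49 / 160) (5 / 576)"

definition cusp7_coeff :: "nat \<Rightarrow> complex" where
  "cusp7_coeff = comb7_coeff (- 1 / 160) (- 49 / 160) (5 / 576)"

lemma cusp7_coeff_values:
  shows "cusp7_coeff 0 = 0"
    "cusp7_coeff (Suc 0) = 1"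
    "cusp7_coeff 2 = - 1"
    "cusp7_coeff 3 = - 2"
    "cusp7_coeff 4 = - 7"
    "cusp7_coeff 5 = 16"
    "cusp7_coeff 6 = 2"
    "cusp7_coeff 7 = - 7"
    "cusp7_coeff 8 = 15"
  by (simp_all add: cusp7_coeff_def comb7_coeff_def dil_def eisE_coeff_values psi_prod_values)

text \<open>The auxiliary form \<open>B\<close> starts with q^2 and has the nonzero value 1/2401 at
  the cusp 0. Subtracting \<open>cusp7\<close> and a multiple of \<open>B\<close> gives order 3,
  hence zero; vanishing at the cusp 0 then forces the multiple to be 0.\<close>

lemma cusp7_unique:
  assumes "cusp_form 4 7 f" "has_q_expansion f a" "a 1 = 1"
  shows "a = cusp7_coeff" "\<And>z. z \<in> uhp \<Longrightarrow> f z = cusp7 z"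
proof -
  define B where "B = comb7 (1 / 960) (29 / 960) (- 1 / 1152)"
  define B_coeff where "B_coeff = comb7_coeff (1 / 960) (29 / 960) (- 1 / 1152)"
  have slash0: "(slash 4 f A \<longlongrightarrow> 0) im_top" if "det A = 1" for A
    using assms(1) that by (simp add: cusp_form_def SL2Z_def)
  have "(f \<longlongrightarrow> 0) im_top"
    using slash0[OF det_I] by (simp add: slash_def[abs_def] mat_def)
  then have a0: "a 0 = 0"
    using has_q_expansion_tendsto[OF assms(2)] tendsto_unique im_top_neq_bot by blast
  define A :: "int^2^2" where "A = vector [vector [0, - 1], vector [1, 0]]"
  have "det A = 1" by (simp add: A_def det_2)
  from slash0[OF this] have lim_f: "((\<lambda>z. f (- 1 / z) / z ^ 4) \<longlongrightarrow> 0) im_top"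
    by (simp add: slash_def[abs_def] A_def)
  define \<beta> where "\<beta> = a 2 + 1"
  define h where "h = (\<lambda>z. f z - cusp7 z - \<beta> * B z)"
  define e where "e = (\<lambda>n. a n - cusp7_coeff n - \<beta> * B_coeff n)"
  have h: "mform 4 7 h" "has_q_expansion h e"
    unfolding h_def e_def cusp7_def cusp7_coeff_def B_def B_coeff_def
    by (intro mform_diff mform_cmult comb7_mform cusp_form_imp_mform assms dvd_refl,
        intro has_q_expansion_diff has_q_expansion_cmult comb7_q_expansion assms)
  have B_values: "B_coeff 0 = 0" "B_coeff (Suc 0) = 0" "B_coeff 2 = 1"
    by (simp_all add: B_coeff_def comb7_coeff_def dil_def eisE_coeff_values psi_prod_values)
  have "e n = 0" if "n < 3" for n
  proof -
    have "n \<in> {0, 1, 2}" using that by auto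
    then show ?thesis
      using a0 assms(3) by (auto simp: e_def \<beta>_def B_values cusp7_coeff_values)
  qed
  then have h0: "h w = 0" if "w \<in> uhp" for w
    using weight_4_level_7_order_3[OF h _ that] by blast
  have "((\<lambda>z. f (- 1 / z) / z ^ 4 - cusp7 (- 1 / z) / z ^ 4 - \<beta> * (B (- 1 / z) / z ^ 4)) \<longlongrightarrow> 0 - 0 - \<beta> * (1 / 2401)) im_top"
    using comb7_cusp_0_limit[of "- 1 / 160" "- 49 / 160" "5 / 576"] comb7_cusp_0_limit[of "1 / 960" "29 / 960" "- 1 / 1152"]
    by (intro tendsto_diff tendsto_mult tendsto_const lim_f) (simp_all add: cusp7_def B_def)
  moreover have "eventually (\<lambda>z. f (- 1 / z) / z ^ 4 - cusp7 (- 1 / z) / z ^ 4 - \<beta> * (B (- 1 / z) / z ^ 4) = 0) im_top"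
    using eventually_uhp_im_top
  proof eventually_elim
    case (elim z)
    have "f (- 1 / z) / z ^ 4 - cusp7 (- 1 / z) / z ^ 4 - \<beta> * (B (- 1 / z) / z ^ 4) = h (- 1 / z) / z ^ 4"
      unfolding h_def by (simp only: diff_divide_distrib times_divide_eq_right)
    then show ?case
      using h0[OF uhp_minus_inverse[OF elim]] by simp
  qed
  ultimately have "((\<lambda>z. 0) \<longlongrightarrow> 0 - 0 - \<beta> * (1 / 2401)) im_top"
    by (rule Lim_transform_eventually)
  then have "\<beta> = 0"
    by (simp add: tendsto_const_iff)
  then show eq: "f z = cusp7 z" if "z \<in> uhp" for z
    using h0[OF that] by (simp add: h_def)
  show "a = cusp7_coeff"
    by (rule has_q_expansion_unique[OF assms(2) _ eq]) (simp_all add: cusp7_def cusp7_coeff_def comb7_q_expansion)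
qed

text \<open>\<open>eisPsi 7\<close> at 2z is half the difference of \<open>eisPsi 14\<close> and
  \<open>eisPsi 2\<close> at z, because P(z) cancels.\<close>

lemma cusp7_dilate_mform: "mform 4 14 (\<lambda>z. cusp7 (of_nat 2 * z))"
proof -
  define \<psi> where "\<psi> = (\<lambda>z. 1 / 2 * (eisPsi 14 z - eisPsi 2 z))"
  have \<psi>: "\<psi> z = eisPsi 7 (of_nat 2 * z)" for z
    by (simp add: \<psi>_def eisPsi_def)
  have "mform 2 14 \<psi>"
    unfolding \<psi>_def by (intro mform_cmult mform_diff eisPsi_mform) auto
  from mform_mult[OF this this] have "mform 4 14 (\<lambda>z. \<psi> z * \<psi> z)" by simp
  moreover have "mform 4 14 (\<lambda>z. eisE (of_nat 2 * z))" "mform 4 14 (\<lambda>z. eisE (of_nat 14 * z))"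
    by (intro eisE_dilate_mform; simp)+
  ultimately have "mform 4 14 (\<lambda>z. (- 1 / 160) * eisE (of_nat 2 * z) + (- 49 / 160) * eisE (of_nat 14 * z) + (5 / 576) * (\<psi> z * \<psi> z))"
    by (intro mform_add mform_cmult)
  then show ?thesis
    by (rule mform_cong[rotated]) (simp add: cusp7_def comb7_def \<psi> mult.assoc[symmetric])
qed

section \<open>The square of \<open>eisPsi 14\<close> and the convolution sum\<close>

text \<open>The difference of the two sides is a form of weight 4 and level 14, so agreement up to
  q^8 proves the identity for all n.\<close>

lemma psi_14_square_coeff_eq:
  "psi_prod_coeff 14 14 n = 111 / 125 * dil 1 eisE_coeff n - 56 / 125 * dil 2 eisE_coeff n - 686 / 125 * dil 7 eisE_coeff n
    + 21756 / 125 * dil 14 eisE_coeff n + 3456 / 25 * cusp7_coeff n + 13824 / 25 * dil 2 cusp7_coeff n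
    + 192 * comb_coeff newform_1 n + 2016 / 25 * comb_coeff newform_2 n"
proof -
  define f where "f = (\<lambda>z. eisPsi 14 z * eisPsi 14 z - (111 / 125 * eisE (of_nat 1 * z) - 56 / 125 * eisE (of_nat 2 * z)
    - 686 / 125 * eisE (of_nat 7 * z) + 21756 / 125 * eisE (of_nat 14 * z) + 3456 / 25 * cusp7 z
    + 13824 / 25 * cusp7 (of_nat 2 * z) + 192 * comb newform_1 z + 2016 / 25 * comb newform_2 z))"
  define a where "a = (\<lambda>n. psi_prod_coeff 14 14 n - (111 / 125 * dil 1 eisE_coeff n - 56 / 125 * dil 2 eisE_coeff n
    - 686 / 125 * dil 7 eisE_coeff n + 21756 / 125 * dil 14 eisE_coeff n + 3456 / 25 * cusp7_coeff n
    + 13824 / 25 * dil 2 cusp7_coeff n + 192 * comb_coeff newform_1 n + 2016 / 25 * comb_coeff newform_2 n))"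
  have c7: "mform 4 14 cusp7" "has_q_expansion cusp7 cusp7_coeff"
    unfolding cusp7_def cusp7_coeff_def by (simp_all add: comb7_mform comb7_q_expansion)
  have f: "mform 4 14 f"
    unfolding f_def by (intro mform_diff mform_add mform_cmult eisPsi_mult_mform eisE_dilate_mform c7 cusp7_dilate_mform
        comb_mform) auto
  have fa: "has_q_expansion f a"
    unfolding f_def a_def
    by (intro has_q_expansion_diff has_q_expansion_add has_q_expansion_cmult eisPsi_mult_q_expansion dilate_q_expansion
        eisE_q_expansion c7 comb_q_expansion) auto
  have "a n = 0" if "n \<le> 8" for n
  proof -
    have "n \<in> {0, 1, 2, 3, 4, 5, 6, 7, 8}" using that by auto
    then show ?thesis
      by (auto simp: a_def dil_def psi_prod_values eisE_coeff_values cusp7_coeff_values newform_1_values newform_2_values)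
  qed
  from weight_4_level_14_order_9[OF f fa this] show ?thesis
    by (simp add: a_def)
qed

text \<open>Expand the square: Ramanujan's identity evaluates P(z)^2 and P(14z)^2, and the mixed
  term -28 P(z) P(14z) carries the convolution.\<close>

lemma psi_14_square_coeff:
  "psi_prod_coeff 14 14 n = eisE_coeff n + 12 * of_nat n * eisP_coeff n
    - 28 * (\<Sum>i\<le>n. dil 14 eisP_coeff i * eisP_coeff (n - i))
    + 196 * dil 14 (\<lambda>m. eisE_coeff m + 12 * of_nat m * eisP_coeff m) n"
proof -
  have sq: "has_q_expansion (\<lambda>z. eisP z * eisP z) (\<lambda>n. eisE_coeff n + 12 * of_nat n * eisP_coeff n)"
    using has_q_expansion_mult[OF eisP_q_expansion eisP_q_expansion] by (simp add: eisP_square_coeff)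
  have "has_q_expansion (\<lambda>z. eisP z * eisP z - 28 * (eisP (of_nat 14 * z) * eisP z)
      + 196 * (\<lambda>z. eisP z * eisP z) (of_nat 14 * z))
    (\<lambda>n. eisE_coeff n + 12 * of_nat n * eisP_coeff n
    - 28 * (\<Sum>i\<le>n. dil 14 eisP_coeff i * eisP_coeff (n - i))
    + 196 * dil 14 (\<lambda>m. eisE_coeff m + 12 * of_nat m * eisP_coeff m) n)"
    by (intro has_q_expansion_add has_q_expansion_diff has_q_expansion_cmult has_q_expansion_mult
        dilate_q_expansion[OF eisP_q_expansion] dilate_q_expansion[OF sq] sq eisP_q_expansion) auto
  from has_q_expansion_unique[OF eisPsi_mult_q_expansion this, of 14 14] show ?thesis
    by (simp add: fun_eq_iff eisPsi_def algebra_simps)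
qed

text \<open>The index i = 14 m contributes 24^2 = 576 times a term of the convolution, except for m
  = 0 and, when 14 divides n, m = n/14: there one factor is the constant term 1 of P.\<close>

lemma conv_W_coeff:
  assumes "n > 0"
  shows "(\<Sum>i\<le>n. dil 14 eisP_coeff i * eisP_coeff (n - i)) =
    576 * of_nat (conv_W 14 n) - 24 * of_nat (divisor_sigma 1 n) - 24 * of_nat (if 14 dvd n then divisor_sigma 1 (n div 14) else 0)"
proof -
  let ?p = eisP_coeff and ?\<sigma> = "divisor_sigma 1"
  define M where "M = {m. 0 < m \<and> 14 * m < n}"
  have fin: "finite M"
    by (rule finite_subset[of _ "{..n}"]) (auto simp: M_def)
  have p: "?p 0 = 1" "m > 0 \<Longrightarrow> ?p m = - 24 * of_nat (?\<sigma> m)" for m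
    by (simp_all add: eisP_coeff_def)
  have "(\<Sum>i\<le>n. dil 14 ?p i * ?p (n - i)) = (\<Sum>i\<in>(*) 14 ` {m. 14 * m \<le> n}. dil 14 ?p i * ?p (n - i))"
    by (rule sum.mono_neutral_right) (auto simp: dil_def elim!: dvdE)
  also have "\<dots> = (\<Sum>m\<in>{m. 14 * m \<le> n}. ?p m * ?p (n - 14 * m))"
    by (subst sum.reindex) (auto simp: inj_on_def dil_def)
  also have "{m. 14 * m \<le> n} = insert 0 (M \<union> (if 14 dvd n then {n div 14} else {}))"
    using assms by (auto simp: M_def le_less)
  also have "(\<Sum>m\<in>insert 0 (M \<union> (if 14 dvd n then {n div 14} else {})). ?p m * ?p (n - 14 * m)) =
      ?p n + (\<Sum>m\<in>M \<union> (if 14 dvd n then {n div 14} else {}). ?p m * ?p (n - 14 * m))"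
    using fin assms by (subst sum.insert) (auto simp: M_def p(1))
  also have "(\<Sum>m\<in>M \<union> (if 14 dvd n then {n div 14} else {}). ?p m * ?p (n - 14 * m)) =
      (\<Sum>m\<in>M. ?p m * ?p (n - 14 * m)) + (if 14 dvd n then ?p (n div 14) else 0)"
    using fin assms by (subst sum.union_disjoint) (auto simp: M_def p(1))
  also have "(\<Sum>m\<in>M. ?p m * ?p (n - 14 * m)) = (\<Sum>m\<in>M. 576 * of_nat (?\<sigma> m * ?\<sigma> (n - 14 * m)))"
    by (rule sum.cong) (auto simp: M_def p(2))
  also have "\<dots> = 576 * of_nat (conv_W 14 n)"
    by (simp add: conv_W_def M_def sum_distrib_left)
  also have "?p n = - 24 * of_nat (?\<sigma> n)"
    using assms by (rule p(2))
  also have "(if 14 dvd n then ?p (n div 14) else 0) = - 24 * of_nat (if 14 dvd n then ?\<sigma> (n div 14) else 0)"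
    using assms by (auto simp: p(2) elim!: dvdE)
  finally show ?thesis by (simp add: algebra_simps)
qed

theorem theorem4:
  fixes \<Delta>7 \<Delta>14_1 \<Delta>14_2 :: "complex \<Rightarrow> complex"
    and \<tau>7 \<tau>14_1 \<tau>14_2 :: "nat \<Rightarrow> complex"
    and n :: nat
  assumes "cusp_form 4 7 \<Delta>7" "has_q_expansion \<Delta>7 \<tau>7" "\<tau>7 1 = 1"
    and "primitive_form 4 14 \<Delta>14_1" "has_q_expansion \<Delta>14_1 \<tau>14_1" "\<tau>14_1 1 = 1" "\<tau>14_1 2 = 2"
    and "primitive_form 4 14 \<Delta>14_2" "has_q_expansion \<Delta>14_2 \<tau>14_2" "\<tau>14_2 1 = 1" "\<tau>14_2 2 = -2"
    and "n > 0"
  shows "of_nat (conv_W 14 n) =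
      1 / 600 * of_nat (divisor_sigma 3 n)
    + 1 / 150 * of_nat (zero_ext (divisor_sigma 3) (of_nat n / 2))
    + 49 / 600 * of_nat (zero_ext (divisor_sigma 3) (of_nat n / 7))
    + 49 / 150 * of_nat (zero_ext (divisor_sigma 3) (of_nat n / 14))
    - 1 / 56 * of_nat n * of_nat (divisor_sigma 1 n)
    - 1 / 4 * of_nat n * of_nat (zero_ext (divisor_sigma 1) (of_nat n / 14))
    + 1 / 24 * of_nat (divisor_sigma 1 n)
    + 1 / 24 * of_nat (zero_ext (divisor_sigma 1) (of_nat n / 14))
    - 3 / 350 * \<tau>7 n
    - 6 / 175 * zero_ext \<tau>7 (of_nat n / 2)
    - 1 / 84 * \<tau>14_1 n
    - 1 / 200 * \<tau>14_2 n"
proof -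
  let ?\<sigma>1 = "\<lambda>t. if t dvd n then divisor_sigma 1 (n div t) else 0"
  let ?\<sigma>3 = "\<lambda>t. if t dvd n then divisor_sigma 3 (n div t) else 0"
  have n: "n > 0" by fact
  have E: "dil t eisE_coeff n = 240 * of_nat (?\<sigma>3 t)" for t
    using n by (auto simp: dil_def eisE_coeff_def elim!: dvdE)
  \<comment> \<open>The factor is 12 * 24 / 14 = 144/7, since m = n/14.\<close>
  have D: "dil 14 (\<lambda>m. eisE_coeff m + 12 * of_nat m * eisP_coeff m) n =
      240 * of_nat (?\<sigma>3 14) - 144 / 7 * of_nat n * of_nat (?\<sigma>1 14)"
    using n by (auto simp: dil_def eisE_coeff_def eisP_coeff_def elim!: dvdE)
  have \<tau>7: "\<tau>7 = cusp7_coeff"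
    by (rule cusp7_unique[OF assms(1-3)])
  have \<tau>14: "\<tau>14_1 = comb_coeff newform_1" "\<tau>14_2 = comb_coeff newform_2"
    by (rule newform_1_unique[OF assms(4-7)], rule newform_2_unique[OF assms(8-11)])
  have z: "zero_ext f (of_nat n / 2) = (if 2 dvd n then f (n div 2) else 0)"
    "zero_ext f (of_nat n / 7) = (if 7 dvd n then f (n div 7) else 0)"
    "zero_ext f (of_nat n / 14) = (if 14 dvd n then f (n div 14) else 0)" for f :: "nat \<Rightarrow> 'b::zero"
    using zero_ext_divide[OF n, of 2 f] zero_ext_divide[OF n, of 7 f] zero_ext_divide[OF n, of 14 f] by simp_all
  define W s1 s2 s7 s14 r1 r14 N t1 t2 u1 u2 where defs: "W = complex_of_nat (conv_W 14 n)"
    "s1 = complex_of_nat (divisor_sigma 3 n)" "s2 = complex_of_nat (?\<sigma>3 2)" "s7 = complex_of_nat (?\<sigma>3 7)"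
    "s14 = complex_of_nat (?\<sigma>3 14)" "r1 = complex_of_nat (divisor_sigma 1 n)" "r14 = complex_of_nat (?\<sigma>1 14)"
    "N = complex_of_nat n" "t1 = cusp7_coeff n" "t2 = dil 2 cusp7_coeff n" "u1 = comb_coeff newform_1 n" "u2 = comb_coeff newform_2 n"
  \<comment> \<open>The two evaluations of the n-th coefficient of the square of
    \<open>eisPsi 14\<close> are equated and then solved for W.\<close>
  have "240 * s1 - 288 * N * r1 - 28 * (576 * W - 24 * r1 - 24 * r14) + 196 * (240 * s14 - 144 / 7 * N * r14) =
      111 / 125 * (240 * s1) - 56 / 125 * (240 * s2) - 686 / 125 * (240 * s7) + 21756 / 125 * (240 * s14)
      + 3456 / 25 * t1 + 13824 / 25 * t2 + 192 * u1 + 2016 / 25 * u2"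
    using psi_14_square_coeff[of n] unfolding psi_14_square_coeff_eq conv_W_coeff[OF n] D E
    using n by (simp add: defs eisE_coeff_def eisP_coeff_def algebra_simps)
  \<comment> \<open>4375 = 5^4 * 7 clears the denominators 7, 25 and 125; W then has the factor 4375
    * 28 * 576 = 70560000.\<close>
  from arg_cong[OF this, of "\<lambda>x. 4375 * x"]
  have "1050000 * s1 - 1260000 * (N * r1) - 122500 * (576 * W - 24 * r1 - 24 * r14) + 196 * (1050000 * s14 - 90000 * (N * r14)) =
      932400 * s1 - 470400 * s2 - 5762400 * s7 + 182750400 * s14 + 604800 * t1 + 2419200 * t2 + 840000 * u1 + 352800 * u2"
    by (simp add: algebra_simps)
  then have "70560000 * W = 117600 * s1 + 470400 * s2 + 5762400 * s7 + 23049600 * s14 - 1260000 * (N * r1)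
      - 17640000 * (N * r14) + 2940000 * r1 + 2940000 * r14 - 604800 * t1 - 2419200 * t2 - 840000 * u1 - 352800 * u2"
    by algebra
  then have "70560000 * W = 70560000 * (1 / 600 * s1 + 1 / 150 * s2 + 49 / 600 * s7 + 49 / 150 * s14
      - 1 / 56 * N * r1 - 1 / 4 * N * r14 + 1 / 24 * r1 + 1 / 24 * r14
      - 3 / 350 * t1 - 6 / 175 * t2 - 1 / 84 * u1 - 1 / 200 * u2)"
    by (simp add: algebra_simps)
  then have "W = 1 / 600 * s1 + 1 / 150 * s2 + 49 / 600 * s7 + 49 / 150 * s14
      - 1 / 56 * N * r1 - 1 / 4 * N * r14 + 1 / 24 * r1 + 1 / 24 * r14
      - 3 / 350 * t1 - 6 / 175 * t2 - 1 / 84 * u1 - 1 / 200 * u2"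
    by (simp only: mult_cancel_left) simp
  then show ?thesis
    unfolding z \<tau>7 \<tau>14 defs dil_def .
qed

end
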